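(* Let $G$ be a connected simple Lie group with finite centre, $K$ a maximal compact subgroup with $\mathrm{rank}(G)=\mathrm{rank}(K)$, and let $\mathfrak{g},\mathfrak{k},\mathfrak{p},\mathfrak{h},\Delta,\Delta_\mathfrak{k}$ be as in the context. Assume that $\mathfrak{k}$ is semisimple. Fix a positive root system $P_\mathfrak{k}$ of $\Delta_\mathfrak{k}$ and a Borel-de Siebenthal positive root system $P$ of $\Delta$ containing $P_\mathfrak{k}$, with set of simple roots $\Phi$, unique non-compact simple root $\nu$, highest root $\delta$, and let $\Phi_0=\Phi\setminus\{\nu\}$, $w^0_{\mathfrak{l}_0}$, $\lambda=w^0_{\mathfrak{l}_0}(\nu)$, $\epsilon=w^0_{\mathfrak{l}_0}(\delta)$, and $\Phi_\mathfrak{k}=\Phi_0\cup\{\epsilon\}$ (the set of simple roots of $P_\mathfrak{k}$) be as in the context. (1) Let $\phi'\in\Phi_0$ be such that $n_{\phi'}(\delta)=1$, and let $\phi\in\Phi_0$ be such that $w^0_{\mathfrak{l}_0}(\phi')=-\phi$. Let $\mathfrak{l}'_0$ be the reductive subalgebra of $\mathfrak{k}$ containing $\mathfrak{h}$ such that the Dynkin diagram of $[\mathfrak{l}'_0,\mathfrak{l}'_0]$ is the subdiagram of the Dynkin diagram of $\mathfrak{k}$ with vertices $\Phi_\mathfrak{k}\setminus\{\phi\}$. Let $\nu'$ be the lowest weight of the irreducible $\mathfrak{l}'_0$-submodule of $\mathfrak{p}$ with highest weight $\lambda$, relative to the positive root system of $\Delta(\mathfrak{l}'_0,\mathfrak{h})$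 whose simple roots are $\Phi_\mathfrak{k}\setminus\{\phi\}$. Then $(\Phi_\mathfrak{k}\setminus\{\phi\})\cup\{\nu'\}$ is the set of all simple roots of a Borel-de Siebenthal positive root system of $\Delta$ containing $P_\mathfrak{k}$. (2) Conversely, every Borel-de Siebenthal positive root system of $\Delta$ containing $P_\mathfrak{k}$ is either $P$ or has the form described in (1), i.e. its set of simple roots is $(\Phi_\mathfrak{k}\setminus\{\phi\})\cup\{\nu'\}$ for $\phi$ and $\nu'$ obtained as in (1) from some $\phi'\in\Phi_0$ with $n_{\phi'}(\delta)=1$.
   Context: Setting. $\mathfrak{g}_0=\mathrm{Lie}(G)$, $\mathfrak{k}_0=\mathrm{Lie}(K)$, $\mathfrak{g}_0=\mathfrak{k}_0\oplus\mathfrak{p}_0$ is the Cartan decomposition, $\mathfrak{t}_0$ is a maximal abelian subalgebra of $\mathfrak{k}_0$, and $\mathfrak{g}=\mathfrak{g}_0^{\mathbb{C}}$, $\mathfrak{k}=\mathfrak{k}_0^{\mathbb{C}}$, $\mathfrak{p}=\mathfrak{p}_0^{\mathbb{C}}$, $\mathfrak{h}=\mathfrak{t}_0^{\mathbb{C}}$. By the equal rank hypothesis $\mathfrak{h}$ is a Cartan subalgebra of both $\mathfrak{g}$ and $\mathfrak{k}$. $\Delta=\Delta(\mathfrak{g},\mathfrak{h})$ is the root system of $\mathfrak g$, $\mathfrak{g}^\alpha$ is the root space of $\alpha$, and $\Delta_\mathfrak{k}=\Delta(\mathfrak{k},\mathfrak{h})$. A root $\alpha$ is compact if $\mathfrak{g}^\alpha\subset\mathfrak{k}$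 and non-compact if $\mathfrak{g}^\alpha\subset\mathfrak{p}$; every root is one or the other, and $\Delta_\mathfrak{k}$ is the set of compact roots. Borel-de Siebenthal positive root system: a positive root system of $\Delta$ whose set of simple roots contains exactly one non-compact root, say $\nu$, and such that the coefficient of $\nu$ in the highest root, expressed as a sum of simple roots, is $1$ if $\mathfrak{k}$ has non-zero centre and $2$ if $\mathfrak{k}$ is semisimple. Notation attached to $P$ (with $\mathfrak{k}$ semisimple). $P\supset P_\mathfrak{k}$ is a Borel-de Siebenthal positive root system, $\Phi$ its simple roots, $\nu\in\Phi$ the unique non-compact one, $\delta$ the highest root of $\mathfrak{g}$ with respect to $P$. For $\alpha\in\Delta$ and $\psi\in\Phi$, $n_\psi(\alpha)$ is the coefficient of $\psi$ in $\alpha$ expressed in the basis $\Phi$. For $i\neq 0$, $\mathfrak{l}_i=\bigoplus_{\alpha\in\Delta,\,n_\nu(\alpha)=i}\mathfrak{g}^\alpha$, and $\mathfrak{l}_0=\mathfrak{h}\oplus\bigoplus_{n_\nu(\alpha)=0}\mathfrak{g}^\alpha$; thus $\mathfrak{k}=\mathfrak{l}_{-2}\oplus\mathfrak{l}_0\oplus\mathfrak{l}_2$ and $\mathfrak{p}=\mathfrak{l}_{-1}\oplus\mathfrak{l}_1$. $\mathfrak{l}_0$ is reductive with Cartan subalgebra $\mathfrak{h}$; $\Delta_0=\Delta(\mathfrak{l}_0,\mathfrak{h})$, $P_0=\Delta_0\cap P_\mathfrak{k}$ is a positive root system of $\Delta_0$ with simple roots $\Phi_0=\Phi\setminus\{\nu\}$.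 $w^0_{\mathfrak{l}_0}$ is the longest element of the Weyl group of $(\mathfrak{l}_0,\mathfrak{h})$ with respect to $P_0$. The root $\lambda=w^0_{\mathfrak{l}_0}(\nu)$ is the highest weight of the irreducible $\mathfrak{l}_0$-module $\mathfrak{l}_1$ (relative to $P_0$) and of the irreducible $\mathfrak{k}$-module $\mathfrak{p}$ (relative to $P_\mathfrak{k}$). The root $\epsilon=w^0_{\mathfrak{l}_0}(\delta)$ is the lowest weight of the irreducible $\mathfrak{l}_0$-module $\mathfrak{l}_2$, and $\Phi_\mathfrak{k}=\Phi_0\cup\{\epsilon\}$ is the set of simple roots of $P_\mathfrak{k}$. *)

theory Defs
  imports "HOL-Analysis.Analysis" "HOL-Algebra.Group"
begin

section \<open>Lie groups and their Lie algebras\<close>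

text \<open>On open sets of finite-dimensional spaces this is the usual class \<open>C\<^sup>k\<close>: all partial
  derivatives up to order \<open>k\<close> exist and are continuous.\<close>

primrec Ck_on :: "nat \<Rightarrow> 'a::real_normed_vector set \<Rightarrow> ('a \<Rightarrow> 'b::real_normed_vector) \<Rightarrow> bool" where
  "Ck_on 0 S f \<longleftrightarrow> continuous_on S f"
| "Ck_on (Suc k) S f \<longleftrightarrow>
     (\<exists>f'. (\<forall>x\<in>S. (f has_derivative f' x) (at x)) \<and> (\<forall>v. Ck_on k S (\<lambda>x. f' x v)))"

definition smooth_on :: "'a::real_normed_vector set \<Rightarrow> ('a \<Rightarrow> 'b::real_normed_vector) \<Rightarrow> bool" where
  "smooth_on S f \<longleftrightarrow> (\<forall>k. Ck_on k S f)"

text \<open>A group \<open>G\<close> with a topology \<open>T\<close> on its carrier and a smooth atlas \<open>A\<close> of charts \<open>(U, \<phi>)\<close>.\<close>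

definition lie_group ::
  "('g, 'z) monoid_scheme \<Rightarrow> 'g topology \<Rightarrow> ('g set \<times> ('g \<Rightarrow> real^'n)) set \<Rightarrow> bool" where
  "lie_group G T A \<longleftrightarrow>
     group G \<and> topspace T = carrier G \<and> Hausdorff_space T \<and> second_countable T \<and>
     continuous_map (prod_topology T T) T (\<lambda>(x, y). x \<otimes>\<^bsub>G\<^esub> y) \<and>
     continuous_map T T (\<lambda>x. inv\<^bsub>G\<^esub> x) \<and>
     (\<Union>(U, \<phi>)\<in>A. U) = carrier G \<and>
     (\<forall>(U, \<phi>)\<in>A. openin T U \<and> open (\<phi> ` U) \<and>
        homeomorphic_map (subtopology T U) (top_of_set (\<phi> ` U)) \<phi>) \<and>
     (\<forall>(U, \<phi>)\<in>A. \<forall>(V, \<psi>)\<in>A. smooth_on (\<phi> ` (U \<inter> V)) (\<lambda>a. \<psi> (inv_into U \<phi> a))) \<and>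
     (\<forall>(U, \<phi>)\<in>A. \<forall>(V, \<psi>)\<in>A. \<forall>(W, \<omega>)\<in>A.
        smooth_on {(a, b). a \<in> \<phi> ` U \<and> b \<in> \<psi> ` V \<and> inv_into U \<phi> a \<otimes>\<^bsub>G\<^esub> inv_into V \<psi> b \<in> W}
          (\<lambda>(a, b). \<omega> (inv_into U \<phi> a \<otimes>\<^bsub>G\<^esub> inv_into V \<psi> b))) \<and>
     (\<forall>(U, \<phi>)\<in>A. \<forall>(W, \<omega>)\<in>A.
        smooth_on {a. a \<in> \<phi> ` U \<and> inv\<^bsub>G\<^esub> (inv_into U \<phi> a) \<in> W}
          (\<lambda>a. \<omega> (inv\<^bsub>G\<^esub> (inv_into U \<phi> a))))"

text \<open>Functions on the manifold are normalised to be \<open>0\<close> outside the carrier, operators on them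
  to be \<open>0\<close> outside the algebra of smooth functions, so that equality means what it should.\<close>

definition smooth_functions ::
  "('g, 'z) monoid_scheme \<Rightarrow> ('g set \<times> ('g \<Rightarrow> real^'n)) set \<Rightarrow> ('g \<Rightarrow> real) set" where
  "smooth_functions G A =
     {f. (\<forall>(U, \<phi>)\<in>A. smooth_on (\<phi> ` U) (\<lambda>a. f (inv_into U \<phi> a))) \<and> (\<forall>x. x \<notin> carrier G \<longrightarrow> f x = 0)}"

definition left_translate ::
  "('g, 'z) monoid_scheme \<Rightarrow> 'g \<Rightarrow> ('g \<Rightarrow> real) \<Rightarrow> ('g \<Rightarrow> real)" where
  "left_translate G a f = (\<lambda>x. if x \<in> carrier G then f (a \<otimes>\<^bsub>G\<^esub> x) else 0)"

definition left_invariant_fields ::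
  "('g, 'z) monoid_scheme \<Rightarrow> ('g set \<times> ('g \<Rightarrow> real^'n)) set \<Rightarrow> (('g \<Rightarrow> real) \<Rightarrow> ('g \<Rightarrow> real)) set" where
  "left_invariant_fields G A =
     {D. (\<forall>f\<in>smooth_functions G A. D f \<in> smooth_functions G A) \<and>
         (\<forall>f\<in>smooth_functions G A. \<forall>g\<in>smooth_functions G A.
            D (\<lambda>x. f x + g x) = (\<lambda>x. D f x + D g x) \<and>
            D (\<lambda>x. f x * g x) = (\<lambda>x. f x * D g x + g x * D f x)) \<and>
         (\<forall>f\<in>smooth_functions G A. \<forall>c. D (\<lambda>x. c * f x) = (\<lambda>x. c * D f x)) \<and>
         (\<forall>f\<in>smooth_functions G A. \<forall>a\<in>carrier G.
            D (left_translate G a f) = left_translate G a (D f)) \<and>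
         (\<forall>f. f \<notin> smooth_functions G A \<longrightarrow> D f = (\<lambda>x. 0))}"

text \<open>The space \<open>real^'n\<close> with bracket \<open>br\<close> is the Lie algebra of \<open>G\<close>: \<open>\<Lambda>\<close> identifies it with the
  Lie algebra of left-invariant vector fields (viewed as derivations) under the commutator bracket.\<close>

definition is_lie_algebra_of ::
  "('g, 'z) monoid_scheme \<Rightarrow> ('g set \<times> ('g \<Rightarrow> real^'n)) set \<Rightarrow>
   (real^'n \<Rightarrow> real^'n \<Rightarrow> real^'n) \<Rightarrow> (real^'n \<Rightarrow> ('g \<Rightarrow> real) \<Rightarrow> ('g \<Rightarrow> real)) \<Rightarrow> bool" where
  "is_lie_algebra_of G A br \<Lambda> \<longleftrightarrow>
     bij_betw \<Lambda> UNIV (left_invariant_fields G A) \<and>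
     (\<forall>X Y f. \<Lambda> (X + Y) f = (\<lambda>x. \<Lambda> X f x + \<Lambda> Y f x)) \<and>
     (\<forall>c X f. \<Lambda> (c *\<^sub>R X) f = (\<lambda>x. c * \<Lambda> X f x)) \<and>
     (\<forall>X Y. \<forall>f\<in>smooth_functions G A. \<Lambda> (br X Y) f = (\<lambda>x. \<Lambda> X (\<Lambda> Y f) x - \<Lambda> Y (\<Lambda> X f) x))"

text \<open>The Lie algebra of a closed subgroup \<open>K\<close>: all \<open>X\<close> with \<open>exp (t X) \<in> K\<close> for every \<open>t\<close>, where
  \<open>\<gamma> t = exp (t X)\<close> is characterised as the one-parameter subgroup with velocity \<open>X\<close> at \<open>0\<close>.\<close>

definition lie_subalgebra_of_subgroup ::
  "('g, 'z) monoid_scheme \<Rightarrow> 'g topology \<Rightarrow> ('g set \<times> ('g \<Rightarrow> real^'n)) set \<Rightarrow>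
   (real^'n \<Rightarrow> ('g \<Rightarrow> real) \<Rightarrow> ('g \<Rightarrow> real)) \<Rightarrow> 'g set \<Rightarrow> (real^'n) set" where
  "lie_subalgebra_of_subgroup G T A \<Lambda> K =
     {X. \<exists>\<gamma>. continuous_map euclideanreal T \<gamma> \<and> (\<forall>s t. \<gamma> (s + t) = \<gamma> s \<otimes>\<^bsub>G\<^esub> \<gamma> t) \<and> range \<gamma> \<subseteq> K \<and>
        (\<forall>f\<in>smooth_functions G A. ((\<lambda>t. f (\<gamma> t)) has_real_derivative \<Lambda> X f \<one>\<^bsub>G\<^esub>) (at 0))}"

definition finite_centre :: "('g, 'z) monoid_scheme \<Rightarrow> bool" where
  "finite_centre G \<longleftrightarrow> finite {z \<in> carrier G. \<forall>x\<in>carrier G. z \<otimes>\<^bsub>G\<^esub> x = x \<otimes>\<^bsub>G\<^esub> z}"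

definition maximal_compact_subgroup ::
  "('g, 'z) monoid_scheme \<Rightarrow> 'g topology \<Rightarrow> 'g set \<Rightarrow> bool" where
  "maximal_compact_subgroup G T K \<longleftrightarrow>
     subgroup K G \<and> compactin T K \<and>
     (\<forall>K'. subgroup K' G \<and> compactin T K' \<and> K \<subseteq> K' \<longrightarrow> K' = K)"


section \<open>Real Lie algebras\<close>

definition lie_bracket :: "(real^'n \<Rightarrow> real^'n \<Rightarrow> real^'n) \<Rightarrow> bool" where
  "lie_bracket br \<longleftrightarrow>
     bilinear br \<and> (\<forall>x. br x x = 0) \<and>
     (\<forall>x y z. br x (br y z) + br y (br z x) + br z (br x y) = 0)"

definition simple_lie_bracket :: "(real^'n \<Rightarrow> real^'n \<Rightarrow> real^'n) \<Rightarrow> bool" where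
  "simple_lie_bracket br \<longleftrightarrow>
     lie_bracket br \<and> (\<exists>x y. br x y \<noteq> 0) \<and>
     (\<forall>I. subspace I \<and> (\<forall>x. \<forall>y\<in>I. br x y \<in> I) \<longrightarrow> I = {0} \<or> I = UNIV)"

definition killing_form :: "(real^'n \<Rightarrow> real^'n \<Rightarrow> real^'n) \<Rightarrow> real^'n \<Rightarrow> real^'n \<Rightarrow> real" where
  "killing_form br x y = trace (matrix (\<lambda>z. br x (br y z)))"

definition cartan_involution ::
  "(real^'n \<Rightarrow> real^'n \<Rightarrow> real^'n) \<Rightarrow> (real^'n \<Rightarrow> real^'n) \<Rightarrow> bool" where
  "cartan_involution br \<theta> \<longleftrightarrow>
     linear \<theta> \<and> (\<forall>x. \<theta> (\<theta> x) = x) \<and> (\<forall>x y. \<theta> (br x y) = br (\<theta> x) (\<theta> y)) \<and>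
     (\<forall>x. x \<noteq> 0 \<longrightarrow> - killing_form br x (\<theta> x) > 0)"

definition cartan_decomposition ::
  "(real^'n \<Rightarrow> real^'n \<Rightarrow> real^'n) \<Rightarrow> (real^'n) set \<Rightarrow> (real^'n) set \<Rightarrow> bool" where
  "cartan_decomposition br k0 p0 \<longleftrightarrow>
     (\<exists>\<theta>. cartan_involution br \<theta> \<and> k0 = {x. \<theta> x = x} \<and> p0 = {x. \<theta> x = - x})"

definition maximal_abelian_in ::
  "(real^'n \<Rightarrow> real^'n \<Rightarrow> real^'n) \<Rightarrow> (real^'n) set \<Rightarrow> (real^'n) set \<Rightarrow> bool" where
  "maximal_abelian_in br k0 t0 \<longleftrightarrow>
     subspace t0 \<and> t0 \<subseteq> k0 \<and> (\<forall>x\<in>t0. \<forall>y\<in>t0. br x y = 0) \<and>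
     (\<forall>s. subspace s \<and> s \<subseteq> k0 \<and> (\<forall>x\<in>s. \<forall>y\<in>s. br x y = 0) \<and> t0 \<subseteq> s \<longrightarrow> s = t0)"

primrec lower_central ::
  "(real^'n \<Rightarrow> real^'n \<Rightarrow> real^'n) \<Rightarrow> (real^'n) set \<Rightarrow> nat \<Rightarrow> (real^'n) set" where
  "lower_central br H 0 = H"
| "lower_central br H (Suc i) = span {br x y | x y. x \<in> H \<and> y \<in> lower_central br H i}"

text \<open>Nilpotent and self-normalising.\<close>

definition cartan_subalgebra ::
  "(real^'n \<Rightarrow> real^'n \<Rightarrow> real^'n) \<Rightarrow> (real^'n) set \<Rightarrow> (real^'n) set \<Rightarrow> bool" where
  "cartan_subalgebra br L H \<longleftrightarrow>
     subspace H \<and> H \<subseteq> L \<and> (\<forall>x\<in>H. \<forall>y\<in>H. br x y \<in> H) \<and>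
     (\<exists>i. lower_central br H i = {0}) \<and>
     (\<forall>x\<in>L. (\<forall>y\<in>H. br x y \<in> H) \<longrightarrow> x \<in> H)"

text \<open>The rank is the common dimension of all Cartan subalgebras.\<close>

definition has_rank ::
  "(real^'n \<Rightarrow> real^'n \<Rightarrow> real^'n) \<Rightarrow> (real^'n) set \<Rightarrow> nat \<Rightarrow> bool" where
  "has_rank br L r \<longleftrightarrow>
     (\<exists>H. cartan_subalgebra br L H) \<and> (\<forall>H. cartan_subalgebra br L H \<longrightarrow> dim H = r)"


section \<open>Complexification\<close>

text \<open>The complexification of \<open>real^'n\<close> is \<open>complex^'n\<close>; \<open>cbr br\<close> is the complex-bilinear extension
  of \<open>br\<close>.\<close>

definition Re_vec :: "complex^'n \<Rightarrow> real^'n" where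
  "Re_vec z = (\<chi> i. Re (z $ i))"

definition Im_vec :: "complex^'n \<Rightarrow> real^'n" where
  "Im_vec z = (\<chi> i. Im (z $ i))"

definition cbr ::
  "(real^'n \<Rightarrow> real^'n \<Rightarrow> real^'n) \<Rightarrow> complex^'n \<Rightarrow> complex^'n \<Rightarrow> complex^'n" where
  "cbr br z w = (\<chi> i. Complex
      ((br (Re_vec z) (Re_vec w) - br (Im_vec z) (Im_vec w)) $ i)
      ((br (Re_vec z) (Im_vec w) + br (Im_vec z) (Re_vec w)) $ i))"

definition complexify :: "(real^'n) set \<Rightarrow> (complex^'n) set" where
  "complexify S = {z. Re_vec z \<in> S \<and> Im_vec z \<in> S}"


section \<open>Complex Lie algebras\<close>

text \<open>From here on \<open>B\<close> is a Lie bracket on \<open>complex^'n\<close>.\<close>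

definition subalgebra ::
  "(complex^'n \<Rightarrow> complex^'n \<Rightarrow> complex^'n) \<Rightarrow> (complex^'n) set \<Rightarrow> bool" where
  "subalgebra B M \<longleftrightarrow> vec.subspace M \<and> (\<forall>x\<in>M. \<forall>y\<in>M. B x y \<in> M)"

definition lie_ideal ::
  "(complex^'n \<Rightarrow> complex^'n \<Rightarrow> complex^'n) \<Rightarrow> (complex^'n) set \<Rightarrow> (complex^'n) set \<Rightarrow> bool" where
  "lie_ideal B M I \<longleftrightarrow> vec.subspace I \<and> I \<subseteq> M \<and> (\<forall>x\<in>M. \<forall>y\<in>I. B x y \<in> I)"

primrec derived_series ::
  "(complex^'n \<Rightarrow> complex^'n \<Rightarrow> complex^'n) \<Rightarrow> (complex^'n) set \<Rightarrow> nat \<Rightarrow> (complex^'n) set" where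
  "derived_series B M 0 = M"
| "derived_series B M (Suc i) =
     vec.span {B x y | x y. x \<in> derived_series B M i \<and> y \<in> derived_series B M i}"

definition solvable :: "(complex^'n \<Rightarrow> complex^'n \<Rightarrow> complex^'n) \<Rightarrow> (complex^'n) set \<Rightarrow> bool" where
  "solvable B M \<longleftrightarrow> (\<exists>i. derived_series B M i = {0})"

definition lie_centre ::
  "(complex^'n \<Rightarrow> complex^'n \<Rightarrow> complex^'n) \<Rightarrow> (complex^'n) set \<Rightarrow> (complex^'n) set" where
  "lie_centre B M = {x \<in> M. \<forall>y\<in>M. B x y = 0}"

text \<open>The radical is \<open>0\<close>, respectively equal to the centre.\<close>

definition semisimple :: "(complex^'n \<Rightarrow> complex^'n \<Rightarrow> complex^'n) \<Rightarrow> (complex^'n) set \<Rightarrow> bool" where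
  "semisimple B M \<longleftrightarrow> (\<forall>I. lie_ideal B M I \<and> solvable B I \<longrightarrow> I = {0})"

definition reductive :: "(complex^'n \<Rightarrow> complex^'n \<Rightarrow> complex^'n) \<Rightarrow> (complex^'n) set \<Rightarrow> bool" where
  "reductive B M \<longleftrightarrow> (\<forall>I. lie_ideal B M I \<and> solvable B I \<longrightarrow> I \<subseteq> lie_centre B M)"


section \<open>Roots\<close>

text \<open>Functionals on \<open>h\<close> are represented by functions that vanish outside \<open>h\<close>.\<close>

type_synonym 'n functional = "complex^'n \<Rightarrow> complex"

definition dual_space :: "(complex^'n) set \<Rightarrow> 'n functional set" where
  "dual_space h =
     {\<mu>. (\<forall>x\<in>h. \<forall>y\<in>h. \<mu> (x + y) = \<mu> x + \<mu> y) \<and> (\<forall>c. \<forall>x\<in>h. \<mu> (c *s x) = c * \<mu> x) \<and>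
         (\<forall>x. x \<notin> h \<longrightarrow> \<mu> x = 0)}"

definition neg :: "'n functional \<Rightarrow> 'n functional" where
  "neg \<mu> = (\<lambda>x. - \<mu> x)"

definition weight_space ::
  "(complex^'n \<Rightarrow> complex^'n \<Rightarrow> complex^'n) \<Rightarrow> (complex^'n) set \<Rightarrow> (complex^'n) set \<Rightarrow>
   'n functional \<Rightarrow> (complex^'n) set" where
  "weight_space B h M \<mu> = {x \<in> M. \<forall>H\<in>h. B H x = \<mu> H *s x}"

definition roots ::
  "(complex^'n \<Rightarrow> complex^'n \<Rightarrow> complex^'n) \<Rightarrow> (complex^'n) set \<Rightarrow> (complex^'n) set \<Rightarrow>
   'n functional set" where
  "roots B h M = {\<alpha> \<in> dual_space h. \<alpha> \<noteq> (\<lambda>x. 0) \<and> weight_space B h M \<alpha> \<noteq> {0}}"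

abbreviation root_space ::
  "(complex^'n \<Rightarrow> complex^'n \<Rightarrow> complex^'n) \<Rightarrow> (complex^'n) set \<Rightarrow> 'n functional \<Rightarrow> (complex^'n) set" where
  "root_space B h \<alpha> \<equiv> weight_space B h UNIV \<alpha>"

definition positive_system :: "'n functional set \<Rightarrow> 'n functional set \<Rightarrow> bool" where
  "positive_system R P \<longleftrightarrow>
     P \<subseteq> R \<and> P \<inter> neg ` P = {} \<and> P \<union> neg ` P = R \<and>
     (\<forall>\<alpha>\<in>P. \<forall>\<beta>\<in>P. (\<lambda>x. \<alpha> x + \<beta> x) \<in> R \<longrightarrow> (\<lambda>x. \<alpha> x + \<beta> x) \<in> P)"

definition simple_roots :: "'n functional set \<Rightarrow> 'n functional set" where
  "simple_roots P = {\<alpha> \<in> P. \<not> (\<exists>\<beta>\<in>P. \<exists>\<gamma>\<in>P. \<alpha> = (\<lambda>x. \<beta> x + \<gamma> x))}"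

text \<open>\<open>coef \<Phi> \<alpha> \<psi>\<close> is the coefficient \<open>n\<^sub>\<psi>(\<alpha>)\<close> of \<open>\<psi>\<close> in the expansion of \<open>\<alpha>\<close> in the basis \<open>\<Phi>\<close>.\<close>

definition coef :: "'n functional set \<Rightarrow> 'n functional \<Rightarrow> 'n functional \<Rightarrow> int" where
  "coef \<Phi> \<alpha> =
     (THE c. \<alpha> = (\<lambda>x. \<Sum>\<psi>\<in>\<Phi>. of_int (c \<psi>) * \<psi> x) \<and> (\<forall>\<psi>. \<psi> \<notin> \<Phi> \<longrightarrow> c \<psi> = 0))"

definition highest_root :: "'n functional set \<Rightarrow> 'n functional set \<Rightarrow> 'n functional \<Rightarrow> bool" where
  "highest_root R P \<delta> \<longleftrightarrow>
     \<delta> \<in> R \<and>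
     (\<forall>\<beta>\<in>R. \<forall>\<psi>\<in>simple_roots P. coef (simple_roots P) \<beta> \<psi> \<le> coef (simple_roots P) \<delta> \<psi>)"

definition borel_de_siebenthal ::
  "(complex^'n \<Rightarrow> complex^'n \<Rightarrow> complex^'n) \<Rightarrow> (complex^'n) set \<Rightarrow> (complex^'n) set \<Rightarrow>
   (complex^'n) set \<Rightarrow> 'n functional set \<Rightarrow> bool" where
  "borel_de_siebenthal B h k p P \<longleftrightarrow>
     positive_system (roots B h UNIV) P \<and>
     (\<exists>\<nu> \<delta>. {\<alpha> \<in> simple_roots P. root_space B h \<alpha> \<subseteq> p} = {\<nu>} \<and>
        highest_root (roots B h UNIV) P \<delta> \<and>
        (lie_centre B k \<noteq> {0} \<longrightarrow> coef (simple_roots P) \<delta> \<nu> = 1) \<and>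
        (semisimple B k \<longrightarrow> coef (simple_roots P) \<delta> \<nu> = 2))"

text \<open>The summand of degree \<open>0\<close> for the grading of the Lie algebra by \<open>n\<^sub>\<nu>\<close>.\<close>

definition l_zero ::
  "(complex^'n \<Rightarrow> complex^'n \<Rightarrow> complex^'n) \<Rightarrow> (complex^'n) set \<Rightarrow>
   'n functional set \<Rightarrow> 'n functional \<Rightarrow> (complex^'n) set" where
  "l_zero B h \<Phi> \<nu> =
     vec.span (h \<union> (\<Union>\<alpha>\<in>{\<alpha> \<in> roots B h UNIV. coef \<Phi> \<alpha> \<nu> = 0}. root_space B h \<alpha>))"


section \<open>Weyl groups\<close>

text \<open>The coroot of \<open>\<alpha>\<close>: the element \<open>H\<close> of the line \<open>[g\<^sup>\<alpha>, g\<^sup>-\<^sup>\<alpha>] \<subseteq> h\<close> with \<open>\<alpha> H = 2\<close>.\<close>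

definition coroot ::
  "(complex^'n \<Rightarrow> complex^'n \<Rightarrow> complex^'n) \<Rightarrow> (complex^'n) set \<Rightarrow> 'n functional \<Rightarrow> complex^'n" where
  "coroot B h \<alpha> =
     (THE H. H \<in> vec.span {B e f | e f. e \<in> root_space B h \<alpha> \<and> f \<in> root_space B h (neg \<alpha>)} \<and>
        \<alpha> H = 2)"

text \<open>Reflections act on the dual space of \<open>h\<close>; elsewhere they are the identity, so that elements
  of the Weyl group are equal as functions iff they agree on the dual space.\<close>

definition reflection ::
  "(complex^'n \<Rightarrow> complex^'n \<Rightarrow> complex^'n) \<Rightarrow> (complex^'n) set \<Rightarrow> 'n functional \<Rightarrow>
   'n functional \<Rightarrow> 'n functional" where
  "reflection B h \<alpha> \<mu> = (if \<mu> \<in> dual_space h then (\<lambda>x. \<mu> x - \<mu> (coroot B h \<alpha>) * \<alpha> x) else \<mu>)"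

definition reflection_product ::
  "(complex^'n \<Rightarrow> complex^'n \<Rightarrow> complex^'n) \<Rightarrow> (complex^'n) set \<Rightarrow> 'n functional list \<Rightarrow>
   'n functional \<Rightarrow> 'n functional" where
  "reflection_product B h \<alpha>s = foldr (\<lambda>\<alpha> w. reflection B h \<alpha> \<circ> w) \<alpha>s id"

definition weyl_group ::
  "(complex^'n \<Rightarrow> complex^'n \<Rightarrow> complex^'n) \<Rightarrow> (complex^'n) set \<Rightarrow> 'n functional set \<Rightarrow>
   ('n functional \<Rightarrow> 'n functional) set" where
  "weyl_group B h R = {reflection_product B h \<alpha>s | \<alpha>s. set \<alpha>s \<subseteq> R}"

definition weyl_length ::
  "(complex^'n \<Rightarrow> complex^'n \<Rightarrow> complex^'n) \<Rightarrow> (complex^'n) set \<Rightarrow> 'n functional set \<Rightarrow>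
   ('n functional \<Rightarrow> 'n functional) \<Rightarrow> nat" where
  "weyl_length B h P w =
     (LEAST m. \<exists>\<alpha>s. length \<alpha>s = m \<and> set \<alpha>s \<subseteq> simple_roots P \<and> w = reflection_product B h \<alpha>s)"

definition longest_element ::
  "(complex^'n \<Rightarrow> complex^'n \<Rightarrow> complex^'n) \<Rightarrow> (complex^'n) set \<Rightarrow> 'n functional set \<Rightarrow>
   'n functional set \<Rightarrow> ('n functional \<Rightarrow> 'n functional) \<Rightarrow> bool" where
  "longest_element B h R P w \<longleftrightarrow>
     w \<in> weyl_group B h R \<and>
     (\<forall>w'\<in>weyl_group B h R. weyl_length B h P w' \<le> weyl_length B h P w)"


section \<open>Submodules and extremal weights\<close>

definition irreducible_submodule ::
  "(complex^'n \<Rightarrow> complex^'n \<Rightarrow> complex^'n) \<Rightarrow> (complex^'n) set \<Rightarrow> (complex^'n) set \<Rightarrow>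
   (complex^'n) set \<Rightarrow> bool" where
  "irreducible_submodule B L M V \<longleftrightarrow>
     vec.subspace V \<and> V \<subseteq> M \<and> V \<noteq> {0} \<and> (\<forall>x\<in>L. \<forall>v\<in>V. B x v \<in> V) \<and>
     (\<forall>U. vec.subspace U \<and> U \<subseteq> V \<and> (\<forall>x\<in>L. \<forall>v\<in>U. B x v \<in> U) \<longrightarrow> U = {0} \<or> U = V)"

text \<open>Highest and lowest weights of an irreducible module \<open>V\<close>, with respect to a set \<open>Q\<close> of positive
  roots: weights of a nonzero vector killed by all positive, respectively negative, root vectors
  of the subalgebra \<open>L\<close> acting on \<open>V\<close>.\<close>

definition highest_weight ::
  "(complex^'n \<Rightarrow> complex^'n \<Rightarrow> complex^'n) \<Rightarrow> (complex^'n) set \<Rightarrow> (complex^'n) set \<Rightarrow>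
   'n functional set \<Rightarrow> (complex^'n) set \<Rightarrow> 'n functional \<Rightarrow> bool" where
  "highest_weight B h L Q V \<mu> \<longleftrightarrow>
     \<mu> \<in> dual_space h \<and>
     (\<exists>v\<in>weight_space B h V \<mu>. v \<noteq> 0 \<and> (\<forall>\<alpha>\<in>Q. \<forall>e\<in>weight_space B h L \<alpha>. B e v = 0))"

definition lowest_weight ::
  "(complex^'n \<Rightarrow> complex^'n \<Rightarrow> complex^'n) \<Rightarrow> (complex^'n) set \<Rightarrow> (complex^'n) set \<Rightarrow>
   'n functional set \<Rightarrow> (complex^'n) set \<Rightarrow> 'n functional \<Rightarrow> bool" where
  "lowest_weight B h L Q V \<mu> \<longleftrightarrow> highest_weight B h L (neg ` Q) V \<mu>"

text \<open>\<open>L\<close> is a reductive subalgebra of \<open>k\<close> containing \<open>h\<close>, and \<open>Q\<close> is the positive root system of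
  its root system whose set of simple roots is \<open>S\<close>.  When \<open>S\<close> consists of simple roots of \<open>k\<close>, this
  says that the Dynkin diagram of \<open>[L, L]\<close> is the subdiagram of the one of \<open>k\<close> with vertices \<open>S\<close>:
  \<open>L\<close> and \<open>[L, L]\<close> have the same roots, and the edges are determined by the vertices.\<close>

definition reductive_with_simple_roots ::
  "(complex^'n \<Rightarrow> complex^'n \<Rightarrow> complex^'n) \<Rightarrow> (complex^'n) set \<Rightarrow> (complex^'n) set \<Rightarrow>
   'n functional set \<Rightarrow> (complex^'n) set \<Rightarrow> 'n functional set \<Rightarrow> bool" where
  "reductive_with_simple_roots B h k S L Q \<longleftrightarrow>
     subalgebra B L \<and> L \<subseteq> k \<and> h \<subseteq> L \<and> reductive B L \<and>
     positive_system (roots B h L) Q \<and> simple_roots Q = S"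

text \<open>\<open>\<phi>\<close> and \<open>\<nu>'\<close> arise from some \<open>\<phi>' \<in> \<Phi>\<^sub>0\<close> with \<open>n\<^sub>\<phi>\<^sub>'(\<delta>) = 1\<close> by the construction in the first part
  of the theorem; here \<open>w0\<close> is the longest Weyl group element of \<open>l\<^sub>0\<close>, and \<open>L\<close>, \<open>V\<close> are the algebra
  \<open>l'\<^sub>0\<close> and its irreducible submodule of \<open>p\<close> with highest weight \<open>lam = w0 \<nu>\<close>.\<close>

definition exchange_data ::
  "(complex^'n \<Rightarrow> complex^'n \<Rightarrow> complex^'n) \<Rightarrow> (complex^'n) set \<Rightarrow> (complex^'n) set \<Rightarrow>
   (complex^'n) set \<Rightarrow> 'n functional set \<Rightarrow> 'n functional set \<Rightarrow> 'n functional set \<Rightarrow>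
   'n functional \<Rightarrow> ('n functional \<Rightarrow> 'n functional) \<Rightarrow> 'n functional \<Rightarrow>
   'n functional \<Rightarrow> 'n functional \<Rightarrow> bool" where
  "exchange_data B h k p \<Phi> \<Phi>0 \<Phi>k \<delta> w0 lam \<phi> \<nu>' \<longleftrightarrow>
     (\<exists>\<phi>'\<in>\<Phi>0. coef \<Phi> \<delta> \<phi>' = 1 \<and> \<phi> \<in> \<Phi>0 \<and> w0 \<phi>' = neg \<phi> \<and>
        (\<exists>L Q V. reductive_with_simple_roots B h k (\<Phi>k - {\<phi>}) L Q \<and>
           irreducible_submodule B L p V \<and> highest_weight B h L Q V lam \<and>
           lowest_weight B h L Q V \<nu>'))"

end

(*
Let f(alpha) be the coefficient of nu in alpha.  Its parity distinguishes compact from non-compact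
roots, and the simple compact roots are Phi_0 together with eps.  A Borel-de Siebenthal system P'
containing P_k is determined by its own degree f', which vanishes on all simple compact roots but
one, where it is 2.  If that one is eps, then f' = f and P' = P.  Otherwise it is some phi in Phi_0,
and applying w0 to the expansion of delta gives
  eps = 2 lambda + sum over psi in Phi_0 of n_psi(delta) w0(psi),
hence f'(lambda) = n_phi'(delta), which is odd and at most 2, so equal to 1.  Conversely, if
n_phi'(delta) = 1, then the functional f' defined by these values is integral, has the right parity
and is bounded by 2 on the roots; the roots on which f' is positive, together with those of degree 0
in P_k, form the required system.  It has a highest root, being Weyl conjugate to P.

The root space facts come from the Hermitian form -Kill(x, theta(conj y)): for a root vector e
and the conjugate linear involution st, ad e and ad (st e) are adjoint to each other.  Equal rank
makes the complexification of t_0 its own centraliser.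
*)

theory Submission
  imports Defs "HOL-Library.Function_Algebras" "HOL-Computational_Algebra.Fundamental_Theorem_Algebra"
begin

section \<open>Root systems\<close>

text \<open>Both halves of the theorem compare integer-valued degrees on the roots. In (1) the
  degree is manufactured from \<phi>': it is n_\<nu> - 2 n_\<phi>' pulled back by w0, so that it is
  1 on \<lambda>, -2 on w0(\<phi>') and 0 on the remaining images of simple roots. In (2) it is read
  off from P', and its parts of degree 0 and 1 serve as l'_0 and as the submodule of p. Functionals
  are plain functions without a bilinear form, so the combinatorics is axiomatised through Cartan
  integers. The axiom \<open>posdef\<close> is the shadow of (v, v) = \<Sum> c_\<alpha> (v,
  \<alpha>): if v is a nonnegative combination of roots and pairs nonpositively with each of them,
  then v = 0. On the Lie algebra side, root spaces are lines and brackets of root vectors with root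
  sum are nonzero because certain squared norms cannot be negative; sl2-strings are needed only for
  the integrality of Cartan integers and for root strings.\<close>

lemma of_int_fun_apply: "(of_int c :: 'a \<Rightarrow> 'b::ring_1) x = of_int c"
  by (cases c) simp_all

lemma sum_fun_apply: "(\<Sum>i\<in>I. f i) x = (\<Sum>i\<in>I. f i x)"
  for f :: "'i \<Rightarrow> 'a \<Rightarrow> 'b::comm_monoid_add"
  by (induction I rule: infinite_finite_induct) simp_all

lemma sum_list_fun_apply: "sum_list fs x = sum_list (map (\<lambda>f. f x) fs)"
  for fs :: "('a \<Rightarrow> 'b::comm_monoid_add) list"
  by (induction fs) simp_all

lemmas fun_apply = plus_fun_apply times_fun_apply zero_fun_apply one_fun_apply of_int_fun_apply sum_fun_apply uminus_apply minus_apply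

text \<open>As simp rules these would expand sums and multiples of roots pointwise.\<close>

declare plus_fun_apply [simp del] times_fun_apply [simp del] zero_fun_apply [simp del] one_fun_apply [simp del]
  uminus_apply [simp del] minus_apply [simp del]

section \<open>Additive notation and integral combinations\<close>

lemma neg_eq_uminus: "neg = uminus"
  by (simp add: fun_eq_iff neg_def fun_apply)

lemma positive_system_iff:
  "positive_system R P \<longleftrightarrow>
     P \<subseteq> R \<and> P \<inter> uminus ` P = {} \<and> P \<union> uminus ` P = R \<and> (\<forall>\<alpha>\<in>P. \<forall>\<beta>\<in>P. \<alpha> + \<beta> \<in> R \<longrightarrow> \<alpha> + \<beta> \<in> P)"
  by (simp add: positive_system_def plus_fun_def neg_eq_uminus)

lemma simple_roots_iff:
  "\<alpha> \<in> simple_roots P \<longleftrightarrow> \<alpha> \<in> P \<and> (\<forall>\<beta>\<in>P. \<forall>\<gamma>\<in>P. \<alpha> \<noteq> \<beta> + \<gamma>)"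
  by (auto simp: simple_roots_def plus_fun_def)

text \<open>Functionals carry pointwise ring operations, so
  \<open>of_int (c \<psi>) * \<psi>\<close> is a scalar multiple: its first factor is a constant
  function.\<close>

definition int_comb :: "'n functional set \<Rightarrow> ('n functional \<Rightarrow> int) \<Rightarrow> 'n functional" where
  "int_comb F c = (\<Sum>\<psi>\<in>F. of_int (c \<psi>) * \<psi>)"

lemma coef_eq: "coef \<Phi> \<alpha> = (THE c. \<alpha> = int_comb \<Phi> c \<and> (\<forall>\<psi>. \<psi> \<notin> \<Phi> \<longrightarrow> c \<psi> = 0))"
proof -
  have "(\<lambda>x. \<Sum>\<psi>\<in>\<Phi>. of_int (c \<psi>) * \<psi> x) = int_comb \<Phi> c" for c
    by (simp add: fun_eq_iff fun_apply int_comb_def)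
  then show ?thesis unfolding coef_def by simp
qed

lemma int_comb_apply: "int_comb F c x = (\<Sum>\<psi>\<in>F. of_int (c \<psi>) * \<psi> x)"
  by (simp add: int_comb_def fun_apply)

lemma int_comb_add: "int_comb F c + int_comb F d = int_comb F (\<lambda>\<psi>. c \<psi> + d \<psi>)"
  by (simp add: int_comb_def sum.distrib distrib_right)

lemma int_comb_minus: "- int_comb F c = int_comb F (\<lambda>\<psi>. - c \<psi>)"
  by (simp add: int_comb_def sum_negf)

lemma int_comb_scale: "of_int k * int_comb F c = int_comb F (\<lambda>\<psi>. k * c \<psi>)"
  by (simp add: int_comb_def sum_distrib_left mult.assoc)

lemma int_comb_cong: "(\<And>\<psi>. \<psi> \<in> F \<Longrightarrow> c \<psi> = d \<psi>) \<Longrightarrow> int_comb F c = int_comb F d"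
  by (simp add: int_comb_def)

lemma int_comb_single:
  assumes "finite F" "\<psi> \<in> F"
  shows "int_comb F (\<lambda>\<phi>. if \<phi> = \<psi> then k else 0) = of_int k * \<psi>"
proof -
  have "int_comb F (\<lambda>\<phi>. if \<phi> = \<psi> then k else 0) = (\<Sum>\<phi>\<in>F. if \<phi> = \<psi> then of_int k * \<phi> else 0)"
    unfolding int_comb_def by (intro sum.cong) auto
  then show ?thesis using assms by simp
qed

text \<open>Turns multiplicities into repetitions in a list, the form in which
  \<open>sum_list_pos_nonzero\<close> can be proved by induction on the length.\<close>

lemma int_comb_nonneg_sum_list:
  assumes "finite F" "F \<subseteq> P" "\<And>\<psi>. \<psi> \<in> F \<Longrightarrow> 0 \<le> c \<psi>"
  shows "\<exists>\<gamma>s. set \<gamma>s \<subseteq> P \<and> sum_list \<gamma>s = int_comb F c \<and> ((\<exists>\<psi>\<in>F. c \<psi> > 0) \<longrightarrow> \<gamma>s \<noteq> [])"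
  using assms
proof (induction F rule: finite_induct)
  case empty
  show ?case by (auto simp: int_comb_def intro!: exI[of _ "[]"])
next
  case (insert \<psi> F)
  have "\<exists>\<gamma>s. set \<gamma>s \<subseteq> P \<and> sum_list \<gamma>s = int_comb F c \<and> ((\<exists>\<psi>\<in>F. c \<psi> > 0) \<longrightarrow> \<gamma>s \<noteq> [])"
    by (rule insert.IH) (use insert.prems in blast)+
  then obtain \<gamma>s where \<gamma>s: "set \<gamma>s \<subseteq> P" "sum_list \<gamma>s = int_comb F c" "(\<exists>\<psi>\<in>F. c \<psi> > 0) \<longrightarrow> \<gamma>s \<noteq> []"
    by blast
  let ?l = "replicate (nat (c \<psi>)) \<psi> @ \<gamma>s"
  have "of_nat (nat (c \<psi>)) * \<psi> = of_int (c \<psi>) * \<psi>"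
    using insert.prems(2)[of \<psi>] by (metis insertI1 of_int_of_nat_eq int_nat_eq)
  then have "sum_list ?l = int_comb (insert \<psi> F) c"
    using \<gamma>s insert.hyps by (simp add: int_comb_def sum_list_replicate)
  moreover have "set ?l \<subseteq> P" using \<gamma>s insert.prems by (auto simp: set_replicate_conv_if)
  moreover have "(\<exists>\<phi>\<in>insert \<psi> F. c \<phi> > 0) \<longrightarrow> ?l \<noteq> []" using \<gamma>s by auto
  ultimately show ?case by blast
qed

text \<open>\<open>cr \<alpha>\<close> is the coroot of \<open>\<alpha>\<close>, so that \<open>\<beta> (cr \<alpha>)\<close> is a Cartan integer.  The assumption
  \<open>posdef\<close> is all that is needed of an invariant inner product.\<close>

locale root_system =
  fixes R :: "'n::finite functional set" and cr :: "'n functional \<Rightarrow> complex^'n" and h :: "(complex^'n) set"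
  assumes finite_roots: "finite R"
    and roots_dual: "R \<subseteq> dual_space h"
    and zero_not_root: "0 \<notin> R"
    and minus_root: "\<alpha> \<in> R \<Longrightarrow> - \<alpha> \<in> R"
    and coroot_self: "\<alpha> \<in> R \<Longrightarrow> \<alpha> (cr \<alpha>) = 2"
    and coroot_minus: "\<alpha> \<in> R \<Longrightarrow> \<mu> \<in> dual_space h \<Longrightarrow> \<mu> (cr (- \<alpha>)) = - \<mu> (cr \<alpha>)"
    and coroot_reflect: "\<alpha> \<in> R \<Longrightarrow> \<beta> \<in> R \<Longrightarrow> \<mu> \<in> dual_space h \<Longrightarrow>
      \<mu> (cr (\<lambda>x. \<alpha> x - \<alpha> (cr \<beta>) * \<beta> x)) = \<mu> (cr \<alpha>) - \<mu> (cr \<beta>) * \<beta> (cr \<alpha>)"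
    and integral: "\<alpha> \<in> R \<Longrightarrow> \<beta> \<in> R \<Longrightarrow> \<beta> (cr \<alpha>) \<in> \<int>"
    and pos_sym: "\<alpha> \<in> R \<Longrightarrow> \<beta> \<in> R \<Longrightarrow> Re (\<beta> (cr \<alpha>)) > 0 \<Longrightarrow> Re (\<alpha> (cr \<beta>)) > 0"
    and string: "\<alpha> \<in> R \<Longrightarrow> \<beta> \<in> R \<Longrightarrow> \<beta> \<noteq> \<alpha> \<Longrightarrow> 0 \<le> i \<Longrightarrow> of_int i \<le> Re (\<beta> (cr \<alpha>)) \<Longrightarrow>
      \<beta> - of_int i * \<alpha> \<in> R"
    and reduced: "\<alpha> \<in> R \<Longrightarrow> \<alpha> + \<alpha> \<notin> R"
    and posdef: "F \<subseteq> R \<Longrightarrow> (\<And>\<alpha>. \<alpha> \<in> F \<Longrightarrow> 0 \<le> c \<alpha>) \<Longrightarrow>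
      (\<And>\<beta>. \<beta> \<in> F \<Longrightarrow> Re (int_comb F c (cr \<beta>)) \<le> 0) \<Longrightarrow> int_comb F c = 0"
begin

text \<open>The floor merely extracts an \<open>int\<close> from a complex value that
  \<open>integral\<close> guarantees to be an integer.\<close>

definition cint :: "'n functional \<Rightarrow> 'n functional \<Rightarrow> int" where
  "cint \<beta> \<alpha> = \<lfloor>Re (\<beta> (cr \<alpha>))\<rfloor>"

lemma cint: "\<alpha> \<in> R \<Longrightarrow> \<beta> \<in> R \<Longrightarrow> \<beta> (cr \<alpha>) = of_int (cint \<beta> \<alpha>)"
  using integral[of \<alpha> \<beta>] by (auto simp: cint_def elim!: Ints_cases)

lemma coroot_minus_root: "\<alpha> \<in> R \<Longrightarrow> \<beta> \<in> R \<Longrightarrow> \<beta> (cr (- \<alpha>)) = - \<beta> (cr \<alpha>)"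
  using coroot_minus roots_dual by blast

section \<open>Root strings and reflections\<close>

lemma string_up:
  assumes "\<alpha> \<in> R" "\<beta> \<in> R" "\<beta> \<noteq> - \<alpha>" "0 \<le> i" "of_int i \<le> - Re (\<beta> (cr \<alpha>))"
  shows "\<beta> + of_int i * \<alpha> \<in> R"
  using string[of "- \<alpha>" \<beta> i] assms minus_root coroot_minus_root[of \<alpha> \<beta>] by simp

lemma add_root:
  assumes "\<alpha> \<in> R" "\<beta> \<in> R" "\<beta> \<noteq> - \<alpha>" "Re (\<beta> (cr \<alpha>)) < 0"
  shows "\<alpha> + \<beta> \<in> R"
  using string_up[of \<alpha> \<beta> 1] assms cint[of \<alpha> \<beta>] by (simp add: add.commute)

lemma diff_root:
  assumes "\<alpha> \<in> R" "\<beta> \<in> R" "\<beta> \<noteq> \<alpha>" "Re (\<beta> (cr \<alpha>)) > 0"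
  shows "\<beta> - \<alpha> \<in> R"
  using string[of \<alpha> \<beta> 1] assms cint[of \<alpha> \<beta>] by simp

text \<open>The Cartan integer of n\<alpha> with respect to \<alpha> is 2n, so its string may be
  followed down n - 2 steps, which leads to 2\<alpha>, excluded by \<open>reduced\<close>.\<close>

lemma multiple_not_root:
  assumes "\<alpha> \<in> R" "2 \<le> n"
  shows "of_int n * \<alpha> \<notin> R"
proof
  assume n: "of_int n * \<alpha> \<in> R"
  have ne: "of_int n * \<alpha> \<noteq> \<alpha>"
  proof
    assume "of_int n * \<alpha> = \<alpha>"
    then have "of_int n * \<alpha> (cr \<alpha>) = \<alpha> (cr \<alpha>)" by (metis of_int_fun_apply times_fun_apply)
    then have "complex_of_int n * 2 = 2" unfolding coroot_self[OF assms(1)] .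
    then have "complex_of_int n = 1" by simp
    then show False using assms by simp
  qed
  have "of_int n * \<alpha> - of_int (n - 2) * \<alpha> \<in> R"
    by (rule string[OF assms(1) n ne]) (use assms coroot_self[of \<alpha>] in \<open>auto simp: fun_apply\<close>)
  then have "\<alpha> + \<alpha> \<in> R" by (simp add: algebra_simps)
  then show False using reduced assms by blast
qed

text \<open>Unlike \<open>reflection\<close> this is one formula for all functions, so additivity
  holds without hypotheses; the two agree on \<open>dual_space h\<close>.\<close>

definition refl :: "'n functional \<Rightarrow> 'n functional \<Rightarrow> 'n functional" where
  "refl \<alpha> \<mu> = (\<lambda>x. \<mu> x - \<mu> (cr \<alpha>) * \<alpha> x)"

lemma refl_root_eq: "\<alpha> \<in> R \<Longrightarrow> \<beta> \<in> R \<Longrightarrow> refl \<alpha> \<beta> = \<beta> - of_int (cint \<beta> \<alpha>) * \<alpha>"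
  using cint[of \<alpha> \<beta>] by (simp add: refl_def fun_eq_iff fun_apply)

lemma refl_self: "\<alpha> \<in> R \<Longrightarrow> refl \<alpha> \<alpha> = - \<alpha>"
  by (simp add: refl_def fun_eq_iff fun_apply coroot_self)

lemma refl_refl [simp]: "\<alpha> \<in> R \<Longrightarrow> refl \<alpha> (refl \<alpha> \<mu>) = \<mu>"
  by (simp add: refl_def fun_eq_iff fun_apply coroot_self)

lemma refl_add: "refl \<alpha> (\<mu> + \<nu>) = refl \<alpha> \<mu> + refl \<alpha> \<nu>"
  by (simp add: refl_def fun_eq_iff fun_apply algebra_simps)

lemma refl_scale: "refl \<alpha> (of_int c * \<mu>) = of_int c * refl \<alpha> \<mu>"
  by (simp add: refl_def fun_eq_iff fun_apply algebra_simps)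

text \<open>The string axiom, taken with i equal to the Cartan integer up to sign. The roots
  \<alpha> and -\<alpha> are separate cases because strings exclude them.\<close>

lemma refl_root: 
  assumes "\<alpha> \<in> R" "\<beta> \<in> R"
  shows "refl \<alpha> \<beta> \<in> R"
proof -
  consider "\<beta> = \<alpha>" | "\<beta> = - \<alpha>" | "\<beta> \<noteq> \<alpha>" "\<beta> \<noteq> - \<alpha>" by blast
  then show ?thesis
  proof cases
    case 1
    then show ?thesis using assms refl_self minus_root by simp
  next
    case 2
    then have "refl \<alpha> \<beta> = \<alpha>" using assms(1) by (simp add: refl_def fun_eq_iff fun_apply coroot_self)
    then show ?thesis using assms by simp
  next
    case 3
    show ?thesis
    proof (cases "cint \<beta> \<alpha> \<ge> 0")
      case True
      then have "\<beta> - of_int (cint \<beta> \<alpha>) * \<alpha> \<in> R"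
        by (intro string) (use assms 3 cint[of \<alpha> \<beta>] in auto)
      then show ?thesis using refl_root_eq assms by simp
    next
      case False
      then have "\<beta> + of_int (- cint \<beta> \<alpha>) * \<alpha> \<in> R"
        by (intro string_up) (use assms 3 cint[of \<alpha> \<beta>] in auto)
      then show ?thesis using refl_root_eq assms by simp
    qed
  qed
qed

lemma refl_dual: "\<alpha> \<in> R \<Longrightarrow> \<mu> \<in> dual_space h \<Longrightarrow> refl \<alpha> \<mu> \<in> dual_space h"
  using roots_dual unfolding refl_def dual_space_def subset_eq by (auto simp: algebra_simps)

text \<open>The axiom \<open>coroot_reflect\<close> describes the coroot of a reflected root only
  through its values on \<open>dual_space h\<close>, whence the restriction on \<mu>.\<close>

lemma refl_conj:
  assumes "\<alpha> \<in> R" "\<beta> \<in> R" "\<mu> \<in> dual_space h"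
  shows "refl (refl \<beta> \<alpha>) \<mu> = refl \<beta> (refl \<alpha> (refl \<beta> \<mu>))"
proof -
  have "\<mu> (cr (refl \<beta> \<alpha>)) = \<mu> (cr \<alpha>) - \<mu> (cr \<beta>) * \<beta> (cr \<alpha>)"
    unfolding refl_def using coroot_reflect assms by blast
  also have "\<dots> = refl \<beta> \<mu> (cr \<alpha>)" by (simp add: refl_def)
  finally have "refl (refl \<beta> \<alpha>) \<mu> = (\<lambda>x. \<mu> x - refl \<beta> \<mu> (cr \<alpha>) * refl \<beta> \<alpha> x)"
    by (simp add: refl_def[of "refl \<beta> \<alpha>"])
  also have "\<dots> = refl \<beta> (\<lambda>x. refl \<beta> \<mu> x - refl \<beta> \<mu> (cr \<alpha>) * \<alpha> x)"
    using coroot_self[OF assms(2)] by (simp add: refl_def fun_eq_iff fun_apply algebra_simps)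
  finally show ?thesis by (simp add: refl_def[of \<alpha>])
qed

text \<open>Serves for the compact roots, the roots of degree 0 and the roots of a subalgebra. Only
  strings need an argument: a string in R is walked one step at a time, and each step adds -\<alpha>
  and so stays in S.\<close>

lemma root_system_closed_subset:
  assumes S: "S \<subseteq> R" and minus: "\<And>\<alpha>. \<alpha> \<in> S \<Longrightarrow> - \<alpha> \<in> S"
    and add: "\<And>\<alpha> \<beta>. \<alpha> \<in> S \<Longrightarrow> \<beta> \<in> S \<Longrightarrow> \<alpha> + \<beta> \<in> R \<Longrightarrow> \<alpha> + \<beta> \<in> S"
  shows "root_system S cr h"
proof unfold_locales
  fix \<alpha> \<beta> and i :: int
  assume a: "\<alpha> \<in> S" "\<beta> \<in> S" "\<beta> \<noteq> \<alpha>" "0 \<le> i" "of_int i \<le> Re (\<beta> (cr \<alpha>))"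
  have "of_int (int j) \<le> Re (\<beta> (cr \<alpha>)) \<Longrightarrow> \<beta> - of_int (int j) * \<alpha> \<in> S" for j
  proof (induction j)
    case (Suc j)
    have "\<beta> - of_int (int (Suc j)) * \<alpha> \<in> R"
      by (rule string) (use Suc.prems a(1-3) S in auto)
    moreover have eq: "\<beta> - of_int (int (Suc j)) * \<alpha> = - \<alpha> + (\<beta> - of_int (int j) * \<alpha>)"
      by (simp add: fun_eq_iff fun_apply algebra_simps)
    ultimately have 1: "- \<alpha> + (\<beta> - of_int (int j) * \<alpha>) \<in> R" by (simp only:)
    have IH: "\<beta> - of_int (int j) * \<alpha> \<in> S" by (rule Suc.IH) (use Suc.prems in simp)
    have "- \<alpha> + (\<beta> - of_int (int j) * \<alpha>) \<in> S"
      using add[OF minus[OF a(1)] IH 1] .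
    then show ?case by (simp only: eq)
  qed (use a in simp)
  from this[of "nat i"] show "\<beta> - of_int i * \<alpha> \<in> S" using a by simp
next
  show "finite S" using S finite_roots by (rule finite_subset)
  show "S \<subseteq> dual_space h" using S roots_dual by (rule order_trans)
  show "0 \<notin> S" using S zero_not_root by (rule contra_subsetD)
next
  fix \<alpha> assume "\<alpha> \<in> S"
  note \<alpha> = this subsetD[OF S this]
  show "- \<alpha> \<in> S" using minus \<alpha>(1) .
  show "\<alpha> (cr \<alpha>) = 2" using coroot_self \<alpha>(2) .
  show "\<alpha> + \<alpha> \<notin> S" using reduced[OF \<alpha>(2)] S by (rule contra_subsetD[rotated])
  show "\<mu> (cr (- \<alpha>)) = - \<mu> (cr \<alpha>)" if "\<mu> \<in> dual_space h" for \<mu>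
    using coroot_minus \<alpha>(2) that .
  fix \<beta> assume "\<beta> \<in> S"
  note \<beta> = subsetD[OF S this]
  show "\<beta> (cr \<alpha>) \<in> \<int>" using integral \<alpha>(2) \<beta> .
  show "Re (\<alpha> (cr \<beta>)) > 0" if "Re (\<beta> (cr \<alpha>)) > 0" using pos_sym \<alpha>(2) \<beta> that .
  show "\<mu> (cr (\<lambda>x. \<alpha> x - \<alpha> (cr \<beta>) * \<beta> x)) = \<mu> (cr \<alpha>) - \<mu> (cr \<beta>) * \<beta> (cr \<alpha>)"
    if "\<mu> \<in> dual_space h" for \<mu>
    using coroot_reflect \<alpha>(2) \<beta> that .
next
  fix F c
  assume "F \<subseteq> S" "\<And>\<alpha>. \<alpha> \<in> F \<Longrightarrow> 0 \<le> c \<alpha>" "\<And>\<beta>. \<beta> \<in> F \<Longrightarrow> Re (int_comb F c (cr \<beta>)) \<le> 0"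
  then show "int_comb F c = 0" using posdef[of F c] S by blast
qed

subsection \<open>Words in reflections\<close>

text \<open>The formula involves no parameter but \<open>cr\<close>, so a subsystem with the same
  coroots has the same words; facts about words in a subsystem thus apply to R directly.\<close>

definition word :: "'n functional list \<Rightarrow> 'n functional \<Rightarrow> 'n functional" where
  "word \<alpha>s = foldr (\<lambda>\<alpha> w. refl \<alpha> \<circ> w) \<alpha>s id"

lemma word_Nil [simp]: "word [] \<mu> = \<mu>"
  by (simp add: word_def)

lemma word_Cons [simp]: "word (\<alpha> # \<alpha>s) \<mu> = refl \<alpha> (word \<alpha>s \<mu>)"
  by (simp add: word_def)

lemma word_append [simp]: "word (\<alpha>s @ \<beta>s) \<mu> = word \<alpha>s (word \<beta>s \<mu>)"
  by (induction \<alpha>s) auto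

lemma word_rev [simp]: "set \<alpha>s \<subseteq> R \<Longrightarrow> word \<alpha>s (word (rev \<alpha>s) \<mu>) = \<mu>"
  by (induction \<alpha>s arbitrary: \<mu>) auto

lemma word_rev' [simp]: "set \<alpha>s \<subseteq> R \<Longrightarrow> word (rev \<alpha>s) (word \<alpha>s \<mu>) = \<mu>"
  using word_rev[of "rev \<alpha>s"] by simp

lemma word_add: "word \<alpha>s (\<mu> + \<nu>) = word \<alpha>s \<mu> + word \<alpha>s \<nu>"
  by (induction \<alpha>s) (simp_all add: refl_add)

lemma word_scale: "word \<alpha>s (of_int c * \<mu>) = of_int c * word \<alpha>s \<mu>"
  by (induction \<alpha>s) (simp_all add: refl_scale)

lemma word_minus: "word \<alpha>s (- \<mu>) = - word \<alpha>s \<mu>"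
  using word_scale[of \<alpha>s "-1" \<mu>] by (simp only: of_int_minus of_int_1 mult_minus1)

lemma word_diff: "word \<alpha>s (\<mu> - \<nu>) = word \<alpha>s \<mu> - word \<alpha>s \<nu>"
  using word_add[of \<alpha>s \<mu> "- \<nu>"] word_minus[of \<alpha>s \<nu>] by simp

lemma word_zero [simp]: "word \<alpha>s 0 = 0"
  using word_scale[of \<alpha>s 0 0] by simp

lemma word_sum: "word \<alpha>s (\<Sum>i\<in>I. f i) = (\<Sum>i\<in>I. word \<alpha>s (f i))"
  by (induction I rule: infinite_finite_induct) (simp_all add: word_add)

lemma word_root: "set \<alpha>s \<subseteq> R \<Longrightarrow> \<beta> \<in> R \<Longrightarrow> word \<alpha>s \<beta> \<in> R"
  by (induction \<alpha>s) (auto simp: refl_root)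

lemma word_dual: "set \<alpha>s \<subseteq> R \<Longrightarrow> \<mu> \<in> dual_space h \<Longrightarrow> word \<alpha>s \<mu> \<in> dual_space h"
  by (induction \<alpha>s) (auto simp: refl_dual)

lemma word_inj: "set \<alpha>s \<subseteq> R \<Longrightarrow> word \<alpha>s \<mu> = word \<alpha>s \<nu> \<longleftrightarrow> \<mu> = \<nu>"
  using word_rev' by metis

lemma word_roots: "set \<alpha>s \<subseteq> R \<Longrightarrow> word \<alpha>s ` R = R"
proof
  assume a: "set \<alpha>s \<subseteq> R"
  then show "word \<alpha>s ` R \<subseteq> R" using word_root by auto
  show "R \<subseteq> word \<alpha>s ` R"
  proof
    fix \<beta> assume "\<beta> \<in> R"
    then have "word (rev \<alpha>s) \<beta> \<in> R" using a by (intro word_root) auto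
    then show "\<beta> \<in> word \<alpha>s ` R" by (rule rev_image_eqI) (simp add: a)
  qed
qed

text \<open>Iterates \<open>refl_conj\<close>; the inverse of a word is the reversed word.\<close>

lemma refl_word:
  "set \<alpha>s \<subseteq> R \<Longrightarrow> \<beta> \<in> R \<Longrightarrow> \<mu> \<in> dual_space h \<Longrightarrow>
     refl (word \<alpha>s \<beta>) \<mu> = word \<alpha>s (refl \<beta> (word (rev \<alpha>s) \<mu>))"
proof (induction \<alpha>s arbitrary: \<mu>)
  case (Cons \<alpha> \<alpha>s)
  then show ?case using refl_conj[of "word \<alpha>s \<beta>" \<alpha> \<mu>] word_root refl_dual by auto
qed auto

lemma positive_system_word:
  assumes "set \<alpha>s \<subseteq> R" "positive_system R P"
  shows "positive_system R (word \<alpha>s ` P)"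
proof -
  note P = assms(2)[unfolded positive_system_iff]
  have um: "uminus ` word \<alpha>s ` P = word \<alpha>s ` uminus ` P"
    by (simp add: image_image word_minus)
  have add: "word \<alpha>s \<alpha> + word \<alpha>s \<beta> \<in> word \<alpha>s ` P"
    if "\<alpha> \<in> P" "\<beta> \<in> P" "word \<alpha>s \<alpha> + word \<alpha>s \<beta> \<in> R" for \<alpha> \<beta>
  proof -
    have "word (rev \<alpha>s) (word \<alpha>s (\<alpha> + \<beta>)) \<in> R"
      by (rule word_root) (use assms that in \<open>auto simp: word_add\<close>)
    then have "\<alpha> + \<beta> \<in> P" using that P assms by auto
    then show ?thesis by (simp add: word_add[symmetric])
  qed
  have "word \<alpha>s ` (P \<union> uminus ` P) = R" using P word_roots assms(1) by simp
  then have un: "word \<alpha>s ` P \<union> word \<alpha>s ` uminus ` P = R" by (simp only: image_Un)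
  have "word \<alpha>s ` (P \<inter> uminus ` P) = word \<alpha>s ` P \<inter> word \<alpha>s ` uminus ` P"
    by (rule image_Int) (rule injI, simp only: word_inj[OF assms(1)])
  moreover have "word \<alpha>s ` (P \<inter> uminus ` P) = {}" using P by simp
  ultimately have int: "word \<alpha>s ` P \<inter> word \<alpha>s ` uminus ` P = {}" by (simp only:)
  show ?thesis unfolding positive_system_iff um
    using un int add by blast
qed

lemma simple_roots_word:
  assumes "set \<alpha>s \<subseteq> R"
  shows "simple_roots (word \<alpha>s ` P) = word \<alpha>s ` simple_roots P"
proof -
  have mem: "word \<alpha>s \<alpha> \<in> word \<alpha>s ` P \<longleftrightarrow> \<alpha> \<in> P" for \<alpha>
    by (rule inj_image_mem_iff) (rule injI, simp only: word_inj[OF assms])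
  have *: "word \<alpha>s \<alpha> \<in> simple_roots (word \<alpha>s ` P) \<longleftrightarrow> \<alpha> \<in> simple_roots P" for \<alpha>
    unfolding simple_roots_iff by (simp add: mem word_inj[OF assms] word_add[symmetric])
  show ?thesis
  proof (intro equalityI subsetI)
    fix \<beta> assume \<beta>: "\<beta> \<in> simple_roots (word \<alpha>s ` P)"
    then obtain \<alpha> where "\<beta> = word \<alpha>s \<alpha>" unfolding simple_roots_iff by blast
    with \<beta> * show "\<beta> \<in> word \<alpha>s ` simple_roots P" by simp
  qed (use * in blast)
qed

lemma int_comb_word:
  assumes "set \<alpha>s \<subseteq> R"
  shows "int_comb (word \<alpha>s ` F) c = word \<alpha>s (int_comb F (c \<circ> word \<alpha>s))"
proof -
  have "inj_on (word \<alpha>s) F" by (auto intro!: inj_onI simp: word_inj[OF assms])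
  then show ?thesis by (simp add: int_comb_def sum.reindex word_sum word_scale)
qed

end

subsection \<open>Positive systems\<close>

locale positive_roots = root_system +
  fixes P
  assumes positive: "positive_system R P"
begin

abbreviation \<Phi> where "\<Phi> \<equiv> simple_roots P"

lemma pos_root: "\<alpha> \<in> P \<Longrightarrow> \<alpha> \<in> R"
  using positive unfolding positive_system_iff by blast

lemma pos_not_minus: "\<alpha> \<in> P \<Longrightarrow> - \<alpha> \<notin> P"
  using positive unfolding positive_system_iff by (metis IntI empty_iff image_eqI minus_minus)

lemma root_cases: "\<alpha> \<in> R \<Longrightarrow> \<alpha> \<in> P \<or> - \<alpha> \<in> P"
  using positive unfolding positive_system_iff by force

lemma pos_minus_iff: "\<alpha> \<in> R \<Longrightarrow> - \<alpha> \<in> P \<longleftrightarrow> \<alpha> \<notin> P"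
  using root_cases pos_not_minus by blast

lemma pos_add: "\<alpha> \<in> P \<Longrightarrow> \<beta> \<in> P \<Longrightarrow> \<alpha> + \<beta> \<in> R \<Longrightarrow> \<alpha> + \<beta> \<in> P"
  using positive unfolding positive_system_iff by blast

lemma simple_pos: "\<psi> \<in> \<Phi> \<Longrightarrow> \<psi> \<in> P"
  by (simp add: simple_roots_iff)

lemma simple_root: "\<psi> \<in> \<Phi> \<Longrightarrow> \<psi> \<in> R"
  using simple_pos pos_root by blast

lemma finite_pos: "finite P"
  using finite_roots finite_subset positive unfolding positive_system_iff by blast

lemma finite_simple: "finite \<Phi>"
  using finite_pos by (rule rev_finite_subset) (auto simp: simple_roots_iff)

text \<open>If \<open>\<alpha> + \<Sum>\<beta>s = 0\<close>, then the coroot of \<open>\<alpha>\<close> is negative on some \<open>\<beta>\<close> in the list, and \<open>\<alpha>\<close>, \<open>\<beta>\<close>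
  can be replaced by the positive root \<open>\<alpha> + \<beta>\<close>.\<close>

lemma sum_list_pos_nonzero: "set \<gamma>s \<subseteq> P \<Longrightarrow> \<gamma>s \<noteq> [] \<Longrightarrow> sum_list \<gamma>s \<noteq> 0"
proof (induction "length \<gamma>s" arbitrary: \<gamma>s rule: less_induct)
  case less
  obtain \<alpha> \<beta>s where \<gamma>s: "\<gamma>s = \<alpha> # \<beta>s" using less.prems by (cases \<gamma>s) auto
  have \<alpha>: "\<alpha> \<in> P" "\<alpha> \<in> R" and \<beta>s: "set \<beta>s \<subseteq> P" using less.prems pos_root by (auto simp: \<gamma>s)
  show ?case
  proof
    assume 0: "sum_list \<gamma>s = 0"
    then have "\<alpha> (cr \<alpha>) + sum_list (map (\<lambda>\<beta>. \<beta> (cr \<alpha>)) \<beta>s) = 0"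
      unfolding \<gamma>s using sum_list_fun_apply[of "\<alpha> # \<beta>s" "cr \<alpha>"] by (simp add: zero_fun_apply)
    then have "sum_list (map (\<lambda>\<beta>. \<beta> (cr \<alpha>)) \<beta>s) = -2"
      using coroot_self[OF \<alpha>(2)] by (simp add: add_eq_0_iff)
    moreover have "Re (sum_list (map (\<lambda>\<beta>. \<beta> (cr \<alpha>)) \<beta>s)) = sum_list (map (\<lambda>\<beta>. Re (\<beta> (cr \<alpha>))) \<beta>s)"
      by (induction \<beta>s) auto
    ultimately have "sum_list (map (\<lambda>\<beta>. Re (\<beta> (cr \<alpha>))) \<beta>s) < 0" by simp
    then have "\<exists>\<beta>\<in>set \<beta>s. Re (\<beta> (cr \<alpha>)) < 0"
      using sum_list_nonneg[of "map (\<lambda>\<beta>. Re (\<beta> (cr \<alpha>))) \<beta>s"] by fastforce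
    then obtain \<beta> where \<beta>: "\<beta> \<in> set \<beta>s" "Re (\<beta> (cr \<alpha>)) < 0" by blast
    then have \<beta>P: "\<beta> \<in> P" "\<beta> \<in> R" using \<beta>s pos_root by auto
    have "\<beta> \<noteq> - \<alpha>" using pos_not_minus[OF \<alpha>(1)] \<beta>P by blast
    then have "\<alpha> + \<beta> \<in> R" using add_root \<alpha> \<beta>P \<beta> by blast
    then have ab: "\<alpha> + \<beta> \<in> P" using pos_add \<alpha> \<beta>P by blast
    let ?l = "(\<alpha> + \<beta>) # remove1 \<beta> \<beta>s"
    have "length \<beta>s \<noteq> 0" using \<beta>(1) by auto
    then have "length ?l < length \<gamma>s" using \<beta>(1) by (simp add: \<gamma>s length_remove1)
    moreover have "set ?l \<subseteq> P" using ab \<beta>s set_remove1_subset[of \<beta> \<beta>s] by (simp add: subset_iff)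
    ultimately have "sum_list ?l \<noteq> 0" using less.hyps by blast
    moreover have "sum_list ?l = sum_list \<gamma>s"
      using sum_list_map_remove1[OF \<beta>(1), of "\<lambda>x. x"] by (simp add: \<gamma>s add.assoc)
    ultimately show False using 0 by simp
  qed
qed

text \<open>Being smaller by a nonempty sum of positive roots is transitive and, by
  \<open>sum_list_pos_nonzero\<close>, irreflexive, hence well-founded on the finite set P. Heights
  are not yet available: expansions in simple roots are themselves obtained by this
  induction.\<close>

lemma pos_induct [consumes 1, case_names simple add]:
  assumes "\<alpha> \<in> P" and simple: "\<And>\<psi>. \<psi> \<in> \<Phi> \<Longrightarrow> Q \<psi>"
    and add: "\<And>\<beta> \<gamma>. \<beta> \<in> P \<Longrightarrow> \<gamma> \<in> P \<Longrightarrow> \<beta> + \<gamma> \<in> P \<Longrightarrow> Q \<beta> \<Longrightarrow> Q \<gamma> \<Longrightarrow> Q (\<beta> + \<gamma>)"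
  shows "Q \<alpha>"
proof -
  define below where
    "below = {(\<beta>, \<alpha>). \<alpha> \<in> P \<and> \<beta> \<in> P \<and> (\<exists>\<gamma>s. \<gamma>s \<noteq> [] \<and> set \<gamma>s \<subseteq> P \<and> \<alpha> = \<beta> + sum_list \<gamma>s)}"
  have "trans below"
  proof (rule transI)
    fix \<alpha> \<beta> \<gamma> assume "(\<alpha>, \<beta>) \<in> below" "(\<beta>, \<gamma>) \<in> below"
    then obtain l m where "\<alpha> \<in> P" "\<gamma> \<in> P" "l \<noteq> []" "set l \<subseteq> P" "\<beta> = \<alpha> + sum_list l"
      "m \<noteq> []" "set m \<subseteq> P" "\<gamma> = \<beta> + sum_list m" unfolding below_def by blast
    then have "l @ m \<noteq> []" "set (l @ m) \<subseteq> P" "\<gamma> = \<alpha> + sum_list (l @ m)" by (simp_all add: add.assoc)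
    then show "(\<alpha>, \<gamma>) \<in> below" unfolding below_def using \<open>\<alpha> \<in> P\<close> \<open>\<gamma> \<in> P\<close> by blast
  qed
  moreover have "irrefl below"
    unfolding irrefl_def below_def using sum_list_pos_nonzero by auto
  ultimately have "acyclic below" by (simp add: acyclic_irrefl)
  moreover have "finite below"
    by (rule finite_subset[of _ "P \<times> P"]) (auto simp: below_def finite_pos)
  ultimately have "wf below" by (rule finite_acyclic_wf[rotated])
  then have "\<alpha> \<in> P \<longrightarrow> Q \<alpha>"
  proof (induction \<alpha> rule: wf_induct_rule)
    case (less \<alpha>)
    show ?case
    proof
      assume \<alpha>: "\<alpha> \<in> P"
      show "Q \<alpha>"
      proof (cases "\<alpha> \<in> \<Phi>")
        case False
        then obtain \<beta> \<gamma> where bg: "\<beta> \<in> P" "\<gamma> \<in> P" "\<alpha> = \<beta> + \<gamma>" using \<alpha> by (auto simp: simple_roots_iff)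
        have "(\<beta>, \<alpha>) \<in> below"
          unfolding below_def using \<alpha> bg by (auto intro!: exI[of _ "[\<gamma>]"])
        moreover have "(\<gamma>, \<alpha>) \<in> below"
          unfolding below_def using \<alpha> bg by (auto intro!: exI[of _ "[\<beta>]"] simp: add.commute)
        ultimately have "Q \<beta>" "Q \<gamma>" using less bg by auto
        then show ?thesis using add bg \<alpha> by blast
      qed (rule simple)
    qed
  qed
  then show ?thesis using assms by blast
qed

text \<open>Otherwise \<phi> - \<psi> is a root, and depending on its sign it splits \<phi> or
  \<psi> into two positive roots.\<close>

lemma simple_obtuse:
  assumes "\<phi> \<in> \<Phi>" "\<psi> \<in> \<Phi>" "\<phi> \<noteq> \<psi>"
  shows "Re (\<phi> (cr \<psi>)) \<le> 0"
proof (rule ccontr)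
  assume "\<not> ?thesis"
  then have d: "\<phi> - \<psi> \<in> R" using diff_root simple_root assms by force
  have "\<phi> = (\<phi> - \<psi>) + \<psi>" "\<psi> = - (\<phi> - \<psi>) + \<phi>" by simp_all
  then show False
    using root_cases[OF d] assms unfolding simple_roots_iff by metis
qed

lemma int_comb_pos_nonzero:
  assumes "F \<subseteq> P" "\<And>\<psi>. \<psi> \<in> F \<Longrightarrow> 0 \<le> c \<psi>" "int_comb F c = 0" "\<psi> \<in> F"
  shows "c \<psi> = 0"
proof (rule ccontr)
  assume "c \<psi> \<noteq> 0"
  then have pos: "\<exists>\<psi>\<in>F. c \<psi> > 0" using assms by force
  have "finite F" using assms(1) finite_pos finite_subset by blast
  then obtain \<gamma>s where "set \<gamma>s \<subseteq> P" "sum_list \<gamma>s = int_comb F c" "(\<exists>\<psi>\<in>F. c \<psi> > 0) \<longrightarrow> \<gamma>s \<noteq> []"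
    using int_comb_nonneg_sum_list[of F P c] assms by blast
  then show False using sum_list_pos_nonzero pos assms(3) by metis
qed

text \<open>Writing a relation as an equality \<open>v = w\<close> of nonnegative combinations of disjoint sets of simple
  roots, obtuseness gives \<open>(v, w) \<le> 0\<close>, hence \<open>v = w = 0\<close>.\<close>

lemma simple_independent:
  assumes 0: "int_comb \<Phi> c = 0" and "\<psi> \<in> \<Phi>"
  shows "c \<psi> = 0"
proof -
  define F where "F = {\<psi> \<in> \<Phi>. c \<psi> > 0}"
  define G where "G = {\<psi> \<in> \<Phi>. c \<psi> \<le> 0}"
  have un: "\<Phi> = F \<union> G" "F \<inter> G = {}" and fin: "finite F" "finite G" and sub: "F \<subseteq> P" "G \<subseteq> P" "G \<subseteq> R"
    using finite_simple simple_pos simple_root by (auto simp: F_def G_def)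
  have "int_comb \<Phi> c = int_comb F c + int_comb G c"
    unfolding int_comb_def un(1) using fin un(2) by (rule sum.union_disjoint)
  then have "int_comb F c = - int_comb G c" using 0 by (simp add: eq_neg_iff_add_eq_0)
  then have eq: "int_comb F c = int_comb G (\<lambda>\<psi>. - c \<psi>)" by (simp only: int_comb_minus)
  have G0: "int_comb G (\<lambda>\<psi>. - c \<psi>) = 0"
  proof (rule posdef[OF sub(3)])
    show "0 \<le> - c \<psi>" if "\<psi> \<in> G" for \<psi> using that by (simp add: G_def)
    fix \<psi> assume \<psi>: "\<psi> \<in> G"
    have "Re (int_comb F c (cr \<psi>)) = (\<Sum>\<phi>\<in>F. of_int (c \<phi>) * Re (\<phi> (cr \<psi>)))"
      by (simp add: int_comb_apply)
    also have "\<dots> \<le> 0"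
    proof (rule sum_nonpos)
      fix \<phi> assume "\<phi> \<in> F"
      then have \<phi>: "\<phi> \<in> \<Phi>" "c \<phi> > 0" by (simp_all add: F_def)
      have "\<psi> \<in> \<Phi>" "\<phi> \<noteq> \<psi>" using \<phi> \<psi> by (auto simp: G_def)
      then have "Re (\<phi> (cr \<psi>)) \<le> 0" using simple_obtuse \<phi> by blast
      then show "of_int (c \<phi>) * Re (\<phi> (cr \<psi>)) \<le> 0" using \<phi>(2) by (simp add: mult_nonneg_nonpos)
    qed
    finally show "Re (int_comb G (\<lambda>\<psi>. - c \<psi>) (cr \<psi>)) \<le> 0" using eq by simp
  qed
  show ?thesis
  proof (cases "\<psi> \<in> F")
    case True
    then show ?thesis using int_comb_pos_nonzero[of F c \<psi>] sub(1) eq G0 by (auto simp: F_def)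
  next
    case False
    then have "\<psi> \<in> G" using assms un by blast
    then have "- c \<psi> = 0" using int_comb_pos_nonzero[of G "\<lambda>\<psi>. - c \<psi>" \<psi>] sub(2) G0 by (auto simp: G_def)
    then show ?thesis by simp
  qed
qed

section \<open>Coefficients with respect to the simple roots\<close>

definition root_lattice :: "'a functional set" where
  "root_lattice = range (int_comb \<Phi>)"

lemma coef_int_comb: "\<psi> \<in> \<Phi> \<Longrightarrow> coef \<Phi> (int_comb \<Phi> c) \<psi> = c \<psi>"
proof -
  assume \<psi>: "\<psi> \<in> \<Phi>"
  \<comment> \<open>The description behind \<open>coef\<close> asks for a function that vanishes
    outside \<Phi>, so c is truncated first.\<close>
  define d where "d = (\<lambda>\<psi>. if \<psi> \<in> \<Phi> then c \<psi> else 0)"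
  have d: "int_comb \<Phi> c = int_comb \<Phi> d" by (rule int_comb_cong) (simp add: d_def)
  have "coef \<Phi> (int_comb \<Phi> c) = d"
    unfolding coef_eq
  proof (rule the_equality)
    show "int_comb \<Phi> c = int_comb \<Phi> d \<and> (\<forall>\<psi>. \<psi> \<notin> \<Phi> \<longrightarrow> d \<psi> = 0)" using d by (simp add: d_def)
    fix e assume e: "int_comb \<Phi> c = int_comb \<Phi> e \<and> (\<forall>\<psi>. \<psi> \<notin> \<Phi> \<longrightarrow> e \<psi> = 0)"
    have "int_comb \<Phi> (\<lambda>\<psi>. e \<psi> + - d \<psi>) = int_comb \<Phi> e + - int_comb \<Phi> d"
      by (simp only: int_comb_minus int_comb_add)
    also have "\<dots> = 0" using e d by simp
    finally have "e \<psi> + - d \<psi> = 0" if "\<psi> \<in> \<Phi>" for \<psi> by (rule simple_independent) (rule that)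
    then show "e = d" using e by (auto simp: fun_eq_iff d_def)
  qed
  then show ?thesis using \<psi> by (simp add: d_def)
qed

lemma coef_expansion: "\<mu> \<in> root_lattice \<Longrightarrow> \<mu> = int_comb \<Phi> (coef \<Phi> \<mu>)"
  unfolding root_lattice_def using int_comb_cong coef_int_comb by (metis (no_types, lifting) rangeE)

lemma root_latticeI: "\<mu> = int_comb \<Phi> c \<Longrightarrow> \<mu> \<in> root_lattice"
  unfolding root_lattice_def by blast

lemma lattice_add: "\<mu> \<in> root_lattice \<Longrightarrow> \<nu> \<in> root_lattice \<Longrightarrow> \<mu> + \<nu> \<in> root_lattice"
  unfolding root_lattice_def by (auto simp: int_comb_add)

lemma lattice_scale: "\<mu> \<in> root_lattice \<Longrightarrow> of_int k * \<mu> \<in> root_lattice"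
  unfolding root_lattice_def by (auto simp: int_comb_scale)

lemma lattice_minus: "\<mu> \<in> root_lattice \<Longrightarrow> - \<mu> \<in> root_lattice"
  using lattice_scale[of \<mu> "-1"] by simp

lemma lattice_zero: "0 \<in> root_lattice"
  by (rule root_latticeI[of _ "\<lambda>_. 0"]) (simp add: int_comb_def)

lemma coef_add:
  "\<mu> \<in> root_lattice \<Longrightarrow> \<nu> \<in> root_lattice \<Longrightarrow> \<psi> \<in> \<Phi> \<Longrightarrow> coef \<Phi> (\<mu> + \<nu>) \<psi> = coef \<Phi> \<mu> \<psi> + coef \<Phi> \<nu> \<psi>"
  unfolding root_lattice_def by (auto simp: int_comb_add coef_int_comb)

lemma coef_scale:
  "\<mu> \<in> root_lattice \<Longrightarrow> \<psi> \<in> \<Phi> \<Longrightarrow> coef \<Phi> (of_int k * \<mu>) \<psi> = k * coef \<Phi> \<mu> \<psi>"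
  unfolding root_lattice_def by (auto simp: int_comb_scale coef_int_comb)

lemma coef_minus: "\<mu> \<in> root_lattice \<Longrightarrow> \<psi> \<in> \<Phi> \<Longrightarrow> coef \<Phi> (- \<mu>) \<psi> = - coef \<Phi> \<mu> \<psi>"
  using coef_scale[of \<mu> \<psi> "-1"] by simp

lemma coef_zero: "\<psi> \<in> \<Phi> \<Longrightarrow> coef \<Phi> 0 \<psi> = 0"
  using coef_scale[of 0 \<psi> 0] lattice_zero by simp

lemma lattice_simple: "\<psi> \<in> \<Phi> \<Longrightarrow> \<psi> \<in> root_lattice"
  by (rule root_latticeI[of _ "\<lambda>\<phi>. if \<phi> = \<psi> then 1 else 0"]) (simp only: int_comb_single[OF finite_simple] of_int_1 mult_1)

lemma coef_simple: "\<psi> \<in> \<Phi> \<Longrightarrow> \<phi> \<in> \<Phi> \<Longrightarrow> coef \<Phi> \<psi> \<phi> = (if \<phi> = \<psi> then 1 else 0)"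
  using coef_int_comb[of \<phi> "\<lambda>\<phi>. if \<phi> = \<psi> then 1 else 0"] int_comb_single[OF finite_simple, of \<psi> 1]
  by simp

lemma pos_lattice: "\<alpha> \<in> P \<Longrightarrow> \<alpha> \<in> root_lattice"
  by (induction rule: pos_induct) (auto intro: lattice_simple lattice_add)

lemma lattice_root: "\<alpha> \<in> R \<Longrightarrow> \<alpha> \<in> root_lattice"
  using root_cases pos_lattice lattice_minus by (metis minus_minus)

lemma coef_nonneg: "\<alpha> \<in> P \<Longrightarrow> \<psi> \<in> \<Phi> \<Longrightarrow> 0 \<le> coef \<Phi> \<alpha> \<psi>"
  by (induction rule: pos_induct) (auto simp: coef_simple coef_add pos_lattice)

lemma pos_if_coef_pos: "\<alpha> \<in> R \<Longrightarrow> \<psi> \<in> \<Phi> \<Longrightarrow> 0 < coef \<Phi> \<alpha> \<psi> \<Longrightarrow> \<alpha> \<in> P"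
  using coef_nonneg[of "- \<alpha>" \<psi>] root_cases[of \<alpha>] coef_minus[of \<alpha> \<psi>] lattice_root[of \<alpha>] by force

lemma lattice_sum: "(\<And>i. i \<in> I \<Longrightarrow> f i \<in> root_lattice) \<Longrightarrow> (\<Sum>i\<in>I. f i) \<in> root_lattice"
  by (induction I rule: infinite_finite_induct) (auto intro: lattice_add lattice_zero)

lemma coef_sum:
  "(\<And>i. i \<in> I \<Longrightarrow> f i \<in> root_lattice) \<Longrightarrow> \<psi> \<in> \<Phi> \<Longrightarrow> coef \<Phi> (\<Sum>i\<in>I. f i) \<psi> = (\<Sum>i\<in>I. coef \<Phi> (f i) \<psi>)"
  by (induction I rule: infinite_finite_induct) (auto simp: coef_zero coef_add lattice_sum)

lemma coef_eq_zero_imp: "\<mu> \<in> root_lattice \<Longrightarrow> (\<And>\<psi>. \<psi> \<in> \<Phi> \<Longrightarrow> coef \<Phi> \<mu> \<psi> = 0) \<Longrightarrow> \<mu> = 0"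
  using coef_expansion[of \<mu>] int_comb_cong[of \<Phi> "coef \<Phi> \<mu>" "\<lambda>_. 0"] by (simp add: int_comb_def)

text \<open>The reflection alters only the coefficient of \<psi>, and a positive root other than
  \<psi> has another positive coefficient, since no multiple n\<psi> with n \<ge> 2 is a
  root.\<close>

lemma refl_simple_pos:
  assumes \<psi>: "\<psi> \<in> \<Phi>" and \<alpha>: "\<alpha> \<in> P" "\<alpha> \<noteq> \<psi>"
  shows "refl \<psi> \<alpha> \<in> P"
proof -
  have R: "\<alpha> \<in> R" "\<psi> \<in> R" using pos_root simple_root assms by auto
  have "\<exists>\<phi>\<in>\<Phi>. \<phi> \<noteq> \<psi> \<and> coef \<Phi> \<alpha> \<phi> > 0"
  proof (rule ccontr)
    assume "\<not> ?thesis"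
    then have z: "coef \<Phi> \<alpha> \<phi> = 0" if "\<phi> \<in> \<Phi>" "\<phi> \<noteq> \<psi>" for \<phi>
      using that coef_nonneg[OF \<alpha>(1) that(1)] by force
    define n where "n = coef \<Phi> \<alpha> \<psi>"
    have "\<alpha> = int_comb \<Phi> (\<lambda>\<phi>. if \<phi> = \<psi> then n else 0)"
      by (subst coef_expansion[OF lattice_root[OF R(1)]], rule int_comb_cong) (simp add: n_def z)
    then have eq: "\<alpha> = of_int n * \<psi>" using int_comb_single[OF finite_simple \<psi>] by simp
    have "n \<ge> 0" using coef_nonneg \<alpha> \<psi> by (simp add: n_def)
    moreover have "n \<noteq> 0" using eq zero_not_root R(1) by (metis mult_zero_left of_int_0)
    moreover have "n \<noteq> 1" using eq \<alpha>(2) by auto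
    ultimately have "n \<ge> 2" by linarith
    then show False using multiple_not_root R eq by blast
  qed
  then obtain \<phi> where \<phi>: "\<phi> \<in> \<Phi>" "\<phi> \<noteq> \<psi>" "coef \<Phi> \<alpha> \<phi> > 0" by blast
  have "refl \<psi> \<alpha> = \<alpha> + of_int (- cint \<alpha> \<psi>) * \<psi>" using refl_root_eq R by simp
  then have "coef \<Phi> (refl \<psi> \<alpha>) \<phi> = coef \<Phi> \<alpha> \<phi> + (- cint \<alpha> \<psi>) * coef \<Phi> \<psi> \<phi>"
    using coef_add[OF lattice_root[OF R(1)] lattice_scale[OF lattice_root[OF R(2)]] \<phi>(1)]
      coef_scale[OF lattice_root[OF R(2)] \<phi>(1)] by (simp only:)
  then have "coef \<Phi> (refl \<psi> \<alpha>) \<phi> > 0" using \<phi> coef_simple[OF \<psi> \<phi>(1)] by simp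
  then show ?thesis using pos_if_coef_pos[OF refl_root[OF R(2,1)] \<phi>(1)] by blast
qed

end

context positive_roots
begin

subsection \<open>Weyl groups\<close>

text \<open>A root of P' outside P would have its negative in P, hence in P'.\<close>

lemma positive_system_subset_eq:
  assumes "positive_system R P'" "P \<subseteq> P'"
  shows "P' = P"
proof -
  interpret P': positive_roots R cr h P' using assms(1) by unfold_locales
  show ?thesis using assms(2) P'.pos_root root_cases P'.pos_not_minus by blast
qed

lemma refl_simple_image:
  assumes "\<psi> \<in> \<Phi>"
  shows "refl \<psi> ` P = insert (- \<psi>) (P - {\<psi>})"
proof -
  have \<psi>: "\<psi> \<in> R" using simple_root assms .
  have "refl \<psi> ` P = refl \<psi> ` insert \<psi> (P - {\<psi>})" using simple_pos[OF assms] by (simp add: insert_absorb)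
  also have "\<dots> = insert (- \<psi>) (refl \<psi> ` (P - {\<psi>}))" by (simp only: image_insert refl_self[OF \<psi>])
  also have "refl \<psi> ` (P - {\<psi>}) = P - {\<psi>}"
  proof (intro equalityI subsetI)
    fix \<alpha> assume "\<alpha> \<in> refl \<psi> ` (P - {\<psi>})"
    then obtain \<beta> where \<beta>: "\<beta> \<in> P" "\<beta> \<noteq> \<psi>" "\<alpha> = refl \<psi> \<beta>" by blast
    have "\<alpha> \<noteq> \<psi>"
    proof
      assume "\<alpha> = \<psi>"
      then have "\<beta> = refl \<psi> \<psi>" using \<beta>(3) refl_refl[OF \<psi>, of \<beta>] by simp
      then show False using \<beta>(1) refl_self[OF \<psi>] pos_not_minus simple_pos assms by metis
    qed
    then show "\<alpha> \<in> P - {\<psi>}" using refl_simple_pos assms \<beta> by blast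
  next
    fix \<alpha> assume \<alpha>: "\<alpha> \<in> P - {\<psi>}"
    then have "refl \<psi> \<alpha> \<in> P" using refl_simple_pos assms by blast
    moreover have "refl \<psi> \<alpha> \<noteq> \<psi>"
    proof
      assume "refl \<psi> \<alpha> = \<psi>"
      then have "\<alpha> = - \<psi>" using refl_refl[OF \<psi>, of \<alpha>] refl_self[OF \<psi>] by simp
      then show False using \<alpha> pos_not_minus simple_pos assms by blast
    qed
    ultimately show "\<alpha> \<in> refl \<psi> ` (P - {\<psi>})"
      using refl_refl[OF \<psi>, of \<alpha>] by (intro rev_image_eqI[of "refl \<psi> \<alpha>"]) auto
  qed
  finally show ?thesis .
qed

text \<open>If a simple root \<alpha> of P' is not in P, reflecting P' in \<alpha> replaces \<alpha>
  by -\<alpha> and permutes the other elements, so P' comes one root closer to P. If there is none,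
  then P' is generated inside P and equals it.\<close>

lemma positive_system_conjugate:
  assumes "positive_system R P'"
  shows "\<exists>\<alpha>s. set \<alpha>s \<subseteq> R \<and> P' = word \<alpha>s ` P"
  using assms
proof (induction "card (P' - P)" arbitrary: P' rule: less_induct)
  case less
  interpret P': positive_roots R cr h P' using less.prems by unfold_locales
  show ?case
  proof (cases "P'.\<Phi> \<subseteq> P")
    case True
    have "\<alpha> \<in> P" if "\<alpha> \<in> P'" for \<alpha>
      using that
    proof (induction rule: P'.pos_induct)
      case (add \<beta> \<gamma>)
      then show ?case using pos_add P'.pos_root by blast
    qed (use True in blast)
    then have "P = P'" using P'.positive_system_subset_eq[OF positive] by blast
    then show ?thesis by (intro exI[of _ "[]"]) simp
  next
    case False
    then obtain \<alpha> where \<alpha>: "\<alpha> \<in> P'.\<Phi>" "\<alpha> \<notin> P" by blast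
    have \<alpha>R: "\<alpha> \<in> R" using P'.simple_root \<alpha> by blast
    let ?Q = "word [\<alpha>] ` P'"
    have Q: "positive_system R ?Q" using positive_system_word[of "[\<alpha>]" P'] \<alpha>R less.prems by simp
    have "?Q = refl \<alpha> ` P'" by (rule image_cong) simp_all
    then have "?Q - P = (P' - P) - {\<alpha>}"
      using P'.refl_simple_image[OF \<alpha>(1)] pos_minus_iff[OF \<alpha>R] \<alpha>(2) by auto
    moreover have "\<alpha> \<in> P' - P" using \<alpha> P'.simple_pos by blast
    moreover have "finite (P' - P)" using P'.finite_pos by simp
    ultimately have "card (?Q - P) < card (P' - P)" by (metis card_Diff1_less)
    then obtain \<alpha>s where \<alpha>s: "set \<alpha>s \<subseteq> R" "?Q = word \<alpha>s ` P" using less.hyps Q by blast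
    have "P' = word [\<alpha>] ` ?Q" using \<alpha>R by (simp add: image_image)
    also have "\<dots> = word (\<alpha> # \<alpha>s) ` P" unfolding \<alpha>s(2) by (simp add: image_image)
    finally show ?thesis using \<alpha>s(1) \<alpha>R by (intro exI[of _ "\<alpha> # \<alpha>s"]) simp
  qed
qed

lemma card_simple_roots_eq: "positive_system R P' \<Longrightarrow> card (simple_roots P') = card \<Phi>"
proof -
  assume "positive_system R P'"
  then obtain \<alpha>s where \<alpha>s: "set \<alpha>s \<subseteq> R" "P' = word \<alpha>s ` P" using positive_system_conjugate by blast
  have "inj_on (word \<alpha>s) \<Phi>" by (rule inj_onI) (simp add: word_inj[OF \<alpha>s(1)])
  then show ?thesis using simple_roots_word[OF \<alpha>s(1), of P] \<alpha>s(2) by (simp add: card_image)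
qed

text \<open>Otherwise the expansion of \<alpha> in simple roots satisfies the hypotheses of
  \<open>posdef\<close> and \<alpha> = 0.\<close>

lemma exists_pos_simple:
  assumes "\<alpha> \<in> P"
  shows "\<exists>\<psi>\<in>\<Phi>. Re (\<alpha> (cr \<psi>)) > 0"
proof (rule ccontr)
  assume "\<not> ?thesis"
  then have le: "Re (\<alpha> (cr \<psi>)) \<le> 0" if "\<psi> \<in> \<Phi>" for \<psi> using that by force
  have ex: "int_comb \<Phi> (coef \<Phi> \<alpha>) = \<alpha>" using coef_expansion[OF pos_lattice[OF assms]] by simp
  have "\<Phi> \<subseteq> R" using simple_root by blast
  then have "int_comb \<Phi> (coef \<Phi> \<alpha>) = 0"
    using posdef[of \<Phi> "coef \<Phi> \<alpha>"] coef_nonneg[OF assms] le unfolding ex by blast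
  then show False using ex zero_not_root pos_root assms by metis
qed

section \<open>Generation by simple reflections, and the length of reduced words\<close>

definition height :: "'a functional \<Rightarrow> int" where
  "height \<alpha> = (\<Sum>\<psi>\<in>\<Phi>. coef \<Phi> \<alpha> \<psi>)"

lemma height_refl_less:
  assumes "\<alpha> \<in> P" "\<psi> \<in> \<Phi>" "Re (\<alpha> (cr \<psi>)) > 0"
  shows "height (refl \<psi> \<alpha>) < height \<alpha>"
proof -
  have R: "\<alpha> \<in> R" "\<psi> \<in> R" using pos_root simple_root assms by auto
  let ?n = "cint \<alpha> \<psi>"
  have n: "?n > 0" using cint[OF R(2,1)] assms(3) by simp
  have eq: "refl \<psi> \<alpha> = \<alpha> + of_int (- ?n) * \<psi>" using refl_root_eq R by simp
  have "coef \<Phi> (refl \<psi> \<alpha>) \<phi> = coef \<Phi> \<alpha> \<phi> - (if \<phi> = \<psi> then ?n else 0)" if "\<phi> \<in> \<Phi>" for \<phi>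
    using coef_add[OF lattice_root[OF R(1)] lattice_scale[OF lattice_root[OF R(2)]] that]
      coef_scale[OF lattice_root[OF R(2)] that] coef_simple[OF assms(2) that] unfolding eq by (simp del: of_int_minus)
  then have "height (refl \<psi> \<alpha>) = (\<Sum>\<phi>\<in>\<Phi>. coef \<Phi> \<alpha> \<phi> - (if \<phi> = \<psi> then ?n else 0))"
    unfolding height_def by (rule sum.cong[OF HOL.refl])
  also have "\<dots> = height \<alpha> - ?n"
    unfolding height_def using assms(2) finite_simple by (simp add: sum_subtractf)
  finally show ?thesis using n by simp
qed

lemma height_nonneg: "\<alpha> \<in> P \<Longrightarrow> 0 \<le> height \<alpha>"
  unfolding height_def using coef_nonneg by (simp add: sum_nonneg)

text \<open>Reflecting in a simple root on which the Cartan integer is positive lowers the height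
  and keeps the root positive; the descent can only end at a simple root.\<close>

lemma pos_conjugate_simple:
  "\<alpha> \<in> P \<Longrightarrow> \<exists>\<psi>s \<psi>. set \<psi>s \<subseteq> \<Phi> \<and> \<psi> \<in> \<Phi> \<and> \<alpha> = word \<psi>s \<psi>"
proof (induction "nat (height \<alpha>)" arbitrary: \<alpha> rule: less_induct)
  case less
  show ?case
  proof (cases "\<alpha> \<in> \<Phi>")
    case True
    then show ?thesis by (intro exI[of _ "[]"] exI[of _ \<alpha>]) simp
  next
    case False
    obtain \<psi> where \<psi>: "\<psi> \<in> \<Phi>" "Re (\<alpha> (cr \<psi>)) > 0" using exists_pos_simple less.prems by blast
    have pos: "refl \<psi> \<alpha> \<in> P" using refl_simple_pos \<psi>(1) less.prems False by blast
    have "nat (height (refl \<psi> \<alpha>)) < nat (height \<alpha>)"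
      using height_refl_less[OF less.prems \<psi>] height_nonneg[OF pos] by linarith
    then obtain \<psi>s \<phi> where s: "set \<psi>s \<subseteq> \<Phi>" "\<phi> \<in> \<Phi>" "refl \<psi> \<alpha> = word \<psi>s \<phi>"
      using less.hyps pos by blast
    have "\<alpha> = word (\<psi> # \<psi>s) \<phi>" using s(3) refl_refl[OF simple_root[OF \<psi>(1)], of \<alpha>] by simp
    then show ?thesis using s \<psi>(1) by (intro exI[of _ "\<psi> # \<psi>s"] exI[of _ \<phi>]) simp
  qed
qed

lemma refl_minus: "\<alpha> \<in> R \<Longrightarrow> \<mu> \<in> dual_space h \<Longrightarrow> refl (- \<alpha>) \<mu> = refl \<alpha> \<mu>"
  using coroot_minus[of \<alpha> \<mu>] by (simp add: refl_def fun_apply)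

text \<open>A positive root is w\<psi> for a word w in simple roots and a simple \<psi>, so by
  \<open>refl_word\<close> its reflection is the conjugate of that of \<psi> by w. Opposite roots
  have the same reflection.\<close>

lemma refl_simple_word:
  assumes "\<alpha> \<in> R"
  shows "\<exists>\<psi>s. set \<psi>s \<subseteq> \<Phi> \<and> (\<forall>\<mu>\<in>dual_space h. refl \<alpha> \<mu> = word \<psi>s \<mu>)"
proof -
  have pos: "\<exists>\<psi>s. set \<psi>s \<subseteq> \<Phi> \<and> (\<forall>\<mu>\<in>dual_space h. refl \<beta> \<mu> = word \<psi>s \<mu>)" if "\<beta> \<in> P" for \<beta>
  proof -
    obtain \<psi>s \<psi> where s: "set \<psi>s \<subseteq> \<Phi>" "\<psi> \<in> \<Phi>" "\<beta> = word \<psi>s \<psi>"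
      using pos_conjugate_simple \<open>\<beta> \<in> P\<close> by blast
    have "set \<psi>s \<subseteq> R" using s simple_root by blast
    then have "refl \<beta> \<mu> = word (\<psi>s @ \<psi> # rev \<psi>s) \<mu>" if "\<mu> \<in> dual_space h" for \<mu>
      using refl_word[of \<psi>s \<psi> \<mu>] that s simple_root by simp
    moreover have "set (\<psi>s @ \<psi> # rev \<psi>s) \<subseteq> \<Phi>" using s by simp
    ultimately show ?thesis by blast
  qed
  show ?thesis
  proof (cases "\<alpha> \<in> P")
    case False
    then show ?thesis using pos[of "- \<alpha>"] pos_minus_iff[OF assms] refl_minus[OF assms] by simp
  qed (rule pos)
qed

lemma word_simple_word:
  "set \<alpha>s \<subseteq> R \<Longrightarrow> \<exists>\<psi>s. set \<psi>s \<subseteq> \<Phi> \<and> (\<forall>\<mu>\<in>dual_space h. word \<alpha>s \<mu> = word \<psi>s \<mu>)"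
proof (induction \<alpha>s)
  case Nil
  show ?case by (intro exI[of _ "[]"]) simp
next
  case (Cons \<alpha> \<alpha>s)
  then obtain \<psi>s where s: "set \<psi>s \<subseteq> \<Phi>" "\<And>\<mu>. \<mu> \<in> dual_space h \<Longrightarrow> word \<alpha>s \<mu> = word \<psi>s \<mu>" by auto
  obtain \<phi>s where p: "set \<phi>s \<subseteq> \<Phi>" "\<And>\<mu>. \<mu> \<in> dual_space h \<Longrightarrow> refl \<alpha> \<mu> = word \<phi>s \<mu>"
    using refl_simple_word[of \<alpha>] Cons.prems by auto
  have "set \<psi>s \<subseteq> R" using s simple_root by blast
  then have "word (\<alpha> # \<alpha>s) \<mu> = word (\<phi>s @ \<psi>s) \<mu>" if "\<mu> \<in> dual_space h" for \<mu>
    using that s(2) p(2) word_dual by simp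
  then show ?case using s p by (intro exI[of _ "\<phi>s @ \<psi>s"]) simp
qed

text \<open>Applying the letters from the right, some letter \<psi> turns a positive root negative;
  by \<open>refl_simple_pos\<close> that root is \<psi> itself.\<close>

lemma word_neg_split:
  "set \<psi>s \<subseteq> \<Phi> \<Longrightarrow> \<alpha> \<in> P \<Longrightarrow> word \<psi>s \<alpha> \<notin> P \<Longrightarrow> \<exists>l \<psi> m. \<psi>s = l @ \<psi> # m \<and> word m \<alpha> = \<psi>"
proof (induction \<psi>s)
  case (Cons \<psi> \<psi>s)
  show ?case
  proof (cases "word \<psi>s \<alpha> \<in> P")
    case True
    have "word \<psi>s \<alpha> = \<psi>"
      using Cons.prems True refl_simple_pos[of \<psi> "word \<psi>s \<alpha>"] by auto
    then show ?thesis by (intro exI[of _ "[]"] exI[of _ \<psi>] exI[of _ \<psi>s]) simp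
  next
    case False
    then obtain l \<phi> m where "\<psi>s = l @ \<phi> # m" "word m \<alpha> = \<phi>" using Cons by auto
    then show ?thesis by (intro exI[of _ "\<psi> # l"] exI[of _ \<phi>] exI[of _ m]) simp
  qed
qed simp

text \<open>Words are compared on \<open>dual_space h\<close> only: by
  \<open>reflection_product_eq_iff\<close> this is equality of the Weyl group elements to which
  \<open>weyl_length\<close> refers.\<close>

definition reduced_word :: "'a functional list \<Rightarrow> bool" where
  "reduced_word \<psi>s \<longleftrightarrow> set \<psi>s \<subseteq> \<Phi> \<and>
     (\<forall>\<phi>s. set \<phi>s \<subseteq> \<Phi> \<and> (\<forall>\<mu>\<in>dual_space h. word \<phi>s \<mu> = word \<psi>s \<mu>) \<longrightarrow> length \<psi>s \<le> length \<phi>s)"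

text \<open>The deletion condition: if the inverse of \<open>w\<close> makes \<open>\<psi>\<close> negative, then \<open>s\<^sub>\<psi> w\<close> is shorter than \<open>w\<close>.\<close>

lemma reduced_word_pos:
  assumes red: "reduced_word (\<psi> # \<psi>s)"
  shows "word (rev \<psi>s) \<psi> \<in> P"
proof (rule ccontr)
  assume neg: "word (rev \<psi>s) \<psi> \<notin> P"
  have \<psi>: "\<psi> \<in> \<Phi>" "set \<psi>s \<subseteq> \<Phi>" using red by (auto simp: reduced_word_def)
  obtain l \<phi> m where s: "rev \<psi>s = l @ \<phi> # m" "word m \<psi> = \<phi>"
    using word_neg_split[of "rev \<psi>s" \<psi>] \<psi> neg simple_pos by auto
  have "rev (rev \<psi>s) = rev (l @ \<phi> # m)" using s(1) by (rule arg_cong)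
  then have \<psi>s: "\<psi>s = rev m @ \<phi> # rev l" by simp
  have sub: "set m \<subseteq> \<Phi>" "set l \<subseteq> \<Phi>" "\<phi> \<in> \<Phi>" using \<psi>(2) unfolding \<psi>s by auto
  then have R: "set m \<subseteq> R" "set l \<subseteq> R" "\<phi> \<in> R" using simple_root by auto
  have \<psi>m: "\<psi> = word (rev m) \<phi>" using s(2) R by auto
  \<comment> \<open>The reflection in \<psi> is the one in \<phi> conjugated by m. It cancels the
    letter \<phi> of \<open>\<psi>s\<close>, so the new word is shorter by two letters.\<close>
  have "word (\<psi> # \<psi>s) \<mu> = word (rev m @ rev l) \<mu>" if \<mu>: "\<mu> \<in> dual_space h" for \<mu>
  proof -
    have "set \<psi>s \<subseteq> R" using \<psi>(2) simple_root by blast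
    then have "word \<psi>s \<mu> \<in> dual_space h" using word_dual \<mu> by blast
    then have "refl \<psi> (word \<psi>s \<mu>) = word (rev m) (refl \<phi> (word m (word \<psi>s \<mu>)))"
      using refl_word[of "rev m" \<phi> "word \<psi>s \<mu>"] R \<psi>m by simp
    also have "\<dots> = word (rev m) (word (rev l) \<mu>)"
      unfolding \<psi>s using R by simp
    finally show ?thesis by simp
  qed
  then have "length (\<psi> # \<psi>s) \<le> length (rev m @ rev l)"
    using red sub unfolding reduced_word_def by (metis set_append set_rev Un_subset_iff)
  then show False unfolding \<psi>s by simp
qed

lemma reduced_word_tl: "reduced_word (\<psi> # \<psi>s) \<Longrightarrow> reduced_word \<psi>s"
  unfolding reduced_word_def
proof (intro conjI allI impI)
  assume r: "set (\<psi> # \<psi>s) \<subseteq> \<Phi> \<and> (\<forall>\<phi>s. set \<phi>s \<subseteq> \<Phi> \<and> (\<forall>\<mu>\<in>dual_space h. word \<phi>s \<mu> = word (\<psi> # \<psi>s) \<mu>) \<longrightarrow>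
    length (\<psi> # \<psi>s) \<le> length \<phi>s)"
  then show "set \<psi>s \<subseteq> \<Phi>" by simp
  fix \<phi>s assume a: "set \<phi>s \<subseteq> \<Phi> \<and> (\<forall>\<mu>\<in>dual_space h. word \<phi>s \<mu> = word \<psi>s \<mu>)"
  then have "set (\<psi> # \<phi>s) \<subseteq> \<Phi>" "\<forall>\<mu>\<in>dual_space h. word (\<psi> # \<phi>s) \<mu> = word (\<psi> # \<psi>s) \<mu>"
    using r by simp_all
  then have "length (\<psi> # \<psi>s) \<le> length (\<psi> # \<phi>s)" using r by blast
  then show "length \<psi>s \<le> length \<phi>s" by simp
qed

text \<open>Putting \<psi> in front makes exactly one more positive root negative, namely the
  preimage of \<psi> under the shorter word; it is positive by
  \<open>reduced_word_pos\<close>.\<close>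

lemma length_reduced_word:
  "reduced_word \<psi>s \<Longrightarrow> length \<psi>s = card {\<alpha> \<in> P. word \<psi>s \<alpha> \<notin> P}"
proof (induction \<psi>s)
  case (Cons \<psi> \<psi>s)
  have \<psi>: "\<psi> \<in> \<Phi>" "\<psi> \<in> R" and R: "set \<psi>s \<subseteq> R"
    using Cons.prems simple_root by (auto simp: reduced_word_def)
  let ?\<beta> = "word (rev \<psi>s) \<psi>"
  have \<beta>: "?\<beta> \<in> P" using reduced_word_pos Cons.prems by blast
  have iff: "word (\<psi> # \<psi>s) \<alpha> \<notin> P \<longleftrightarrow> word \<psi>s \<alpha> \<notin> P \<or> \<alpha> = ?\<beta>" if "\<alpha> \<in> P" for \<alpha>
  proof (cases "\<alpha> = ?\<beta>")
    case True
    then have "word (\<psi> # \<psi>s) \<alpha> = - \<psi>" using refl_self[OF \<psi>(2)] R by simp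
    then show ?thesis using True pos_not_minus[OF simple_pos[OF \<psi>(1)]] by simp
  next
    case False
    let ?\<gamma> = "word \<psi>s \<alpha>"
    have \<gamma>: "?\<gamma> \<in> R" using word_root R that pos_root by blast
    have ne: "?\<gamma> \<noteq> \<psi>" using False R by auto
    have ne': "?\<gamma> \<noteq> - \<psi>"
    proof
      assume "?\<gamma> = - \<psi>"
      then have "\<alpha> = - ?\<beta>" using R word_minus[of "rev \<psi>s" \<psi>] by (metis word_rev')
      then show False using \<beta> that pos_not_minus by blast
    qed
    show ?thesis
    proof (cases "?\<gamma> \<in> P")
      case True
      then show ?thesis using refl_simple_pos[OF \<psi>(1) True ne] False by simp
    next
      case F: False
      then have "- ?\<gamma> \<in> P" using pos_minus_iff \<gamma> by blast
      moreover have "- ?\<gamma> \<noteq> \<psi>" using ne' by auto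
      ultimately have "refl \<psi> (- ?\<gamma>) \<in> P" using refl_simple_pos \<psi>(1) by blast
      then have "- refl \<psi> ?\<gamma> \<in> P" using word_minus[of "[\<psi>]" ?\<gamma>] by simp
      then show ?thesis using pos_not_minus[of "refl \<psi> ?\<gamma>"] F by auto
    qed
  qed
  have "{\<alpha> \<in> P. word (\<psi> # \<psi>s) \<alpha> \<notin> P} = insert ?\<beta> {\<alpha> \<in> P. word \<psi>s \<alpha> \<notin> P}"
    using iff \<beta> by blast
  moreover have "?\<beta> \<notin> {\<alpha> \<in> P. word \<psi>s \<alpha> \<notin> P}" using R simple_pos[OF \<psi>(1)] by simp
  moreover have "finite {\<alpha> \<in> P. word \<psi>s \<alpha> \<notin> P}" using finite_pos by simp
  moreover have "length \<psi>s = card {\<alpha> \<in> P. word \<psi>s \<alpha> \<notin> P}" using Cons reduced_word_tl by blast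
  ultimately show ?case by simp
qed simp

lemma exists_reduced_word:
  assumes "set \<alpha>s \<subseteq> R"
  obtains \<psi>s where "reduced_word \<psi>s" "\<forall>\<mu>\<in>dual_space h. word \<alpha>s \<mu> = word \<psi>s \<mu>"
proof -
  let ?Q = "\<lambda>\<psi>s. set \<psi>s \<subseteq> \<Phi> \<and> (\<forall>\<mu>\<in>dual_space h. word \<alpha>s \<mu> = word \<psi>s \<mu>)"
  obtain \<psi>s where \<psi>s: "?Q \<psi>s" "\<And>\<phi>s. ?Q \<phi>s \<Longrightarrow> length \<psi>s \<le> length \<phi>s"
    using word_simple_word[OF assms] ex_has_least_nat[of ?Q _ length] by metis
  show thesis
  proof (rule that)
    show "reduced_word \<psi>s"
      unfolding reduced_word_def
    proof (intro conjI allI impI)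
      fix \<phi>s assume a: "set \<phi>s \<subseteq> \<Phi> \<and> (\<forall>\<mu>\<in>dual_space h. word \<phi>s \<mu> = word \<psi>s \<mu>)"
      then have "?Q \<phi>s" using \<psi>s(1) by simp
      then show "length \<psi>s \<le> length \<phi>s" using \<psi>s(2) by blast
    qed (use \<psi>s in blast)
  qed (use \<psi>s in blast)
qed

text \<open>Some Weyl group element maps \<open>P\<close> to \<open>- P\<close> and has length \<open>card P\<close>, so a reduced word of
  maximal length makes all positive roots negative.\<close>

lemma longest_word_image:
  assumes red: "reduced_word \<psi>s" and max: "\<And>\<phi>s. reduced_word \<phi>s \<Longrightarrow> length \<phi>s \<le> length \<psi>s"
  shows "word \<psi>s ` P = uminus ` P"
proof -
  have "positive_system R (uminus ` P)"
  proof -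
    have "- \<alpha> + - \<beta> \<in> uminus ` P" if "\<alpha> \<in> P" "\<beta> \<in> P" "- \<alpha> + - \<beta> \<in> R" for \<alpha> \<beta>
    proof -
      have "\<alpha> + \<beta> \<in> R" using minus_root[OF that(3)] by (simp add: add.commute)
      then show ?thesis using pos_add that by (intro rev_image_eqI[of "\<alpha> + \<beta>"]) auto
    qed
    moreover have "uminus ` uminus ` P = P" by (simp add: image_image)
    moreover have "uminus ` P \<subseteq> R" using minus_root pos_root by blast
    ultimately show ?thesis
      unfolding positive_system_iff using positive[unfolded positive_system_iff]
      by (simp add: Int_commute Un_commute)
  qed
  then obtain \<alpha>s where \<alpha>s: "set \<alpha>s \<subseteq> R" "uminus ` P = word \<alpha>s ` P" using positive_system_conjugate by blast
  obtain \<phi>s where \<phi>s: "reduced_word \<phi>s" "\<forall>\<mu>\<in>dual_space h. word \<alpha>s \<mu> = word \<phi>s \<mu>"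
    using exists_reduced_word \<alpha>s by blast
  have "word \<phi>s \<alpha> \<notin> P" if "\<alpha> \<in> P" for \<alpha>
  proof -
    have "\<alpha> \<in> dual_space h" using that pos_root roots_dual by blast
    then have "word \<phi>s \<alpha> = word \<alpha>s \<alpha>" using \<phi>s(2) by simp
    then have "word \<phi>s \<alpha> \<in> uminus ` P" using \<alpha>s(2) that by simp
    then obtain \<beta> where "\<beta> \<in> P" "word \<phi>s \<alpha> = - \<beta>" by blast
    then show ?thesis using pos_not_minus[of \<beta>] by simp
  qed
  then have "{\<alpha> \<in> P. word \<phi>s \<alpha> \<notin> P} = P" by blast
  then have "card P \<le> card {\<alpha> \<in> P. word \<psi>s \<alpha> \<notin> P}"
    using max[OF \<phi>s(1)] length_reduced_word[OF \<phi>s(1)] length_reduced_word[OF red] by simp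
  then have all: "{\<alpha> \<in> P. word \<psi>s \<alpha> \<notin> P} = P"
    using card_seteq[OF finite_pos, of "{\<alpha> \<in> P. word \<psi>s \<alpha> \<notin> P}"] by simp
  have R: "set \<psi>s \<subseteq> R" using red simple_root by (auto simp: reduced_word_def)
  have sub: "word \<psi>s ` P \<subseteq> uminus ` P"
  proof
    fix \<beta> assume "\<beta> \<in> word \<psi>s ` P"
    then obtain \<alpha> where \<alpha>: "\<alpha> \<in> P" "\<beta> = word \<psi>s \<alpha>" by blast
    have "\<beta> \<notin> P" using all \<alpha> by blast
    moreover have "\<beta> \<in> R" using word_root R \<alpha> pos_root by blast
    ultimately show "\<beta> \<in> uminus ` P" using root_cases[of \<beta>] by (intro rev_image_eqI[of "- \<beta>"]) auto
  qed
  have "card (word \<psi>s ` P) = card P"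
    by (rule card_image) (rule inj_onI, simp add: word_inj[OF R])
  moreover have "card (uminus ` P) = card P" by (rule card_image) (rule inj_onI, simp)
  ultimately show ?thesis using card_seteq[OF finite_imageI[OF finite_pos] sub] by simp
qed

end

subsection \<open>Borel-de Siebenthal positive systems\<close>

lemma (in positive_roots) coef_word_image:
  assumes \<alpha>s: "set \<alpha>s \<subseteq> R" and \<mu>: "\<mu> \<in> root_lattice" and \<psi>: "\<psi> \<in> \<Phi>"
  shows "coef (simple_roots (word \<alpha>s ` P)) (word \<alpha>s \<mu>) (word \<alpha>s \<psi>) = coef \<Phi> \<mu> \<psi>"
proof -
  interpret P': positive_roots R cr h "word \<alpha>s ` P"
    using positive_system_word[OF \<alpha>s positive] by unfold_locales
  define c where "c = (\<lambda>\<xi>. coef \<Phi> \<mu> (word (rev \<alpha>s) \<xi>))"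
  have c: "c \<circ> word \<alpha>s = coef \<Phi> \<mu>"
    unfolding c_def comp_def word_rev'[OF \<alpha>s] ..
  have eq: "int_comb P'.\<Phi> c = word \<alpha>s \<mu>"
    unfolding simple_roots_word[OF \<alpha>s] int_comb_word[OF \<alpha>s] c coef_expansion[OF \<mu>, symmetric] ..
  have "word \<alpha>s \<psi> \<in> P'.\<Phi>" unfolding simple_roots_word[OF \<alpha>s] using \<psi> by blast
  then have "coef P'.\<Phi> (int_comb P'.\<Phi> c) (word \<alpha>s \<psi>) = c (word \<alpha>s \<psi>)" by (rule P'.coef_int_comb)
  then show ?thesis unfolding eq by (simp only: c_def word_rev'[OF \<alpha>s])
qed

lemma (in positive_roots) highest_root_word:
  assumes \<alpha>s: "set \<alpha>s \<subseteq> R" and \<delta>: "highest_root R P \<delta>"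
  shows "highest_root R (word \<alpha>s ` P) (word \<alpha>s \<delta>)"
  unfolding highest_root_def
proof (intro conjI ballI)
  show "word \<alpha>s \<delta> \<in> R" using word_root \<alpha>s \<delta> by (simp add: highest_root_def)
  fix \<beta> \<xi> assume \<beta>: "\<beta> \<in> R" and \<xi>: "\<xi> \<in> simple_roots (word \<alpha>s ` P)"
  let ?b = "word (rev \<alpha>s) \<beta>"
  have b: "?b \<in> R" "word \<alpha>s ?b = \<beta>" using \<alpha>s \<beta> word_root[of "rev \<alpha>s"] by simp_all
  obtain \<psi> where \<psi>: "\<psi> \<in> \<Phi>" "\<xi> = word \<alpha>s \<psi>" using \<xi> simple_roots_word[OF \<alpha>s] by blast
  have "coef \<Phi> ?b \<psi> \<le> coef \<Phi> \<delta> \<psi>" and "\<delta> \<in> R" using \<delta> b \<psi> by (simp_all add: highest_root_def)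
  then show "coef (simple_roots (word \<alpha>s ` P)) \<beta> \<xi> \<le> coef (simple_roots (word \<alpha>s ` P)) (word \<alpha>s \<delta>) \<xi>"
    using coef_word_image[OF \<alpha>s lattice_root[OF b(1)] \<psi>(1)] coef_word_image[OF \<alpha>s lattice_root \<psi>(1), of \<delta>]
    unfolding b(2) \<psi>(2) by simp
qed

text \<open>Compares two positive systems: a coefficient with respect to P' is determined by its
  values on the images of the simple roots of P under one word. It yields the relation between
  \<open>eps\<close> and \<open>lam\<close>, and the equality of two degrees in
  \<open>bds_cases\<close>.\<close>

lemma (in positive_roots) coef_word_expansion:
  assumes P': "positive_system R P'" and \<alpha>s: "set \<alpha>s \<subseteq> R" and \<alpha>: "\<alpha> \<in> R" and \<xi>: "\<xi> \<in> simple_roots P'"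
  shows "coef (simple_roots P') (word \<alpha>s \<alpha>) \<xi> =
    (\<Sum>\<psi>\<in>\<Phi>. coef \<Phi> \<alpha> \<psi> * coef (simple_roots P') (word \<alpha>s \<psi>) \<xi>)"
proof -
  interpret P': positive_roots R cr h P' using P' by unfold_locales
  have lat: "word \<alpha>s \<psi> \<in> P'.root_lattice" if "\<psi> \<in> \<Phi>" for \<psi>
    using P'.lattice_root word_root[OF \<alpha>s] simple_root that by blast
  have "word \<alpha>s \<alpha> = word \<alpha>s (int_comb \<Phi> (coef \<Phi> \<alpha>))"
    by (rule arg_cong[OF coef_expansion[OF lattice_root[OF \<alpha>]]])
  also have "\<dots> = (\<Sum>\<psi>\<in>\<Phi>. of_int (coef \<Phi> \<alpha> \<psi>) * word \<alpha>s \<psi>)"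
    unfolding int_comb_def by (simp only: word_sum word_scale)
  finally have "coef P'.\<Phi> (word \<alpha>s \<alpha>) \<xi> = (\<Sum>\<psi>\<in>\<Phi>. coef P'.\<Phi> (of_int (coef \<Phi> \<alpha> \<psi>) * word \<alpha>s \<psi>) \<xi>)"
    using P'.coef_sum[OF P'.lattice_scale[OF lat] \<xi>, of \<Phi> "\<lambda>i. i"] by (simp only:)
  also have "\<dots> = (\<Sum>\<psi>\<in>\<Phi>. coef \<Phi> \<alpha> \<psi> * coef P'.\<Phi> (word \<alpha>s \<psi>) \<xi>)"
    by (rule sum.cong[OF HOL.refl]) (simp only: P'.coef_scale[OF lat \<xi>])
  finally show ?thesis .
qed

lemma simple_roots_uminus:
  fixes P :: "'n::finite functional set"
  shows "simple_roots (uminus ` P) = uminus ` simple_roots P"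
proof -
  have *: "- \<alpha> \<in> simple_roots (uminus ` P) \<longleftrightarrow> \<alpha> \<in> simple_roots P" for \<alpha>
  proof -
    have "- \<alpha> = - \<beta> + - \<gamma> \<longleftrightarrow> \<alpha> = \<beta> + \<gamma>" for \<beta> \<gamma> :: "'n functional"
      using neg_equal_iff_equal[of \<alpha> "\<beta> + \<gamma>"] by (simp only: minus_add_distrib)
    moreover have "- \<alpha> \<in> uminus ` P \<longleftrightarrow> \<alpha> \<in> P" by (rule inj_image_mem_iff) (rule injI, simp)
    ultimately show ?thesis unfolding simple_roots_iff by (simp del: add_uminus_conv_diff)
  qed
  show ?thesis
  proof (intro equalityI subsetI)
    fix \<beta> assume \<beta>: "\<beta> \<in> simple_roots (uminus ` P)"
    then show "\<beta> \<in> uminus ` simple_roots P" using *[of "- \<beta>"] by (intro rev_image_eqI[of "- \<beta>"]) simp_all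
  qed (use * in blast)
qed

text \<open>The axiom \<open>compact_add\<close> is the grading modulo 2 of the Lie algebra by k and
  p, seen on roots.\<close>

locale compact_roots = root_system +
  fixes C
  assumes compact_root: "\<alpha> \<in> C \<Longrightarrow> \<alpha> \<in> R"
    and compact_minus: "\<alpha> \<in> C \<Longrightarrow> - \<alpha> \<in> C"
    and compact_add: "\<alpha> \<in> R \<Longrightarrow> \<beta> \<in> R \<Longrightarrow> \<alpha> + \<beta> \<in> R \<Longrightarrow> \<alpha> + \<beta> \<in> C \<longleftrightarrow> (\<alpha> \<in> C \<longleftrightarrow> \<beta> \<in> C)"

locale bds_roots = compact_roots + positive_roots +
  fixes \<nu> \<delta>
  assumes noncompact_simple: "{\<psi> \<in> simple_roots P. \<psi> \<notin> C} = {\<nu>}"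
    and highest: "highest_root R P \<delta>"
    and coef_highest: "coef (simple_roots P) \<delta> \<nu> = 2"
begin

abbreviation \<Phi>0 where "\<Phi>0 \<equiv> simple_roots P - {\<nu>}"
abbreviation R0 where "R0 \<equiv> {\<alpha> \<in> R. coef (simple_roots P) \<alpha> \<nu> = 0}"
abbreviation P0 where "P0 \<equiv> {\<alpha> \<in> P. coef (simple_roots P) \<alpha> \<nu> = 0}"

lemma \<nu>: "\<nu> \<in> \<Phi>" "\<nu> \<notin> C"
proof -
  have "\<nu> \<in> {\<psi> \<in> \<Phi>. \<psi> \<notin> C}" unfolding noncompact_simple by simp
  then show "\<nu> \<in> \<Phi>" "\<nu> \<notin> C" by simp_all
qed

lemma compact_simple:
  assumes "\<psi> \<in> \<Phi>0"
  shows "\<psi> \<in> C"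
proof (rule ccontr)
  assume "\<psi> \<notin> C"
  then have "\<psi> \<in> {\<psi> \<in> \<Phi>. \<psi> \<notin> C}" using assms by simp
  then show False using assms unfolding noncompact_simple by simp
qed

lemma compact_minus_iff: "- \<alpha> \<in> C \<longleftrightarrow> \<alpha> \<in> C"
  using compact_minus[of \<alpha>] compact_minus[of "- \<alpha>"] by auto

text \<open>Both sides are additive modulo 2, and \<nu> is the only odd simple root.\<close>

lemma compact_iff_even: "\<alpha> \<in> R \<Longrightarrow> \<alpha> \<in> C \<longleftrightarrow> even (coef \<Phi> \<alpha> \<nu>)"
proof -
  have pos: "\<alpha> \<in> C \<longleftrightarrow> even (coef \<Phi> \<alpha> \<nu>)" if "\<alpha> \<in> P" for \<alpha>
    using that
  proof (induction rule: pos_induct)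
    case (simple \<psi>)
    then show ?case using \<nu> compact_simple[of \<psi>] coef_simple[OF simple \<nu>(1)] by (cases "\<psi> = \<nu>") auto
  next
    case (add \<beta> \<gamma>)
    then show ?case
      using compact_add[of \<beta> \<gamma>] pos_root[of \<beta>] pos_root[of \<gamma>] pos_root[of "\<beta> + \<gamma>"]
        coef_add[OF pos_lattice pos_lattice \<nu>(1), of \<beta> \<gamma>] by simp
  qed
  assume \<alpha>: "\<alpha> \<in> R"
  show ?thesis
  proof (cases "\<alpha> \<in> P")
    case False
    then have "- \<alpha> \<in> P" using pos_minus_iff \<alpha> by blast
    then show ?thesis using pos[of "- \<alpha>"] coef_minus[OF lattice_root[OF \<alpha>] \<nu>(1)] compact_minus_iff by simp
  qed (rule pos)
qed

lemma highest_root: "\<delta> \<in> R"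
  using highest by (simp add: highest_root_def)

lemma coef_le_highest: "\<alpha> \<in> R \<Longrightarrow> \<psi> \<in> \<Phi> \<Longrightarrow> coef \<Phi> \<alpha> \<psi> \<le> coef \<Phi> \<delta> \<psi>"
  using highest by (simp add: highest_root_def)

lemma coef_\<nu>_le: "\<alpha> \<in> R \<Longrightarrow> coef \<Phi> \<alpha> \<nu> \<le> 2"
  using coef_le_highest[OF _ \<nu>(1)] coef_highest by simp

lemma coef_highest_pos: "\<psi> \<in> \<Phi> \<Longrightarrow> 1 \<le> coef \<Phi> \<delta> \<psi>"
  using coef_le_highest[OF simple_root, of \<psi> \<psi>] coef_simple[of \<psi> \<psi>] by simp

lemma highest_pos: "\<delta> \<in> P" "\<delta> \<in> C"
  using pos_if_coef_pos[OF highest_root \<nu>(1)] compact_iff_even[OF highest_root] coef_highest by simp_all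

lemma closed_subset_pos:
  assumes S: "S \<subseteq> R" "\<And>\<alpha>. \<alpha> \<in> S \<Longrightarrow> - \<alpha> \<in> S"
    and add: "\<And>\<alpha> \<beta>. \<alpha> \<in> S \<Longrightarrow> \<beta> \<in> S \<Longrightarrow> \<alpha> + \<beta> \<in> R \<Longrightarrow> \<alpha> + \<beta> \<in> S"
  shows "positive_roots S cr h (P \<inter> S)"
proof -
  interpret S: root_system S cr h using root_system_closed_subset[OF assms] .
  show ?thesis
  proof
    have "\<alpha> \<in> P \<inter> S \<or> \<alpha> \<in> uminus ` (P \<inter> S)" if "\<alpha> \<in> S" for \<alpha>
    proof (cases "\<alpha> \<in> P")
      case False
      then have "- \<alpha> \<in> P \<inter> S" using that S pos_minus_iff by blast
      then show ?thesis by (intro disjI2 rev_image_eqI[of "- \<alpha>"]) simp_all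
    qed (use that in blast)
    moreover have "uminus ` (P \<inter> S) \<subseteq> S" using S(2) by blast
    moreover have "(P \<inter> S) \<inter> uminus ` (P \<inter> S) = {}" using pos_not_minus by blast
    moreover have "\<alpha> + \<beta> \<in> P \<inter> S" if "\<alpha> \<in> P \<inter> S" "\<beta> \<in> P \<inter> S" "\<alpha> + \<beta> \<in> S" for \<alpha> \<beta>
      using that pos_add S(1) by blast
    ultimately show "positive_system S (P \<inter> S)" unfolding positive_system_iff by blast
  qed
qed

text \<open>The prefix \<open>K\<close> refers to the roots of k, the prefix \<open>Z\<close> below
  to those of l_0.\<close>

sublocale K: positive_roots C cr h "P \<inter> C"
  by (rule closed_subset_pos) (use compact_root compact_minus compact_add in blast)+

lemma P0_eq: "P \<inter> R0 = P0"
  using pos_root by blast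

sublocale Z: positive_roots R0 cr h P0
proof -
  have "positive_roots R0 cr h (P \<inter> R0)"
  proof (rule closed_subset_pos)
    show "- \<alpha> \<in> R0" if "\<alpha> \<in> R0" for \<alpha>
      using that minus_root coef_minus[OF lattice_root \<nu>(1)] by simp
    show "\<alpha> + \<beta> \<in> R0" if "\<alpha> \<in> R0" "\<beta> \<in> R0" "\<alpha> + \<beta> \<in> R" for \<alpha> \<beta>
      using that coef_add[OF lattice_root lattice_root \<nu>(1)] by simp
  qed blast
  then show "positive_roots R0 cr h P0" by (simp only: P0_eq)
qed

text \<open>Degrees of positive roots are nonnegative, so a root of degree 0 can split only into
  positive roots of degree 0.\<close>

lemma simple_roots_P0: "simple_roots P0 = \<Phi>0"
proof (intro equalityI subsetI)
  fix \<psi> assume \<psi>: "\<psi> \<in> \<Phi>0"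
  then show "\<psi> \<in> simple_roots P0"
    using coef_simple[of \<psi> \<nu>] \<nu>(1) by (auto simp: simple_roots_iff)
next
  fix \<alpha> assume \<alpha>: "\<alpha> \<in> simple_roots P0"
  then have \<alpha>P: "\<alpha> \<in> P" "coef \<Phi> \<alpha> \<nu> = 0" by (simp_all add: simple_roots_iff)
  have "\<alpha> \<in> \<Phi>"
    unfolding simple_roots_iff
  proof (intro conjI ballI notI)
    fix \<beta> \<gamma> assume bg: "\<beta> \<in> P" "\<gamma> \<in> P" "\<alpha> = \<beta> + \<gamma>"
    then have "coef \<Phi> \<beta> \<nu> + coef \<Phi> \<gamma> \<nu> = 0"
      using \<alpha>P(2) coef_add[OF pos_lattice pos_lattice \<nu>(1), of \<beta> \<gamma>] by simp
    then have "coef \<Phi> \<beta> \<nu> = 0" "coef \<Phi> \<gamma> \<nu> = 0"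
      using coef_nonneg[OF bg(1) \<nu>(1)] coef_nonneg[OF bg(2) \<nu>(1)] by linarith+
    then show False using \<alpha> bg unfolding simple_roots_iff by blast
  qed (use \<alpha>P in blast)
  moreover have "\<alpha> \<noteq> \<nu>" using \<alpha>P coef_simple[OF \<nu>(1) \<nu>(1)] by auto
  ultimately show "\<alpha> \<in> \<Phi>0" by blast
qed

lemma compact_positive_system_unique:
  assumes "positive_system C Q" "Q \<subseteq> P"
  shows "Q = P \<inter> C"
proof -
  interpret Q: positive_roots C cr h Q using assms(1) by unfold_locales
  show ?thesis
    using Q.positive_system_subset_eq[OF K.positive] assms(2) Q.pos_root by blast
qed

end

text \<open>The word \<open>ws\<close> represents the longest element of the Weyl group of l_0,
  characterised here by sending the positive roots of l_0 to the negative ones.\<close>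

locale bds_longest = bds_roots +
  fixes ws
  assumes ws_roots: "set ws \<subseteq> {\<alpha> \<in> R. coef (simple_roots P) \<alpha> \<nu> = 0}"
    and ws_image: "word ws ` {\<alpha> \<in> P. coef (simple_roots P) \<alpha> \<nu> = 0} = uminus ` {\<alpha> \<in> P. coef (simple_roots P) \<alpha> \<nu> = 0}"
begin

abbreviation lam where "lam \<equiv> word ws \<nu>"
abbreviation eps where "eps \<equiv> word ws \<delta>"

lemma ws_R: "set ws \<subseteq> R"
  using ws_roots by blast

text \<open>Each letter changes \<alpha> by a multiple of a root of degree 0.\<close>

lemma word_degree:
  assumes "set \<alpha>s \<subseteq> R0" "\<alpha> \<in> R"
  shows "coef \<Phi> (word \<alpha>s \<alpha>) \<nu> = coef \<Phi> \<alpha> \<nu>"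
  using assms(1)
proof (induction \<alpha>s)
  case (Cons \<beta> \<alpha>s)
  let ?a = "word \<alpha>s \<alpha>"
  have a: "?a \<in> R" using word_root[of \<alpha>s \<alpha>] Cons.prems assms(2) by auto
  have b: "\<beta> \<in> R" "coef \<Phi> \<beta> \<nu> = 0" using Cons.prems by simp_all
  have "refl \<beta> ?a = ?a + of_int (- cint ?a \<beta>) * \<beta>" using refl_root_eq[OF b(1) a] by simp
  then have "coef \<Phi> (refl \<beta> ?a) \<nu> = coef \<Phi> ?a \<nu> + (- cint ?a \<beta>) * coef \<Phi> \<beta> \<nu>"
    using coef_add[OF lattice_root[OF a] lattice_scale[OF lattice_root[OF b(1)]] \<nu>(1)]
      coef_scale[OF lattice_root[OF b(1)] \<nu>(1)] by (simp only:)
  then show ?case using Cons b(2) by simp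
qed simp

lemma ws_simple_image: "word ws ` \<Phi>0 = uminus ` \<Phi>0"
  using Z.simple_roots_word[of ws P0] ws_roots ws_image simple_roots_uminus[of P0]
  unfolding simple_roots_P0 by simp

lemma ws_simple: "\<psi> \<in> \<Phi>0 \<Longrightarrow> \<exists>\<phi>\<in>\<Phi>0. word ws \<psi> = - \<phi>"
  using ws_simple_image by blast

lemma ws_simple_surj: "\<phi> \<in> \<Phi>0 \<Longrightarrow> \<exists>\<psi>\<in>\<Phi>0. word ws \<psi> = - \<phi>"
  using ws_simple_image by (metis image_iff)

lemma lam_root: "lam \<in> R" "coef \<Phi> lam \<nu> = 1" "lam \<notin> C" "lam \<in> P"
proof -
  show R: "lam \<in> R" using word_root ws_R simple_root \<nu>(1) by blast
  show c: "coef \<Phi> lam \<nu> = 1"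
    using word_degree[OF ws_roots simple_root[OF \<nu>(1)]] coef_simple[OF \<nu>(1) \<nu>(1)] by simp
  show "lam \<notin> C" using compact_iff_even[OF R] c by simp
  show "lam \<in> P" using pos_if_coef_pos[OF R \<nu>(1)] c by simp
qed

lemma eps_root: "eps \<in> R" "coef \<Phi> eps \<nu> = 2" "eps \<in> C" "eps \<in> P" "eps \<notin> \<Phi>"
proof -
  show R: "eps \<in> R" using word_root ws_R highest_root by blast
  show c: "coef \<Phi> eps \<nu> = 2"
    using word_degree[OF ws_roots highest_root] coef_highest by simp
  show "eps \<in> C" using compact_iff_even[OF R] c by simp
  show "eps \<in> P" using pos_if_coef_pos[OF R \<nu>(1)] c by simp
  show "eps \<notin> \<Phi>" using coef_simple[of eps \<nu>] \<nu>(1) c by (auto split: if_splits)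
qed

text \<open>After undoing \<open>ws\<close> the claim compares a root with \<delta>, which has the
  largest coefficients. The word maps \<Phi>0 to -\<Phi>0 and so reverses the inequality, while the
  terms at \<nu> cancel because both degrees are 2.\<close>

lemma eps_lowest:
  assumes \<beta>: "\<beta> \<in> R" "coef \<Phi> \<beta> \<nu> = 2" and \<psi>: "\<psi> \<in> \<Phi>"
  shows "coef \<Phi> eps \<psi> \<le> coef \<Phi> \<beta> \<psi>"
proof -
  let ?b = "word (rev ws) \<beta>"
  have b: "?b \<in> R" "word ws ?b = \<beta>" using word_root[of "rev ws"] ws_R \<beta>(1) by simp_all
  have deg: "coef \<Phi> ?b \<nu> = 2" using word_degree[of "rev ws" \<beta>] ws_roots \<beta> by simp
  have "coef \<Phi> \<beta> \<psi> - coef \<Phi> eps \<psi> =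
      (\<Sum>\<phi>\<in>\<Phi>. coef \<Phi> ?b \<phi> * coef \<Phi> (word ws \<phi>) \<psi>) - (\<Sum>\<phi>\<in>\<Phi>. coef \<Phi> \<delta> \<phi> * coef \<Phi> (word ws \<phi>) \<psi>)"
    using coef_word_expansion[OF positive ws_R b(1) \<psi>] coef_word_expansion[OF positive ws_R highest_root \<psi>]
    unfolding b(2) by simp
  also have "\<dots> = (\<Sum>\<phi>\<in>\<Phi>. (coef \<Phi> ?b \<phi> - coef \<Phi> \<delta> \<phi>) * coef \<Phi> (word ws \<phi>) \<psi>)"
    by (simp add: left_diff_distrib sum_subtractf)
  also have "\<dots> \<ge> 0"
  proof (rule sum_nonneg)
    fix \<phi> assume \<phi>: "\<phi> \<in> \<Phi>"
    show "0 \<le> (coef \<Phi> ?b \<phi> - coef \<Phi> \<delta> \<phi>) * coef \<Phi> (word ws \<phi>) \<psi>"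
    proof (cases "\<phi> = \<nu>")
      case True
      then show ?thesis using deg coef_highest by simp
    next
      case False
      then obtain \<xi> where \<xi>: "\<xi> \<in> \<Phi>0" "word ws \<phi> = - \<xi>" using ws_simple \<phi> by blast
      then have "coef \<Phi> (word ws \<phi>) \<psi> \<le> 0"
        using coef_minus[OF lattice_simple \<psi>, of \<xi>] coef_simple[of \<xi> \<psi>] \<psi> by simp
      then show ?thesis using coef_le_highest[OF b(1) \<phi>] by (simp add: mult_nonpos_nonpos)
    qed
  qed
  finally show ?thesis by simp
qed

text \<open>If \<open>eps\<close> splits into compact positive roots, one summand has degree 2, and
  by \<open>eps_lowest\<close> the other is 0. The rank of the compact roots is not known at this
  point, so any further simple root of degree 2 has to be excluded by obtuseness.\<close>

lemma simple_roots_compact: "simple_roots (P \<inter> C) = \<Phi>0 \<union> {eps}"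
proof -
  have sub: "\<psi> \<in> K.\<Phi>" if "\<psi> \<in> \<Phi>0" for \<psi>
    using that compact_simple[OF that] by (simp add: simple_roots_iff)
  have deg: "coef \<Phi> \<alpha> \<nu> = 0 \<or> coef \<Phi> \<alpha> \<nu> = 2" if "\<alpha> \<in> P" "\<alpha> \<in> C" for \<alpha>
  proof -
    have "even (coef \<Phi> \<alpha> \<nu>)" using compact_iff_even pos_root that by blast
    moreover have "0 \<le> coef \<Phi> \<alpha> \<nu>" "coef \<Phi> \<alpha> \<nu> \<le> 2"
      using coef_nonneg[OF that(1) \<nu>(1)] coef_\<nu>_le[OF pos_root[OF that(1)]] by auto
    ultimately show ?thesis by presburger
  qed
  have no: False if "\<beta> \<in> P" "\<gamma> \<in> P" "\<beta> \<in> C" "\<gamma> \<in> C" "eps = \<beta> + \<gamma>" "coef \<Phi> \<beta> \<nu> = 2" for \<beta> \<gamma>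
  proof -
    have "coef \<Phi> \<gamma> \<psi> = 0" if "\<psi> \<in> \<Phi>" for \<psi>
      using eps_lowest[OF pos_root[OF \<open>\<beta> \<in> P\<close>] \<open>coef \<Phi> \<beta> \<nu> = 2\<close> that] coef_nonneg[OF \<open>\<gamma> \<in> P\<close> that]
        coef_add[OF pos_lattice pos_lattice that, OF \<open>\<beta> \<in> P\<close> \<open>\<gamma> \<in> P\<close>] \<open>eps = \<beta> + \<gamma>\<close> by simp
    then have "\<gamma> = 0" using coef_eq_zero_imp[OF pos_lattice[OF \<open>\<gamma> \<in> P\<close>]] by blast
    then show False using \<open>\<gamma> \<in> P\<close> pos_root zero_not_root by blast
  qed
  have eps: "eps \<in> K.\<Phi>"
    unfolding simple_roots_iff
  proof (intro conjI ballI notI)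
    fix \<beta> \<gamma> assume bg: "\<beta> \<in> P \<inter> C" "\<gamma> \<in> P \<inter> C" "eps = \<beta> + \<gamma>"
    then have "coef \<Phi> \<beta> \<nu> + coef \<Phi> \<gamma> \<nu> = 2"
      using coef_add[OF pos_lattice pos_lattice \<nu>(1), of \<beta> \<gamma>] eps_root(2) by simp
    then have "coef \<Phi> \<beta> \<nu> = 2 \<or> coef \<Phi> \<gamma> \<nu> = 2" using deg[of \<beta>] bg by auto
    moreover have "eps = \<gamma> + \<beta>" using bg(3) by (simp add: add.commute)
    ultimately show False using no[of \<beta> \<gamma>] no[of \<gamma> \<beta>] bg by blast
  qed (use eps_root in blast)
  have "\<beta> \<in> \<Phi>0 \<union> {eps}" if \<beta>: "\<beta> \<in> K.\<Phi>" for \<beta>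
  proof (rule ccontr)
    assume not: "\<beta> \<notin> \<Phi>0 \<union> {eps}"
    have \<beta>P: "\<beta> \<in> P" "\<beta> \<in> C" "\<beta> \<in> R" using \<beta> K.simple_pos pos_root by blast+
    have "coef \<Phi> \<beta> \<nu> \<noteq> 0"
    proof
      assume 0: "coef \<Phi> \<beta> \<nu> = 0"
      have "P0 \<subseteq> P \<inter> C" using compact_iff_even pos_root by auto
      then have "\<beta> \<in> simple_roots P0" using \<beta> 0 \<beta>P unfolding simple_roots_iff by blast
      then show False using not simple_roots_P0 by blast
    qed
    then have 2: "coef \<Phi> \<beta> \<nu> = 2" using deg \<beta>P by blast
    \<comment> \<open>The difference \<beta> - \<open>eps\<close> is a nonnegative combination of
      \<Phi>0, on which the coroot of \<beta> is nonpositive. Hence \<open>eps\<close> takes a value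
      of at least 2 on this coroot, while distinct simple roots are obtuse.\<close>
    define c where "c = (\<lambda>\<psi>. coef \<Phi> \<beta> \<psi> - coef \<Phi> eps \<psi>)"
    have "\<beta> = int_comb \<Phi> (coef \<Phi> \<beta>)" "eps = int_comb \<Phi> (coef \<Phi> eps)"
      using coef_expansion lattice_root \<beta>P(3) eps_root(1) by blast+
    then have "\<beta> (cr \<beta>) - eps (cr \<beta>) = (\<Sum>\<psi>\<in>\<Phi>. of_int (coef \<Phi> \<beta> \<psi>) * \<psi> (cr \<beta>)) - (\<Sum>\<psi>\<in>\<Phi>. of_int (coef \<Phi> eps \<psi>) * \<psi> (cr \<beta>))"
      using int_comb_apply[of \<Phi> _ "cr \<beta>"] by (metis (no_types))
    also have "\<dots> = (\<Sum>\<psi>\<in>\<Phi>. of_int (c \<psi>) * \<psi> (cr \<beta>))"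
      by (simp add: c_def left_diff_distrib sum_subtractf)
    finally have "Re (\<beta> (cr \<beta>) - eps (cr \<beta>)) = Re (\<Sum>\<psi>\<in>\<Phi>. of_int (c \<psi>) * \<psi> (cr \<beta>))"
      by (rule arg_cong)
    then have "Re (\<beta> (cr \<beta>)) - Re (eps (cr \<beta>)) = (\<Sum>\<psi>\<in>\<Phi>. of_int (c \<psi>) * Re (\<psi> (cr \<beta>)))"
      by simp
    also have "\<dots> \<le> 0"
    proof (rule sum_nonpos)
      fix \<psi> assume \<psi>: "\<psi> \<in> \<Phi>"
      show "of_int (c \<psi>) * Re (\<psi> (cr \<beta>)) \<le> 0"
      proof (cases "\<psi> = \<nu>")
        case True
        then show ?thesis using 2 eps_root(2) by (simp add: c_def)
      next
        case False
        then have "\<psi> \<in> K.\<Phi>" "\<psi> \<noteq> \<beta>" using sub \<psi> not by blast+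
        then have "Re (\<psi> (cr \<beta>)) \<le> 0" using K.simple_obtuse \<beta> by blast
        moreover have "c \<psi> \<ge> 0" using eps_lowest[OF \<beta>P(3) 2 \<psi>] by (simp add: c_def)
        ultimately show ?thesis by (simp add: mult_nonneg_nonpos)
      qed
    qed
    finally have "Re (eps (cr \<beta>)) > 0" using coroot_self[OF \<beta>P(3)] by simp
    moreover have "eps \<noteq> \<beta>" using not by blast
    ultimately show False using K.simple_obtuse[OF eps \<beta>] by simp
  qed
  then show ?thesis using sub eps by blast
qed

end

context bds_longest
begin

section \<open>The positive systems containing a given compact one\<close>

lemma coef_eps:
  assumes "positive_system R P'" "\<xi> \<in> simple_roots P'"
  shows "coef (simple_roots P') eps \<xi> =
    2 * coef (simple_roots P') lam \<xi> + (\<Sum>\<psi>\<in>\<Phi>0. coef \<Phi> \<delta> \<psi> * coef (simple_roots P') (word ws \<psi>) \<xi>)"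
  using coef_word_expansion[OF assms(1) ws_R highest_root assms(2)] coef_highest
    sum.remove[OF finite_simple \<nu>(1), of "\<lambda>\<psi>. coef \<Phi> \<delta> \<psi> * coef (simple_roots P') (word ws \<psi>) \<xi>"]
  by simp

lemma card_simple_compact: "card (\<Phi>0 \<union> {eps}) = card \<Phi>"
  using eps_root(5) \<nu>(1) finite_simple card_Suc_Diff1[of \<Phi> \<nu>] by simp

text \<open>The simple compact roots not in \<open>simple_roots P'\<close> reduce to a single one \<open>e\<close>, of degree \<open>2\<close>.
  If \<open>e = eps\<close>, the degrees of \<open>P\<close> and \<open>P'\<close> coincide; otherwise \<open>coef_eps\<close> determines the \<open>P'\<close>-degree
  of \<open>lam\<close>, which is \<open>1\<close> for reasons of parity.\<close>

lemma bds_cases: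
  assumes bds: "bds_roots R cr h C P' \<nu>' \<delta>'" and sub: "P \<inter> C \<subseteq> P'"
  shows "P' = P \<or> (\<exists>\<phi>'\<in>\<Phi>0. \<exists>\<phi>\<in>\<Phi>0. coef \<Phi> \<delta> \<phi>' = 1 \<and> word ws \<phi>' = - \<phi> \<and>
    simple_roots P' - {\<nu>'} = (\<Phi>0 \<union> {eps}) - {\<phi>} \<and> coef (simple_roots P') lam \<nu>' = 1)"
proof -
  interpret P': bds_roots R cr h C P' \<nu>' \<delta>' by (rule bds)
  have PC: "P' \<inter> C = P \<inter> C"
    using K.positive_system_subset_eq[OF P'.K.positive] sub by blast
  define f where "f = (\<lambda>\<alpha>. coef P'.\<Phi> \<alpha> \<nu>')"
  have \<psi>_K: "\<psi> \<in> \<Phi>0 \<union> {eps}" if "\<psi> \<in> P'.\<Phi>0" for \<psi>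
  proof -
    have "\<psi> \<in> P'.\<Phi>" "\<psi> \<in> C" using that P'.compact_simple[OF that] by blast+
    then have "\<psi> \<in> simple_roots (P' \<inter> C)" unfolding simple_roots_iff by blast
    then show ?thesis unfolding PC simple_roots_compact .
  qed
  have fin: "finite (\<Phi>0 \<union> {eps})" "finite P'.\<Phi>0" using finite_simple P'.finite_simple by simp_all
  have "card P'.\<Phi> = Suc (card P'.\<Phi>0)" using card_Suc_Diff1[OF P'.finite_simple P'.\<nu>(1)] by simp
  \<comment> \<open>The set \<Phi>0 with \<open>eps\<close> has as many elements as \<Phi>, hence as
    the simple roots of the conjugate system P', one more than \<open>P'.\<Phi>0\<close>.\<close>
  then have "card (\<Phi>0 \<union> {eps} - P'.\<Phi>0) = 1"
    using card_Diff_subset[OF fin(2), of "\<Phi>0 \<union> {eps}"] \<psi>_K card_simple_compact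
      card_simple_roots_eq[OF P'.positive] by (simp add: subset_iff)
  then obtain e where e: "\<Phi>0 \<union> {eps} - P'.\<Phi>0 = {e}" by (rule card_1_singletonE)
  have e_mem: "e \<in> \<Phi>0 \<union> {eps}" "e \<notin> P'.\<Phi>0" using e by blast+
  have eq: "P'.\<Phi>0 = (\<Phi>0 \<union> {eps}) - {e}" using e \<psi>_K e_mem by blast
  have f_simple: "f \<psi> = 0" if "\<psi> \<in> \<Phi>0 \<union> {eps}" "\<psi> \<noteq> e" for \<psi>
  proof -
    have "\<psi> \<in> P'.\<Phi>0" using that eq by blast
    then show ?thesis using P'.coef_simple[of \<psi> \<nu>'] P'.\<nu>(1) by (auto simp: f_def)
  qed
  have e_C: "e \<in> P'" "e \<in> C"
    using e_mem simple_roots_compact K.simple_pos[of e] PC by blast+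
  \<comment> \<open>If f vanished at e too, it would vanish on all compact positive roots, among
    them the highest root of P', whose degree is 2.\<close>
  have "f e \<noteq> 0"
  proof
    assume 0: "f e = 0"
    have "f \<alpha> = 0" if "\<alpha> \<in> P \<inter> C" for \<alpha>
      using that
    proof (induction rule: K.pos_induct)
      case (simple \<psi>)
      then show ?case using f_simple[of \<psi>] 0 unfolding simple_roots_compact by blast
    next
      case (add \<beta> \<gamma>)
      then have "\<beta> \<in> P'" "\<gamma> \<in> P'" using PC by blast+
      then show ?case using add P'.coef_add[OF P'.pos_lattice P'.pos_lattice P'.\<nu>(1)] by (simp add: f_def)
    qed
    then have "f \<delta>' = 0" using P'.highest_pos PC by blast
    then show False using P'.coef_highest by (simp add: f_def)
  qed
  moreover have "even (f e)" using P'.compact_iff_even P'.pos_root e_C by (simp add: f_def)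
  moreover have "0 \<le> f e" "f e \<le> 2"
    using P'.coef_nonneg[OF e_C(1) P'.\<nu>(1)] P'.coef_\<nu>_le[OF P'.pos_root[OF e_C(1)]] by (simp_all add: f_def)
  ultimately have f_e: "f e = 2" by presburger
  have f_eps: "f eps = 2 * f lam + (\<Sum>\<psi>\<in>\<Phi>0. coef \<Phi> \<delta> \<psi> * f (word ws \<psi>))"
    unfolding f_def by (rule coef_eps[OF P'.positive P'.\<nu>(1)])
  have f_minus: "f (- \<psi>) = - f \<psi>" if "\<psi> \<in> \<Phi>0" for \<psi>
    unfolding f_def using P'.coef_minus[OF P'.lattice_root P'.\<nu>(1)] simple_root that by blast
  show ?thesis
  proof (cases "e = eps")
    case True
    have f0: "f (word ws \<psi>) = 0" if \<psi>: "\<psi> \<in> \<Phi>0" for \<psi>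
    proof -
      obtain \<xi> where \<xi>: "\<xi> \<in> \<Phi>0" "word ws \<psi> = - \<xi>" using ws_simple \<psi> by blast
      moreover have "\<xi> \<noteq> e" using \<xi> eps_root(5) True by blast
      ultimately show ?thesis using f_simple[of \<xi>] f_minus[of \<xi>] by simp
    qed
    then have f_lam: "f lam = 1" using f_eps f_e True by simp
    \<comment> \<open>The values of f on the images of \<Phi> under \<open>ws\<close> are now known:
      1 on \<open>lam\<close> and 0 elsewhere. These are also the values of n_\<nu>.\<close>
    have f_eq: "f \<alpha> = coef \<Phi> \<alpha> \<nu>" if "\<alpha> \<in> R" for \<alpha>
    proof -
      let ?b = "word (rev ws) \<alpha>"
      have b: "?b \<in> R" "word ws ?b = \<alpha>" using word_root[of "rev ws"] ws_R that by simp_all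
      have "f (word ws ?b) = (\<Sum>\<psi>\<in>\<Phi>. coef \<Phi> ?b \<psi> * f (word ws \<psi>))"
        unfolding f_def by (rule coef_word_expansion[OF P'.positive ws_R b(1) P'.\<nu>(1)])
      also have "\<dots> = coef \<Phi> ?b \<nu>"
        using sum.remove[OF finite_simple \<nu>(1), of "\<lambda>\<psi>. coef \<Phi> ?b \<psi> * f (word ws \<psi>)"] f0 f_lam by simp
      also have "\<dots> = coef \<Phi> \<alpha> \<nu>" using word_degree[of "rev ws" \<alpha>] ws_roots that by simp
      finally show ?thesis unfolding b(2) .
    qed
    have "P \<subseteq> P'"
    proof
      fix \<alpha> assume \<alpha>: "\<alpha> \<in> P"
      then have R: "\<alpha> \<in> R" by (rule pos_root)
      show "\<alpha> \<in> P'"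
      proof (cases "coef \<Phi> \<alpha> \<nu> = 0")
        case True
        then have "\<alpha> \<in> C" using compact_iff_even[OF R] by simp
        then show ?thesis using sub \<alpha> by blast
      next
        case False
        then have "f \<alpha> > 0" using coef_nonneg[OF \<alpha> \<nu>(1)] f_eq[OF R] by simp
        then show ?thesis using P'.pos_if_coef_pos[OF R P'.\<nu>(1)] by (simp add: f_def)
      qed
    qed
    then show ?thesis using positive_system_subset_eq[OF P'.positive] by blast
  next
    case False
    then have e\<Phi>: "e \<in> \<Phi>0" using e_mem by blast
    obtain \<phi>' where \<phi>': "\<phi>' \<in> \<Phi>0" "word ws \<phi>' = - e" using ws_simple_surj e\<Phi> by blast
    have f0: "f (word ws \<psi>) = (if \<psi> = \<phi>' then - 2 else 0)" if \<psi>: "\<psi> \<in> \<Phi>0" for \<psi>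
    proof (cases "\<psi> = \<phi>'")
      case True
      then show ?thesis using \<phi>'(2) f_minus[OF e\<Phi>] f_e by simp
    next
      case ne: False
      obtain \<xi> where \<xi>: "\<xi> \<in> \<Phi>0" "word ws \<psi> = - \<xi>" using ws_simple \<psi> by blast
      have "\<xi> \<noteq> e" using ne \<xi>(2) \<phi>'(2) word_inj[OF ws_R, of \<psi> \<phi>'] by metis
      then show ?thesis using \<xi> f_simple[of \<xi>] f_minus[of \<xi>] ne by simp
    qed
    have "(\<Sum>\<psi>\<in>\<Phi>0. coef \<Phi> \<delta> \<psi> * f (word ws \<psi>)) = (\<Sum>\<psi>\<in>\<Phi>0. if \<psi> = \<phi>' then - 2 * coef \<Phi> \<delta> \<psi> else 0)"
      using f0 by (intro sum.cong[OF HOL.refl]) simp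
    also have "\<dots> = - 2 * coef \<Phi> \<delta> \<phi>'" using \<phi>'(1) finite_simple by simp
    finally have f_lam: "f lam = coef \<Phi> \<delta> \<phi>'" using f_eps f_simple[of eps] False by simp
    have "1 \<le> coef \<Phi> \<delta> \<phi>'" using coef_highest_pos \<phi>'(1) by blast
    moreover have "f lam \<le> 2" unfolding f_def using P'.coef_\<nu>_le[OF lam_root(1)] .
    moreover have "odd (f lam)" unfolding f_def using P'.compact_iff_even[OF lam_root(1)] lam_root(3) by simp
    ultimately have "f lam = 1" using f_lam by presburger
    then show ?thesis using \<phi>' e\<Phi> f_lam eq unfolding f_def by metis
  qed
qed

end

section \<open>Construction of the exchanged positive system\<close>

locale bds_exchange = bds_longest +
  fixes \<phi> \<phi>'
  assumes \<phi>': "\<phi>' \<in> simple_roots P - {\<nu>}" and coef_\<phi>': "coef (simple_roots P) \<delta> \<phi>' = 1"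
    and \<phi>: "\<phi> \<in> simple_roots P - {\<nu>}" and ws_\<phi>': "word ws \<phi>' = - \<phi>"
begin

text \<open>The function that takes the value \<open>2\<close> on \<open>\<phi>\<close> and \<open>0\<close> on the other simple compact roots, in terms
  of the basis \<open>word ws ` \<Phi>\<close>.  It turns out to be the coefficient of the noncompact simple root in the
  new positive system.\<close>

definition degree :: "'a functional \<Rightarrow> int" where
  "degree \<alpha> = coef \<Phi> (word (rev ws) \<alpha>) \<nu> - 2 * coef \<Phi> (word (rev ws) \<alpha>) \<phi>'"

lemma inv_root: "\<alpha> \<in> R \<Longrightarrow> word (rev ws) \<alpha> \<in> R"
  using word_root[of "rev ws"] ws_R by simp

lemma inv_lattice: "\<alpha> \<in> R \<Longrightarrow> word (rev ws) \<alpha> \<in> root_lattice"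
  using inv_root lattice_root by blast

lemma degree_add: "\<alpha> \<in> R \<Longrightarrow> \<beta> \<in> R \<Longrightarrow> degree (\<alpha> + \<beta>) = degree \<alpha> + degree \<beta>"
  unfolding degree_def word_add using coef_add[OF inv_lattice inv_lattice] \<nu>(1) \<phi>' by simp

lemma degree_minus: "\<alpha> \<in> R \<Longrightarrow> degree (- \<alpha>) = - degree \<alpha>"
  unfolding degree_def word_minus using coef_minus[OF inv_lattice] \<nu>(1) \<phi>' by simp

lemma even_degree: "\<alpha> \<in> R \<Longrightarrow> even (degree \<alpha>) \<longleftrightarrow> \<alpha> \<in> C"
  unfolding degree_def using word_degree[of "rev ws" \<alpha>] ws_roots compact_iff_even[of \<alpha>] by simp

text \<open>The place where n_\<phi>'(\<delta>) = 1 enters as a bound. If the pulled back root is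
  positive, its degree is at most its coefficient of \<nu>. If it is negative, its degree is at most
  twice the coefficient of \<phi>' in the opposite root, hence at most 2.\<close>

lemma degree_le: "\<alpha> \<in> R \<Longrightarrow> degree \<alpha> \<le> 2"
proof -
  assume \<alpha>: "\<alpha> \<in> R"
  let ?b = "word (rev ws) \<alpha>"
  have b: "?b \<in> R" using inv_root \<alpha> .
  have P: "\<phi>' \<in> \<Phi>" using \<phi>' by blast
  show ?thesis
  proof (cases "?b \<in> P")
    case True
    then show ?thesis unfolding degree_def
      using coef_nonneg[OF True P] coef_\<nu>_le[OF b] by simp
  next
    case False
    then have m: "- ?b \<in> P" using pos_minus_iff b by blast
    show ?thesis unfolding degree_def
      using coef_nonneg[OF m \<nu>(1)] coef_le_highest[OF pos_root[OF m] P] coef_\<phi>'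
        coef_minus[OF lattice_root[OF b] P] coef_minus[OF lattice_root[OF b] \<nu>(1)] by simp
  qed
qed

lemma degree_lam: "degree lam = 1"
  unfolding degree_def using ws_R coef_simple[OF \<nu>(1) \<nu>(1)] coef_simple[OF \<nu>(1), of \<phi>'] \<phi>' by simp

lemma eps_not_\<phi>: "eps \<noteq> \<phi>"
  using eps_root(5) \<phi> by blast

text \<open>Pulling back by \<open>ws\<close> turns \<open>eps\<close> into \<delta>, of degree 2 -
  2 * 1 = 0, and an element of \<Phi>0 into some -\<xi>, whose degree is twice the coefficient of
  \<phi>' in \<xi>.\<close>

lemma degree_simple_compact: "\<psi> \<in> \<Phi>0 \<union> {eps} \<Longrightarrow> degree \<psi> = (if \<psi> = \<phi> then 2 else 0)"
proof (cases "\<psi> = eps")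
  case True
  then show ?thesis unfolding degree_def using ws_R coef_highest coef_\<phi>' eps_not_\<phi> by simp
next
  case False
  assume "\<psi> \<in> \<Phi>0 \<union> {eps}"
  then have "\<psi> \<in> \<Phi>0" using False by blast
  then obtain \<xi> where \<xi>: "\<xi> \<in> \<Phi>0" "word ws \<xi> = - \<psi>" using ws_simple_surj by blast
  have inv: "word (rev ws) \<psi> = - \<xi>"
    using word_rev'[OF ws_R, of \<xi>] unfolding \<xi>(2) word_minus by (metis minus_minus)
  have iff: "\<psi> = \<phi> \<longleftrightarrow> \<xi> = \<phi>'"
    using word_inj[OF ws_R, of \<xi> \<phi>'] unfolding \<xi>(2) ws_\<phi>' by (simp add: eq_commute)
  have "degree \<psi> = - coef \<Phi> \<xi> \<nu> + 2 * coef \<Phi> \<xi> \<phi>'"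
    unfolding degree_def inv using coef_minus[OF lattice_simple, of \<xi>] \<xi>(1) \<nu>(1) \<phi>' by simp
  then show ?thesis
    using coef_simple[of \<xi>] \<xi>(1) \<nu>(1) \<phi>' iff by auto
qed

lemma degree_nonneg: "\<alpha> \<in> P \<inter> C \<Longrightarrow> 0 \<le> degree \<alpha>"
proof (induction rule: K.pos_induct)
  case (simple \<psi>)
  then show ?case using degree_simple_compact[of \<psi>] unfolding simple_roots_compact by simp
next
  case (add \<beta> \<gamma>)
  then show ?case using degree_add[of \<beta> \<gamma>] pos_root by simp
qed

text \<open>A lexicographic order: the degree decides, and the given compact system breaks ties.
  Roots of degree 0 are even, hence compact, so ties are always broken.\<close>

definition new_positive where
  "new_positive = {\<alpha> \<in> R. degree \<alpha> > 0 \<or> degree \<alpha> = 0 \<and> \<alpha> \<in> P \<inter> C}"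

lemma positive_system_new: "positive_system R new_positive"
  unfolding positive_system_iff
proof (intro conjI ballI impI)
  show "new_positive \<subseteq> R" by (auto simp: new_positive_def)
  show "new_positive \<inter> uminus ` new_positive = {}"
  proof (rule ccontr)
    assume "\<not> ?thesis"
    then obtain \<alpha> where \<alpha>: "\<alpha> \<in> new_positive" "- \<alpha> \<in> new_positive" by force
    then have "degree \<alpha> = 0" using degree_minus[of \<alpha>] by (auto simp: new_positive_def)
    then show False using \<alpha> degree_minus[of \<alpha>] pos_not_minus[of \<alpha>] by (auto simp: new_positive_def)
  qed
  show "new_positive \<union> uminus ` new_positive = R"
  proof (intro equalityI subsetI)
    fix \<alpha> assume "\<alpha> \<in> new_positive \<union> uminus ` new_positive"
    then show "\<alpha> \<in> R" using minus_root by (auto simp: new_positive_def)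
  next
    fix \<alpha> assume R: "\<alpha> \<in> R"
    have "\<alpha> \<in> new_positive \<or> - \<alpha> \<in> new_positive"
    proof (cases "degree \<alpha> = 0")
      case True
      then have "\<alpha> \<in> C" using even_degree[OF R] by simp
      then show ?thesis
        using True R root_cases[OF R] minus_root[OF R] degree_minus[OF R] compact_minus[of \<alpha>]
        by (auto simp: new_positive_def)
    next
      case False
      then show ?thesis using R minus_root[OF R] degree_minus[OF R] by (auto simp: new_positive_def)
    qed
    then show "\<alpha> \<in> new_positive \<union> uminus ` new_positive"
      by (metis UnCI imageI minus_minus)
  qed
  fix \<alpha> \<beta> assume a: "\<alpha> \<in> new_positive" "\<beta> \<in> new_positive" "\<alpha> + \<beta> \<in> R"
  then have R: "\<alpha> \<in> R" "\<beta> \<in> R" by (auto simp: new_positive_def)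
  note deg = degree_add[OF R]
  have nn: "degree \<alpha> \<ge> 0" "degree \<beta> \<ge> 0" using a by (auto simp: new_positive_def)
  show "\<alpha> + \<beta> \<in> new_positive"
  proof (cases "degree (\<alpha> + \<beta>) = 0")
    case True
    then have "\<alpha> \<in> P \<inter> C" "\<beta> \<in> P \<inter> C" using a deg nn by (auto simp: new_positive_def)
    then have "\<alpha> + \<beta> \<in> P \<inter> C" using pos_add a(3) compact_add R by blast
    then show ?thesis using True a(3) by (simp add: new_positive_def)
  next
    case False
    then show ?thesis using deg nn a(3) by (auto simp: new_positive_def)
  qed
qed

lemma compact_pos_new: "P \<inter> C \<subseteq> new_positive"
  using degree_nonneg pos_root by (force simp: new_positive_def)

text \<open>The lowest weight \<nu>' is represented by two properties: its degree is 1, and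
  subtracting a compact positive root of degree 0 never gives a root.\<close>

context
  fixes \<nu>'
  assumes \<nu>'_root: "\<nu>' \<in> R" and degree_\<nu>': "degree \<nu>' = 1"
    and \<nu>'_lowest: "\<And>\<gamma>. \<gamma> \<in> P \<inter> C \<Longrightarrow> degree \<gamma> = 0 \<Longrightarrow> \<nu>' - \<gamma> \<notin> R"
begin

text \<open>Degrees are nonnegative, so degree 0 splits as 0 + 0 and degree 1 as 0 + 1. The first
  case is settled by the simple compact roots, the second by minimality of \<nu>'. Equality then
  follows by counting, as all positive systems have equally many simple roots.\<close>

lemma simple_roots_new: "simple_roots new_positive = (\<Phi>0 \<union> {eps} - {\<phi>}) \<union> {\<nu>'}"
proof -
  interpret N: positive_roots R cr h new_positive using positive_system_new by unfold_locales
  have nn: "degree \<alpha> \<ge> 0" if "\<alpha> \<in> new_positive" for \<alpha> using that by (auto simp: new_positive_def)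
  have zero: "\<alpha> \<in> P \<inter> C" if "\<alpha> \<in> new_positive" "degree \<alpha> = 0" for \<alpha>
    using that by (auto simp: new_positive_def)
  have 1: "\<psi> \<in> N.\<Phi>" if \<psi>: "\<psi> \<in> \<Phi>0 \<union> {eps}" "\<psi> \<noteq> \<phi>" for \<psi>
  proof -
    have K: "\<psi> \<in> K.\<Phi>" using \<psi>(1) unfolding simple_roots_compact .
    show ?thesis
      unfolding simple_roots_iff
    proof (intro conjI ballI notI)
      show "\<psi> \<in> new_positive" using K.simple_pos[OF K] compact_pos_new by blast
      fix \<beta> \<gamma> assume bg: "\<beta> \<in> new_positive" "\<gamma> \<in> new_positive" "\<psi> = \<beta> + \<gamma>"
      have "degree \<beta> + degree \<gamma> = 0"
        using degree_add[OF N.pos_root N.pos_root, OF bg(1,2)] degree_simple_compact[OF \<psi>(1)] \<psi>(2) bg(3) by simp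
      then have "degree \<beta> = 0" "degree \<gamma> = 0" using nn[OF bg(1)] nn[OF bg(2)] by linarith+
      then show False using zero bg K unfolding simple_roots_iff by blast
    qed
  qed
  have no: False if "\<beta> \<in> new_positive" "\<gamma> \<in> new_positive" "\<nu>' = \<beta> + \<gamma>" "degree \<gamma> = 0" for \<beta> \<gamma>
  proof -
    have "\<beta> = \<nu>' - \<gamma>" using that(3) by simp
    then show False using \<nu>'_lowest[OF zero[OF that(2,4)] that(4)] N.pos_root[OF that(1)] by simp
  qed
  have 2: "\<nu>' \<in> N.\<Phi>"
    unfolding simple_roots_iff
  proof (intro conjI ballI notI)
    show "\<nu>' \<in> new_positive" using \<nu>'_root degree_\<nu>' by (simp add: new_positive_def)
    fix \<beta> \<gamma> assume bg: "\<beta> \<in> new_positive" "\<gamma> \<in> new_positive" "\<nu>' = \<beta> + \<gamma>"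
    have "degree \<beta> + degree \<gamma> = 1"
      using degree_add[OF N.pos_root N.pos_root, OF bg(1,2)] degree_\<nu>' bg(3) by simp
    then have "degree \<beta> = 0 \<or> degree \<gamma> = 0" using nn[OF bg(1)] nn[OF bg(2)] by linarith
    moreover have "\<nu>' = \<gamma> + \<beta>" using bg(3) by (simp add: add.commute)
    ultimately show False using no bg by blast
  qed
  have "\<nu>' \<notin> \<Phi>0 \<union> {eps} - {\<phi>}"
  proof
    assume "\<nu>' \<in> \<Phi>0 \<union> {eps} - {\<phi>}"
    then have "degree \<nu>' = (if \<nu>' = \<phi> then 2 else 0)" by (intro degree_simple_compact) blast
    then show False using degree_\<nu>' by (simp split: if_splits)
  qed
  moreover have "\<phi> \<in> \<Phi>0 \<union> {eps}" using \<phi> by blast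
  moreover have "finite (\<Phi>0 \<union> {eps})" using finite_simple by simp
  ultimately have "card ((\<Phi>0 \<union> {eps} - {\<phi>}) \<union> {\<nu>'}) = card (\<Phi>0 \<union> {eps})"
    using card_Suc_Diff1[of "\<Phi>0 \<union> {eps}" \<phi>] by simp
  also have "\<dots> = card N.\<Phi>" using card_simple_compact card_simple_roots_eq[OF positive_system_new] by simp
  finally have card: "card N.\<Phi> \<le> card ((\<Phi>0 \<union> {eps} - {\<phi>}) \<union> {\<nu>'})" by simp
  have "(\<Phi>0 \<union> {eps} - {\<phi>}) \<union> {\<nu>'} \<subseteq> N.\<Phi>" using 1 2 by blast
  then show ?thesis using card_seteq[OF N.finite_simple _ card] by simp
qed

text \<open>The coefficient of \<nu>' equals \<open>degree\<close>, since both are additive and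
  agree on the simple roots. At the highest root it is at least the degree 2 of \<phi>, and 2 is
  also the upper bound.\<close>

lemma bds_roots_new: "\<exists>\<delta>'. bds_roots R cr h C new_positive \<nu>' \<delta>'"
proof -
  interpret N: positive_roots R cr h new_positive using positive_system_new by unfold_locales
  obtain \<alpha>s where \<alpha>s: "set \<alpha>s \<subseteq> R" "new_positive = word \<alpha>s ` P"
    using positive_system_conjugate positive_system_new by blast
  let ?d = "word \<alpha>s \<delta>"
  have hr: "highest_root R new_positive ?d" using highest_root_word[OF \<alpha>s(1) highest] \<alpha>s(2) by simp
  have \<nu>'_simple: "\<nu>' \<in> N.\<Phi>" unfolding simple_roots_new by simp
  have coef_pos: "coef N.\<Phi> \<alpha> \<nu>' = degree \<alpha>" if "\<alpha> \<in> new_positive" for \<alpha>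
    using that
  proof (induction rule: N.pos_induct)
    case (simple \<psi>)
    then show ?case
      using N.coef_simple[OF simple \<nu>'_simple] degree_\<nu>' degree_simple_compact[of \<psi>]
      unfolding simple_roots_new by auto
  next
    case (add \<beta> \<gamma>)
    then show ?case
      using N.coef_add[OF N.pos_lattice N.pos_lattice \<nu>'_simple, of \<beta> \<gamma>]
        degree_add[OF N.pos_root N.pos_root, of \<beta> \<gamma>] by simp
  qed
  have coef: "coef N.\<Phi> \<alpha> \<nu>' = degree \<alpha>" if R: "\<alpha> \<in> R" for \<alpha>
  proof (cases "\<alpha> \<in> new_positive")
    case False
    then have "- \<alpha> \<in> new_positive" using N.pos_minus_iff R by blast
    then show ?thesis
      using coef_pos[of "- \<alpha>"] degree_minus[OF R] N.coef_minus[OF N.lattice_root[OF R] \<nu>'_simple] by simp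
  qed (rule coef_pos)
  have \<phi>_R: "\<phi> \<in> R" using \<phi> simple_root by blast
  have "2 = degree \<phi>" using degree_simple_compact[of \<phi>] \<phi> by simp
  also have "\<dots> = coef N.\<Phi> \<phi> \<nu>'" using coef[OF \<phi>_R] by simp
  also have "\<dots> \<le> coef N.\<Phi> ?d \<nu>'" using hr \<phi>_R \<nu>'_simple by (simp add: highest_root_def)
  finally have "2 \<le> coef N.\<Phi> ?d \<nu>'" .
  moreover have "?d \<in> R" using hr by (simp add: highest_root_def)
  ultimately have 2: "coef N.\<Phi> ?d \<nu>' = 2" using coef[of ?d] degree_le[of ?d] by simp
  have "\<psi> \<in> C" if "\<psi> \<in> \<Phi>0 \<union> {eps}" for \<psi>
    using that compact_simple eps_root(3) by blast
  moreover have "\<nu>' \<notin> C" using even_degree[OF \<nu>'_root] degree_\<nu>' by simp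
  ultimately have "{\<psi> \<in> N.\<Phi>. \<psi> \<notin> C} = {\<nu>'}" unfolding simple_roots_new by blast
  then have "bds_roots R cr h C new_positive \<nu>' ?d" using hr 2 by unfold_locales
  then show ?thesis by blast
qed

end

end

section \<open>Complex Lie algebras with a compatible Hermitian form\<close>

definition poly_apply :: "(complex^'n \<Rightarrow> complex^'n) \<Rightarrow> complex poly \<Rightarrow> complex^'n \<Rightarrow> complex^'n" where
  "poly_apply f p v = (\<Sum>i\<le>Polynomial.degree p. poly.coeff p i *s (f ^^ i) v)"

lemma poly_apply_bound:
  "Polynomial.degree p \<le> N \<Longrightarrow> poly_apply f p v = (\<Sum>i\<le>N. poly.coeff p i *s (f ^^ i) v)"
  unfolding poly_apply_def
  by (rule sum.mono_neutral_left) (auto simp: coeff_eq_0)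

text \<open>Take p of least degree among the nonzero polynomials with p(f)v = 0 and a root z of p.
  With p = (X - z)q, the vector q(f)v is nonzero by minimality and is an eigenvector for z.\<close>

lemma eigenvector_exists:
  fixes f :: "complex^'n \<Rightarrow> complex^'n"
  assumes add: "\<And>x y. f (x + y) = f x + f y" and scale: "\<And>c x. f (c *s x) = c *s f x"
    and W: "vec.subspace W" "W \<noteq> {0}" and inv: "\<And>x. x \<in> W \<Longrightarrow> f x \<in> W"
  obtains v c where "v \<in> W" "v \<noteq> 0" "f v = c *s v"
proof -
  have f0: "f 0 = 0" using scale[of 0 0] by simp
  have f_sum: "f (sum g A) = (\<Sum>i\<in>A. f (g i))" for g :: "nat \<Rightarrow> complex^'n" and A
    by (induction A rule: infinite_finite_induct) (simp_all add: f0 add)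
  obtain v where v: "v \<in> W" "v \<noteq> 0" using W vec.subspace_0 by blast
  have pow_W: "(f ^^ i) v \<in> W" for i by (induction i) (use v inv in auto)
  have pa_W: "poly_apply f p v \<in> W" for p
    unfolding poly_apply_def by (intro vec.subspace_sum vec.subspace_scale W pow_W)
  have "\<exists>p. p \<noteq> 0 \<and> poly_apply f p v = 0"
  proof -
    let ?N = "CARD('n)" and ?g = "\<lambda>i. (f ^^ i) v"
    have "\<exists>c. (\<Sum>i\<le>?N. c i *s ?g i) = 0 \<and> (\<exists>i\<le>?N. c i \<noteq> 0)"
    proof (cases "inj_on ?g {..?N}")
      case True
      then have "card (?g ` {..?N}) = Suc ?N" by (simp add: card_image)
      moreover have "vec.dim (?g ` {..?N}) \<le> ?N" using vec.dim_subset_UNIV by (simp add: vec.dimension_def card_cart_basis)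
      ultimately have "vec.dependent (?g ` {..?N})"
        using vec.independent_bound_general[of "?g ` {..?N}"] by auto
      then obtain u where u: "(\<Sum>x\<in>?g ` {..?N}. u x *s x) = 0" "\<exists>x\<in>?g ` {..?N}. u x \<noteq> 0"
        using vec.dependent_finite[of "?g ` {..?N}"] by auto
      then show ?thesis
        using True by (intro exI[of _ "u \<circ> ?g"]) (auto simp: sum.reindex)
    next
      \<comment> \<open>Coinciding iterates would lower the number of elements of the image set, so
        the dimension bound does not apply; they give a relation with coefficients 1 and -1.\<close>
      case False
      then obtain i j where ij: "i \<le> ?N" "j \<le> ?N" "i \<noteq> j" "?g i = ?g j" by (auto simp: inj_on_def)
      have eq: "(if k = i then 1 else if k = j then -1 else (0::complex)) *s ?g k =
          (if k = i then ?g i else 0) + (if k = j then - ?g j else 0)" for k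
        using ij by auto
      show ?thesis
        by (rule exI[of _ "\<lambda>k. if k = i then 1 else if k = j then -1 else 0"])
           (use ij in \<open>auto simp: eq sum.distrib intro!: exI[of _ i]\<close>)
    qed
    then obtain c i where c: "(\<Sum>i\<le>?N. c i *s ?g i) = 0" "i \<le> ?N" "c i \<noteq> 0" by blast
    define p where "p = (\<Sum>i\<le>?N. monom (c i) i)"
    have coeff: "poly.coeff p j = (if j \<le> ?N then c j else 0)" for j
      unfolding p_def by (auto simp: coeff_sum if_distrib cong: if_cong)
    have "p \<noteq> 0" using coeff[of i] c by auto
    moreover have "Polynomial.degree p \<le> ?N" by (rule degree_le) (simp add: coeff)
    then have "poly_apply f p v = 0" using c(1) coeff by (simp add: poly_apply_bound[of p ?N])
    ultimately show ?thesis by blast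
  qed
  then obtain p where p: "p \<noteq> 0" "poly_apply f p v = 0"
    and min: "\<And>q. q \<noteq> 0 \<Longrightarrow> poly_apply f q v = 0 \<Longrightarrow> Polynomial.degree p \<le> Polynomial.degree q"
    using ex_has_least_nat[of "\<lambda>p. p \<noteq> 0 \<and> poly_apply f p v = 0" _ Polynomial.degree] by metis
  have "Polynomial.degree p \<noteq> 0"
  proof
    assume d: "Polynomial.degree p = 0"
    then have "poly.coeff p 0 *s v = 0" using p(2) by (simp add: poly_apply_def)
    then have "poly.coeff p 0 = 0" using v(2) by simp
    then show False using p(1) d leading_coeff_0_iff[of p] by simp
  qed
  then obtain z where z: "poly p z = 0"
    using fundamental_theorem_of_algebra[of p] by (auto simp: constant_degree)
  then have "[:- z, 1:] dvd p" by (simp add: poly_eq_0_iff_dvd)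
  then obtain q where q: "p = [:- z, 1:] * q" by (rule dvdE)
  have q0: "q \<noteq> 0" using q p(1) by auto
  then have deg: "Polynomial.degree p = Suc (Polynomial.degree q)"
    unfolding q by (subst degree_mult_eq) auto
  let ?w = "poly_apply f q v" and ?n = "Polynomial.degree q"
  have w0: "?w \<noteq> 0" using min[OF q0] deg by auto
  have pq: "p = pCons 0 q - smult z q" unfolding q by simp
  have "poly_apply f p v = (\<Sum>i\<le>Suc ?n. poly.coeff p i *s (f ^^ i) v)" by (simp add: poly_apply_def deg)
  also have "\<dots> = (\<Sum>i\<le>Suc ?n. poly.coeff (pCons 0 q) i *s (f ^^ i) v) - z *s (\<Sum>i\<le>Suc ?n. poly.coeff q i *s (f ^^ i) v)"
    unfolding pq by (simp add: vec.scale_left_diff_distrib sum_subtractf vec.scale_sum_right)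
  also have "(\<Sum>i\<le>Suc ?n. poly.coeff q i *s (f ^^ i) v) = ?w" by (rule poly_apply_bound[symmetric]) simp
  also have "(\<Sum>i\<le>Suc ?n. poly.coeff (pCons 0 q) i *s (f ^^ i) v) = (\<Sum>i\<le>?n. poly.coeff q i *s f ((f ^^ i) v))"
    by (subst sum.atMost_Suc_shift) simp
  also have "\<dots> = f ?w" by (simp add: poly_apply_def f_sum scale)
  finally have "f ?w = z *s ?w" using p(2) by simp
  then show thesis using that[of ?w z] pa_W w0 by blast
qed

text \<open>The form is linear in its first argument, and \<open>st\<close> is conjugate linear and
  reverses brackets. By \<open>ip_B\<close>, \<open>ad (st x)\<close> is the adjoint of
  \<open>ad x\<close>. The subspace h is abelian and is its own centraliser, so it is the weight
  space of weight 0.\<close>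

locale unitary_lie =
  fixes B :: "complex^'n::finite \<Rightarrow> complex^'n \<Rightarrow> complex^'n"
    and ip :: "complex^'n \<Rightarrow> complex^'n \<Rightarrow> complex"
    and st :: "complex^'n \<Rightarrow> complex^'n"
    and h :: "(complex^'n) set"
  assumes B_add: "B (x + y) z = B x z + B y z" and B_scale: "B (c *s x) z = c *s B x z"
    and B_add_right: "B x (y + z) = B x y + B x z" and B_scale_right: "B x (c *s z) = c *s B x z"
    and B_self: "B x x = 0"
    and jacobi: "B x (B y z) = B (B x y) z + B y (B x z)"
    and ip_add: "ip (x + y) z = ip x z + ip y z" and ip_scale: "ip (c *s x) z = c * ip x z"
    and ip_cnj: "cnj (ip x y) = ip y x"
    and ip_pos: "x \<noteq> 0 \<Longrightarrow> Re (ip x x) > 0"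
    and st_st: "st (st x) = x" and st_add: "st (x + y) = st x + st y" and st_scale: "st (c *s x) = cnj c *s st x"
    and st_B: "st (B x y) = B (st y) (st x)"
    and ip_B: "ip (B x y) z = ip y (B (st x) z)"
    and h_subspace: "vec.subspace h"
    and h_st: "H \<in> h \<Longrightarrow> st H \<in> h"
    and h_abelian: "H \<in> h \<Longrightarrow> K \<in> h \<Longrightarrow> B H K = 0"
    and h_centralizer: "(\<And>H. H \<in> h \<Longrightarrow> B H x = 0) \<Longrightarrow> x \<in> h"
begin

lemma B_zero [simp]: "B 0 x = 0" "B x 0 = 0"
  using B_scale[of 0 0 x] B_scale_right[of x 0 0] by simp_all

lemma B_skew: "B x y = - B y x"
proof -
  have "B x y + B y x = B (x + y) (x + y)"
    unfolding B_add B_add_right by (simp add: B_self add.commute)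
  then show ?thesis by (simp add: B_self eq_neg_iff_add_eq_0)
qed

lemma B_minus: "B (- x) y = - B x y" "B x (- y) = - B x y"
  using B_scale[of "-1" x y] B_scale_right[of x "-1" y] by simp_all

lemma ip_zero [simp]: "ip 0 x = 0" "ip x 0 = 0"
proof -
  show 1: "ip 0 x = 0" for x using ip_scale[of 0 0 x] by simp
  show "ip x 0 = 0" using ip_cnj[of 0 x] 1[of x] by simp
qed

lemma ip_add_right: "ip x (y + z) = ip x y + ip x z"
  using ip_cnj[of "y + z" x] ip_cnj[of y x] ip_cnj[of z x] ip_add[of y z x] by simp

lemma ip_scale_right: "ip x (c *s y) = cnj c * ip x y"
  using ip_cnj[of "c *s y" x] ip_cnj[of y x] ip_scale[of c y x] by simp

lemma ip_minus: "ip (- x) y = - ip x y" "ip x (- y) = - ip x y"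
  using ip_scale[of "-1" x y] ip_scale_right[of x "-1" y] by simp_all

lemma ip_diff: "ip (x - y) z = ip x z - ip y z" "ip x (y - z) = ip x y - ip x z"
  using ip_add[of x "- y" z] ip_add_right[of x y "- z"] ip_minus by simp_all

lemma ip_sum: "ip (sum f A) x = (\<Sum>i\<in>A. ip (f i) x)"
  by (induction A rule: infinite_finite_induct) (simp_all add: ip_add)

lemma ip_sum_right: "ip x (sum f A) = (\<Sum>i\<in>A. ip x (f i))"
  by (induction A rule: infinite_finite_induct) (simp_all add: ip_add_right)

section \<open>The squared norm and orthogonal projections\<close>

definition nrm :: "complex^'n \<Rightarrow> real" where
  "nrm x = Re (ip x x)"

lemma ip_self: "ip x x = of_real (nrm x)"
  using ip_cnj[of x x] by (simp add: nrm_def complex_eq_iff)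

lemma nrm_pos: "x \<noteq> 0 \<Longrightarrow> nrm x > 0"
  using ip_pos by (simp add: nrm_def)

lemma nrm_zero [simp]: "nrm 0 = 0"
  by (simp add: nrm_def)

lemma nrm_nonneg: "nrm x \<ge> 0"
  using nrm_pos[of x] by (cases "x = 0") auto

lemma nrm_eq_0: "nrm x = 0 \<longleftrightarrow> x = 0"
  using nrm_pos[of x] by (cases "x = 0") auto

lemma ip_self_eq_0: "ip x x = 0 \<longleftrightarrow> x = 0"
  by (simp add: ip_self nrm_eq_0)

lemma ip_B_right: "ip x (B y z) = ip (B (st y) x) z"
  using ip_B[of "st y" x z] by (simp add: st_st)

lemma st_zero [simp]: "st 0 = 0"
  using st_scale[of 0 0] by simp

lemma st_eq_0: "st x = 0 \<longleftrightarrow> x = 0"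
  using st_st[of x] by auto

lemma projection_span:
  "finite S \<Longrightarrow> \<exists>s\<in>vec.span S. \<forall>y\<in>vec.span S. ip (x - s) y = 0"
proof (induction S arbitrary: x rule: finite_induct)
  case empty
  then show ?case by simp
next
  case (insert a S)
  obtain s where s: "s \<in> vec.span S" "\<And>y. y \<in> vec.span S \<Longrightarrow> ip (x - s) y = 0"
    using insert.IH by blast
  obtain t where t: "t \<in> vec.span S" "\<And>y. y \<in> vec.span S \<Longrightarrow> ip (a - t) y = 0"
    using insert.IH by blast
  let ?a = "a - t"
  \<comment> \<open>The Gram-Schmidt coefficient; if a already lies in the span of S, then a - t = 0
    and the coefficient is set to 0.\<close>
  define k where "k = (if ?a = 0 then 0 else ip (x - s) ?a / ip ?a ?a)"
  have sub: "vec.span S \<subseteq> vec.span (insert a S)" by (rule vec.span_mono) blast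
  have "s \<in> vec.span (insert a S)" "t \<in> vec.span (insert a S)" "a \<in> vec.span (insert a S)"
    using s(1) t(1) sub by (auto intro: vec.span_base)
  then have in_span: "s + k *s ?a \<in> vec.span (insert a S)"
    by (simp add: vec.span_add vec.span_scale vec.span_diff)
  have ort: "ip (x - (s + k *s ?a)) ?a = 0"
  proof (cases "?a = 0")
    case False
    have "ip (x - (s + k *s ?a)) ?a = ip (x - s) ?a - k * ip ?a ?a"
      by (simp only: diff_diff_eq[symmetric] ip_diff(1)[of "x - s"] ip_scale)
    then show ?thesis using False ip_self_eq_0[of ?a] by (simp add: k_def)
  qed simp
  have "ip (x - (s + k *s ?a)) y = 0" if y_span: "y \<in> vec.span (insert a S)" for y
  proof -
    obtain c where c: "y - c *s a \<in> vec.span S" using y_span unfolding vec.span_breakdown_eq by blast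
    have "c *s t \<in> vec.span S" using t(1) by (rule vec.span_scale)
    then have z: "y - c *s a + c *s t \<in> vec.span S" using c vec.span_add by blast
    have y: "y = (y - c *s a + c *s t) + c *s ?a" by (simp add: vec.scale_right_diff_distrib)
    have "ip (x - s) (y - c *s a + c *s t) = 0" "ip ?a (y - c *s a + c *s t) = 0" using s t z by blast+
    then have "ip (x - (s + k *s ?a)) (y - c *s a + c *s t) = 0 - k * 0"
      by (simp only: diff_diff_eq[symmetric] ip_diff(1)[of "x - s"] ip_scale)
    then have "ip (x - (s + k *s ?a)) (y - c *s a + c *s t) = 0" by simp
    moreover have "ip (x - (s + k *s ?a)) ((y - c *s a + c *s t) + c *s ?a) =
        ip (x - (s + k *s ?a)) (y - c *s a + c *s t) + cnj c * ip (x - (s + k *s ?a)) ?a"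
      by (simp only: ip_add_right ip_scale_right)
    ultimately show ?thesis unfolding y[symmetric] using ort by simp
  qed
  then show ?case using in_span by blast
qed

lemma projection:
  assumes "vec.subspace S"
  obtains s where "s \<in> S" "\<And>y. y \<in> S \<Longrightarrow> ip (x - s) y = 0"
proof -
  obtain b where "b \<subseteq> S" "vec.independent b" "S \<subseteq> vec.span b" using vec.basis_exists by metis
  then have "finite b" "vec.span b = S"
    using vec.finiteI_independent assms vec.span_minimal by blast+
  then show thesis using projection_span[of b x] that by blast
qed

subsection \<open>Weight spaces\<close>

abbreviation wsp :: "'n functional \<Rightarrow> (complex^'n) set" where
  "wsp \<mu> \<equiv> weight_space B h UNIV \<mu>"

lemma weight_space_iff: "x \<in> weight_space B h M \<mu> \<longleftrightarrow> x \<in> M \<and> (\<forall>H\<in>h. B H x = \<mu> H *s x)"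
  by (simp add: weight_space_def)

lemma wsp_iff: "x \<in> wsp \<mu> \<longleftrightarrow> (\<forall>H\<in>h. B H x = \<mu> H *s x)"
  by (simp add: weight_space_def)

lemma weight_spaceI: "x \<in> M \<Longrightarrow> x \<in> wsp \<mu> \<Longrightarrow> x \<in> weight_space B h M \<mu>"
  and weight_spaceD: "x \<in> weight_space B h M \<mu> \<Longrightarrow> x \<in> M \<and> x \<in> wsp \<mu>"
  by (simp_all add: weight_space_def)

lemma weight_space_wsp: "wsp \<mu> \<subseteq> M \<Longrightarrow> weight_space B h M \<mu> = wsp \<mu>"
  by (auto simp: weight_space_def)

lemma subspace_wsp: "vec.subspace (wsp \<mu>)"
  by (rule vec.subspaceI) (simp_all add: wsp_iff B_add_right B_scale_right vec.scale_right_distrib vec.scale_left_commute)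

lemma wsp_zero: "x \<in> wsp 0 \<longleftrightarrow> x \<in> h"
  using h_centralizer[of x] h_abelian by (auto simp: wsp_iff zero_fun_apply)

lemma wsp_B: "x \<in> wsp \<mu> \<Longrightarrow> y \<in> wsp \<nu> \<Longrightarrow> B x y \<in> wsp (\<mu> + \<nu>)"
  by (simp add: wsp_iff jacobi[of _ x y] B_scale B_scale_right plus_fun_apply vec.scale_left_distrib)

lemma dual_add: "\<mu> \<in> dual_space h \<Longrightarrow> \<nu> \<in> dual_space h \<Longrightarrow> \<mu> + \<nu> \<in> dual_space h"
  by (simp add: dual_space_def fun_apply algebra_simps)

lemma dual_scale: "\<mu> \<in> dual_space h \<Longrightarrow> of_int c * \<mu> \<in> dual_space h"
  by (simp add: dual_space_def fun_apply algebra_simps)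

lemma dual_minus: "\<mu> \<in> dual_space h \<Longrightarrow> - \<mu> \<in> dual_space h"
  by (simp add: dual_space_def fun_apply algebra_simps)

lemma dual_zero: "0 \<in> dual_space h"
  by (simp add: dual_space_def fun_apply)

lemma dual_ext: "\<mu> \<in> dual_space h \<Longrightarrow> \<nu> \<in> dual_space h \<Longrightarrow> (\<And>H. H \<in> h \<Longrightarrow> \<mu> H = \<nu> H) \<Longrightarrow> \<mu> = \<nu>"
  unfolding dual_space_def by (rule ext) (metis (mono_tags, lifting) mem_Collect_eq)

lemma dual_apply_add: "\<mu> \<in> dual_space h \<Longrightarrow> x \<in> h \<Longrightarrow> y \<in> h \<Longrightarrow> \<mu> (x + y) = \<mu> x + \<mu> y"
  and dual_apply_scale: "\<mu> \<in> dual_space h \<Longrightarrow> x \<in> h \<Longrightarrow> \<mu> (c *s x) = c * \<mu> x"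
  by (simp_all add: dual_space_def)

text \<open>On a weight vector, the adjoint operators \<open>ad H\<close> and
  \<open>ad (st H)\<close> act by scalars, which must be conjugate.\<close>

lemma weight_st: 
  assumes "x \<in> wsp \<mu>" "x \<noteq> 0" "H \<in> h"
  shows "\<mu> (st H) = cnj (\<mu> H)"
proof -
  have "\<mu> H * ip x x = ip (B H x) x" using assms by (simp add: wsp_iff ip_scale)
  also have "\<dots> = ip x (B (st H) x)" by (rule ip_B)
  also have "\<dots> = cnj (\<mu> (st H)) * ip x x" using assms h_st[of H] by (simp add: wsp_iff ip_scale_right)
  finally have "\<mu> H = cnj (\<mu> (st H))" using ip_self_eq_0[of x] assms(2) by simp
  then show ?thesis by simp
qed

lemma wsp_st:
  assumes "x \<in> wsp \<mu>"
  shows "st x \<in> wsp (- \<mu>)"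
proof (cases "x = 0")
  case True
  then show ?thesis using vec.subspace_0[OF subspace_wsp] by simp
next
  case False
  show ?thesis
    unfolding wsp_iff
  proof
    fix H assume H: "H \<in> h"
    have "B H (st x) = st (B x (st H))" by (simp add: st_B st_st)
    also have "\<dots> = st ((-1) *s B (st H) x)" using B_skew[of x "st H"] by simp
    also have "\<dots> = - st (B (st H) x)" by (simp only: st_scale) simp
    also have "\<dots> = - st (\<mu> (st H) *s x)" using assms h_st[OF H] unfolding wsp_iff by simp
    also have "\<dots> = - (\<mu> H *s st x)" by (simp add: st_scale weight_st[OF assms False H])
    finally show "B H (st x) = (- \<mu>) H *s st x" by (simp add: uminus_apply)
  qed
qed

lemma wsp_orthogonal:
  assumes "x \<in> wsp \<mu>" "y \<in> wsp \<nu>" "\<mu> \<in> dual_space h" "\<nu> \<in> dual_space h" "\<mu> \<noteq> \<nu>"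
  shows "ip x y = 0"
proof (cases "y = 0")
  case False
  obtain H where H: "H \<in> h" "\<mu> H \<noteq> \<nu> H" using dual_ext[OF assms(3,4)] assms(5) by blast
  have "\<mu> H * ip x y = ip (B H x) y" using assms(1) H(1) by (simp add: wsp_iff ip_scale)
  also have "\<dots> = ip x (B (st H) y)" by (rule ip_B)
  also have "\<dots> = \<nu> H * ip x y"
    using assms(2) h_st[OF H(1)] weight_st[OF assms(2) False H(1)] by (simp add: wsp_iff ip_scale_right)
  finally show ?thesis using H(2) by simp
qed simp

text \<open>Nonzero vectors of distinct weights are orthogonal, hence linearly independent.\<close>

lemma finite_weights: "finite {\<mu> \<in> dual_space h. wsp \<mu> \<noteq> {0}}" (is "finite ?W")
proof -
  have "\<exists>x. x \<in> wsp \<mu> \<and> x \<noteq> 0" if "\<mu> \<in> ?W" for \<mu>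
    using that vec.subspace_0[OF subspace_wsp[of \<mu>]] by blast
  then have "\<exists>v. \<forall>\<mu>\<in>?W. v \<mu> \<in> wsp \<mu> \<and> v \<mu> \<noteq> 0" by (intro bchoice ballI)
  then obtain v where v: "\<And>\<mu>. \<mu> \<in> ?W \<Longrightarrow> v \<mu> \<in> wsp \<mu> \<and> v \<mu> \<noteq> 0" by (elim exE) blast
  have ort: "ip (v \<mu>) (v \<nu>) = 0" if "\<mu> \<in> ?W" "\<nu> \<in> ?W" "\<mu> \<noteq> \<nu>" for \<mu> \<nu>
  proof (rule wsp_orthogonal)
    show "v \<mu> \<in> wsp \<mu>" "v \<nu> \<in> wsp \<nu>" using v that(1,2) by blast+
    show "\<mu> \<in> dual_space h" "\<nu> \<in> dual_space h" "\<mu> \<noteq> \<nu>" using that by blast+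
  qed
  have inj: "inj_on v ?W"
  proof (rule inj_onI, rule ccontr)
    fix \<mu> \<nu> assume a: "\<mu> \<in> ?W" "\<nu> \<in> ?W" "v \<mu> = v \<nu>" "\<mu> \<noteq> \<nu>"
    then have "ip (v \<mu>) (v \<mu>) = 0" using ort[OF a(1,2,4)] by simp
    then show False using v[OF a(1)] ip_self_eq_0 by simp
  qed
  have "vec.independent (v ` ?W)"
    unfolding vec.independent_explicit_finite_subsets
  proof (intro allI impI ballI)
    fix S u w assume S: "S \<subseteq> v ` ?W" "finite S" "(\<Sum>x\<in>S. u x *s x) = 0" "w \<in> S"
    have "ip (\<Sum>x\<in>S. u x *s x) w = (\<Sum>x\<in>S. if x = w then u w * ip w w else 0)"
      unfolding ip_sum
    proof (rule sum.cong[OF HOL.refl])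
      fix x assume "x \<in> S"
      then obtain \<mu> \<nu> where mn: "\<mu> \<in> ?W" "x = v \<mu>" "\<nu> \<in> ?W" "w = v \<nu>" using S by blast
      show "ip (u x *s x) w = (if x = w then u w * ip w w else 0)"
      proof (cases "x = w")
        case False
        then have "\<mu> \<noteq> \<nu>" using mn by blast
        then have "ip x w = 0" unfolding mn(2,4) by (rule ort[OF mn(1,3)])
        then show ?thesis using False by (simp add: ip_scale)
      qed (simp add: ip_scale)
    qed
    then have "u w * ip w w = 0" using S by simp
    moreover obtain \<mu> where \<mu>: "\<mu> \<in> ?W" "w = v \<mu>" using S by blast
    have "w \<noteq> 0" using v[OF \<mu>(1)] \<mu>(2) by simp
    ultimately show "u w = 0" using ip_self_eq_0[of w] by simp
  qed
  then have "finite (v ` ?W)" by (rule vec.finiteI_independent)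
  then show ?thesis using inj by (rule finite_imageD)
qed

definition h_stable :: "(complex^'n) set \<Rightarrow> bool" where
  "h_stable M \<longleftrightarrow> vec.subspace M \<and> (\<forall>H\<in>h. \<forall>x\<in>M. B H x \<in> M)"

lemma B_commute_h: "H \<in> h \<Longrightarrow> K \<in> h \<Longrightarrow> B H (B K x) = B K (B H x)"
  using jacobi[of H K x] h_abelian[of H K] by simp

text \<open>In a nonzero \<open>h\<close>-stable subspace of minimal dimension all elements of \<open>h\<close> act as scalars.\<close>

lemma weight_vector_exists:
  assumes "h_stable M" "M \<noteq> {0}"
  shows "\<exists>\<mu> v. \<mu> \<in> dual_space h \<and> v \<in> weight_space B h M \<mu> \<and> v \<noteq> 0"
  using assms
proof (induction "vec.dim M" arbitrary: M rule: less_induct)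
  case less
  have M: "vec.subspace M" "\<And>H x. H \<in> h \<Longrightarrow> x \<in> M \<Longrightarrow> B H x \<in> M" using less.prems by (auto simp: h_stable_def)
  show ?case
  proof (cases "\<forall>H\<in>h. \<exists>c. \<forall>x\<in>M. B H x = c *s x")
    case True
    then obtain c where c: "\<And>H x. H \<in> h \<Longrightarrow> x \<in> M \<Longrightarrow> B H x = c H *s x" by metis
    obtain v where v: "v \<in> M" "v \<noteq> 0" using less.prems M(1) vec.subspace_0 by blast
    define \<mu> where "\<mu> = (\<lambda>H. if H \<in> h then c H else 0)"
    have "c (H + K) = c H + c K" if "H \<in> h" "K \<in> h" for H K
    proof -
      have "c (H + K) *s v = (c H + c K) *s v"
        using c[OF vec.subspace_add[OF h_subspace that] v(1)] c[OF that(1) v(1)] c[OF that(2) v(1)]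
        by (simp add: B_add vec.scale_left_distrib)
      then show ?thesis using v(2) vec.scale_cancel_right by blast
    qed
    moreover have "c (k *s H) = k * c H" if "H \<in> h" for H k
    proof -
      have "c (k *s H) *s v = (k * c H) *s v"
        using c[OF vec.subspace_scale[OF h_subspace that, of k] v(1)] c[OF that v(1)] v(2) by (simp add: B_scale)
      then show ?thesis using v(2) vec.scale_cancel_right by blast
    qed
    ultimately have "\<mu> \<in> dual_space h"
      using vec.subspace_add[OF h_subspace] vec.subspace_scale[OF h_subspace]
      by (simp add: dual_space_def \<mu>_def)
    moreover have "v \<in> weight_space B h M \<mu>" using v c by (simp add: weight_space_iff \<mu>_def)
    ultimately show ?thesis using v by blast
  next
    case False
    then obtain H where H: "H \<in> h" "\<And>c. \<exists>x\<in>M. B H x \<noteq> c *s x" by blast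
    obtain v c where v: "v \<in> M" "v \<noteq> 0" "B H v = c *s v"
      using eigenvector_exists[of "B H" M] M H(1) less.prems(2) B_add_right B_scale_right by metis
    define E where "E = {x \<in> M. B H x = c *s x}"
    have sub: "vec.subspace E"
      unfolding E_def
      by (rule vec.subspaceI)
         (simp_all add: B_add_right B_scale_right vec.scale_right_distrib vec.scale_left_commute
           vec.subspace_0[OF M(1)] vec.subspace_add[OF M(1)] vec.subspace_scale[OF M(1)])
    have "B K x \<in> E" if "K \<in> h" "x \<in> E" for K x
      using that M(2) B_commute_h[OF H(1) that(1), of x] by (simp add: E_def B_scale_right)
    then have "h_stable E" using sub by (simp add: h_stable_def)
    moreover have "E \<noteq> {0}" using v by (auto simp: E_def)
    moreover have "vec.dim E < vec.dim M"
    proof -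
      have "vec.span E \<subset> vec.span M" unfolding vec.span_eq_iff[THEN iffD2, OF sub] vec.span_eq_iff[THEN iffD2, OF M(1)]
        using H(2)[of c] by (auto simp: E_def)
      then show ?thesis by (rule vec.dim_psubset)
    qed
    ultimately obtain \<mu> w where "\<mu> \<in> dual_space h" "w \<in> weight_space B h E \<mu>" "w \<noteq> 0"
      using less.hyps by blast
    then show ?thesis by (auto simp: weight_space_iff E_def)
  qed
qed

text \<open>The orthogonal complement of the weight vectors in M is again stable, because h is
  closed under \<open>st\<close>. If it were nonzero, it would contain a weight vector, which would
  be orthogonal to itself.\<close>

lemma weight_decomposition:
  assumes "h_stable M"
  shows "M \<subseteq> vec.span (\<Union>\<mu>\<in>dual_space h. weight_space B h M \<mu>)" (is "_ \<subseteq> ?S")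
proof -
  have M: "vec.subspace M" "\<And>H x. H \<in> h \<Longrightarrow> x \<in> M \<Longrightarrow> B H x \<in> M" using assms by (auto simp: h_stable_def)
  have S_M: "?S \<subseteq> M" by (rule vec.span_minimal[OF _ M(1)]) (auto simp: weight_space_iff)
  have S_stable: "B H y \<in> ?S" if H: "H \<in> h" and y: "y \<in> ?S" for H y
    using y
  proof (induction rule: vec.span_induct_alt)
    case base
    show ?case by (simp add: vec.span_zero)
  next
    case (step c x y)
    then obtain \<mu> where "\<mu> \<in> dual_space h" "x \<in> weight_space B h M \<mu>" by blast
    then have "B H x = \<mu> H *s x" "x \<in> ?S" using H by (auto simp: weight_space_iff intro!: vec.span_base)
    then show ?case
      using step.IH by (simp add: B_add_right B_scale_right vec.span_add vec.span_scale)
  qed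
  define N where "N = {x \<in> M. \<forall>y\<in>?S. ip x y = 0}"
  have "h_stable N"
    unfolding h_stable_def
  proof (intro conjI ballI)
    show "vec.subspace N"
      unfolding N_def
      by (rule vec.subspaceI)
         (simp_all add: ip_add ip_scale vec.subspace_0[OF M(1)] vec.subspace_add[OF M(1)] vec.subspace_scale[OF M(1)])
    fix H x assume H: "H \<in> h" "x \<in> N"
    then have "ip (B H x) y = 0" if "y \<in> ?S" for y
      using S_stable[OF h_st[OF H(1)] that] by (simp add: ip_B N_def)
    then show "B H x \<in> N" using M(2) H by (simp add: N_def)
  qed
  have "N = {0}"
  proof (rule ccontr)
    assume "N \<noteq> {0}"
    then obtain \<mu> v where v: "\<mu> \<in> dual_space h" "v \<in> weight_space B h N \<mu>" "v \<noteq> 0"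
      using weight_vector_exists \<open>h_stable N\<close> by blast
    then have "v \<in> N" "v \<in> weight_space B h M \<mu>" by (auto simp: weight_space_iff N_def)
    then have "v \<in> ?S" using v(1) by (intro vec.span_base) blast
    then have "ip v v = 0" using \<open>v \<in> N\<close> by (simp add: N_def)
    then show False using v(3) ip_self_eq_0 by simp
  qed
  show ?thesis
  proof
    fix x assume x: "x \<in> M"
    obtain s where s: "s \<in> ?S" "\<And>y. y \<in> ?S \<Longrightarrow> ip (x - s) y = 0"
      using projection[OF vec.subspace_span] by metis
    then have "x - s \<in> N" using x S_M vec.subspace_diff[OF M(1)] by (auto simp: N_def)
    then show "x \<in> ?S" using s(1) \<open>N = {0}\<close> by simp
  qed
qed

text \<open>A vector of another weight would be orthogonal to the whole span, hence to
  itself.\<close>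

lemma wsp_in_span:
  assumes "x \<in> wsp \<mu>" "x \<noteq> 0" "\<mu> \<in> dual_space h" "x \<in> vec.span (\<Union>\<nu>\<in>W. wsp \<nu>)" "W \<subseteq> dual_space h"
  shows "\<mu> \<in> W"
proof (rule ccontr)
  assume \<mu>: "\<mu> \<notin> W"
  have "ip x y = 0" if "y \<in> vec.span (\<Union>\<nu>\<in>W. wsp \<nu>)" for y
    using that
  proof (induction rule: vec.span_induct_alt)
    case (step c z y)
    then obtain \<nu> where "\<nu> \<in> W" "z \<in> wsp \<nu>" by blast
    then have "ip x z = 0" using wsp_orthogonal[OF assms(1) _ assms(3)] assms(5) \<mu> by blast
    then show ?case using step.IH by (simp add: ip_add_right ip_scale_right)
  qed simp
  then show False using assms(2,4) ip_self_eq_0 by blast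
qed

end

context unitary_lie
begin

subsection \<open>Roots\<close>

abbreviation \<Delta> where "\<Delta> \<equiv> roots B h UNIV"

lemma roots_iff: "\<alpha> \<in> roots B h M \<longleftrightarrow> \<alpha> \<in> dual_space h \<and> \<alpha> \<noteq> 0 \<and> weight_space B h M \<alpha> \<noteq> {0}"
  by (simp add: roots_def zero_fun_def)

lemma root_dual: "\<alpha> \<in> \<Delta> \<Longrightarrow> \<alpha> \<in> dual_space h"
  by (simp add: roots_iff)

lemma root_vector: "\<alpha> \<in> \<Delta> \<Longrightarrow> \<exists>e. e \<in> wsp \<alpha> \<and> e \<noteq> 0"
  unfolding roots_iff using vec.subspace_0[OF subspace_wsp[of \<alpha>]] by blast

lemma rootI: "\<alpha> \<in> dual_space h \<Longrightarrow> \<alpha> \<noteq> 0 \<Longrightarrow> x \<in> wsp \<alpha> \<Longrightarrow> x \<noteq> 0 \<Longrightarrow> \<alpha> \<in> \<Delta>"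
  unfolding roots_iff by blast

lemma finite_\<Delta>: "finite \<Delta>"
  by (rule finite_subset[OF _ finite_weights]) (rule subsetI, simp add: roots_iff)

lemma minus_in_\<Delta>: "\<alpha> \<in> \<Delta> \<Longrightarrow> - \<alpha> \<in> \<Delta>"
proof -
  assume \<alpha>: "\<alpha> \<in> \<Delta>"
  obtain e where e: "e \<in> wsp \<alpha>" "e \<noteq> 0" using root_vector \<alpha> by blast
  have "- \<alpha> \<noteq> 0" using \<alpha> by (simp add: roots_iff)
  then show ?thesis
    using rootI[OF dual_minus[OF root_dual[OF \<alpha>]] _ wsp_st[OF e(1)]] e(2) by (simp add: st_eq_0)
qed

section \<open>Vectors representing roots, and the pairing of roots\<close>

definition tvec :: "'n functional \<Rightarrow> complex^'n" where
  "tvec \<alpha> = (THE t. t \<in> h \<and> (\<forall>H\<in>h. ip H t = \<alpha> H))"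

lemma riesz_unique:
  assumes "t \<in> h" "s \<in> h" "\<And>H. H \<in> h \<Longrightarrow> ip H t = ip H s"
  shows "t = s"
proof -
  have d: "t - s \<in> h" using vec.subspace_diff[OF h_subspace] assms by blast
  have "ip (t - s) (t - s) = 0" using assms(3)[OF d] by (simp add: ip_diff(2))
  then show ?thesis using ip_self_eq_0[of "t - s"] by simp
qed

lemma tvec_eqI: "t \<in> h \<Longrightarrow> (\<And>H. H \<in> h \<Longrightarrow> ip H t = \<alpha> H) \<Longrightarrow> tvec \<alpha> = t"
  unfolding tvec_def by (rule the_equality) (auto intro: riesz_unique)

text \<open>The bracket of e with \<open>st e\<close> is, up to the squared norm of e, the vector of
  h that represents \<alpha>. Thus the description in \<open>tvec\<close> is met for every root
  without a general representation theorem.\<close>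

lemma B_e_st_e:
  assumes "e \<in> wsp \<alpha>"
  shows "B e (st e) \<in> h" and "H \<in> h \<Longrightarrow> ip H (B e (st e)) = \<alpha> H * ip e e"
proof -
  show "B e (st e) \<in> h" using wsp_B[OF assms wsp_st[OF assms]] wsp_zero by simp
  assume H: "H \<in> h"
  have "ip H (B (st e) e) = ip (B e H) e" by (simp add: ip_B_right st_st)
  also have "\<dots> = - (\<alpha> H * ip e e)"
    using assms H B_skew[of e H] by (simp add: wsp_iff ip_minus ip_scale)
  finally show "ip H (B e (st e)) = \<alpha> H * ip e e" using B_skew[of e "st e"] by (simp add: ip_minus)
qed

lemma B_e_st_e_eq:
  assumes "\<alpha> \<in> \<Delta>" "e \<in> wsp \<alpha>" "e \<noteq> 0"
  shows "B e (st e) = of_real (nrm e) *s tvec \<alpha>"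
proof -
  have n: "nrm e \<noteq> 0" using assms by (simp add: nrm_eq_0)
  have "tvec \<alpha> = of_real (1 / nrm e) *s B e (st e)"
  proof (rule tvec_eqI)
    show "of_real (1 / nrm e) *s B e (st e) \<in> h"
      using B_e_st_e(1)[OF assms(2)] vec.subspace_scale[OF h_subspace] by blast
    show "ip H (of_real (1 / nrm e) *s B e (st e)) = \<alpha> H" if "H \<in> h" for H
      using n B_e_st_e(2)[OF assms(2) that] by (simp add: ip_scale_right ip_self)
  qed
  then show ?thesis using n by simp
qed

lemma tvec:
  assumes "\<alpha> \<in> \<Delta>"
  shows tvec_h: "tvec \<alpha> \<in> h" and ip_tvec: "H \<in> h \<Longrightarrow> ip H (tvec \<alpha>) = \<alpha> H" and st_tvec: "st (tvec \<alpha>) = tvec \<alpha>"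
proof -
  obtain e where e: "e \<in> wsp \<alpha>" "e \<noteq> 0" using root_vector assms by blast
  let ?t = "of_real (1 / nrm e) *s B e (st e)"
  have n: "nrm e \<noteq> 0" using e by (simp add: nrm_eq_0)
  have t: "tvec \<alpha> = ?t" using n B_e_st_e_eq[OF assms e] by simp
  show "tvec \<alpha> \<in> h" unfolding t
    using B_e_st_e(1)[OF e(1)] vec.subspace_scale[OF h_subspace] by blast
  show "ip H (tvec \<alpha>) = \<alpha> H" if "H \<in> h"
    unfolding t using n B_e_st_e(2)[OF e(1) that] by (simp add: ip_scale_right ip_self)
  show "st (tvec \<alpha>) = tvec \<alpha>" unfolding t st_scale st_B st_st by simp
qed

definition pairing :: "'n functional \<Rightarrow> 'n functional \<Rightarrow> real" where
  "pairing \<mu> \<alpha> = Re (\<mu> (tvec \<alpha>))"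

text \<open>The value is real because \<open>tvec \<alpha>\<close> is fixed by
  \<open>st\<close>.\<close>

lemma weight_tvec:
  assumes "\<alpha> \<in> \<Delta>" "x \<in> wsp \<mu>" "x \<noteq> 0"
  shows "\<mu> (tvec \<alpha>) = of_real (pairing \<mu> \<alpha>)"
  using weight_st[OF assms(2,3) tvec_h[OF assms(1)]] st_tvec[OF assms(1)]
  by (simp add: pairing_def complex_eq_iff)

lemma root_tvec: "\<alpha> \<in> \<Delta> \<Longrightarrow> \<beta> \<in> \<Delta> \<Longrightarrow> \<beta> (tvec \<alpha>) = of_real (pairing \<beta> \<alpha>)"
  using root_vector[of \<beta>] weight_tvec by blast

lemma pairing_commute:
  assumes "\<alpha> \<in> \<Delta>" "\<beta> \<in> \<Delta>"
  shows "pairing \<beta> \<alpha> = pairing \<alpha> \<beta>"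
proof -
  have "\<beta> (tvec \<alpha>) = cnj (\<alpha> (tvec \<beta>))"
    using ip_tvec[OF assms(1) tvec_h[OF assms(2)]] ip_tvec[OF assms(2) tvec_h[OF assms(1)]]
      ip_cnj[of "tvec \<beta>" "tvec \<alpha>"] by simp
  then show ?thesis by (simp add: pairing_def)
qed

lemma pairing_add: "pairing (\<mu> + \<nu>) \<alpha> = pairing \<mu> \<alpha> + pairing \<nu> \<alpha>"
  and pairing_minus: "pairing (- \<mu>) \<alpha> = - pairing \<mu> \<alpha>"
  and pairing_scale: "pairing (of_int c * \<mu>) \<alpha> = of_int c * pairing \<mu> \<alpha>"
  by (simp_all add: pairing_def fun_apply)

lemma pairing_self_pos: "\<alpha> \<in> \<Delta> \<Longrightarrow> pairing \<alpha> \<alpha> > 0"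
proof -
  assume \<alpha>: "\<alpha> \<in> \<Delta>"
  have "tvec \<alpha> \<noteq> 0"
  proof
    assume "tvec \<alpha> = 0"
    then have "\<alpha> H = 0" if "H \<in> h" for H using ip_tvec[OF \<alpha> that] by simp
    then have "\<alpha> = 0" using dual_ext[OF root_dual[OF \<alpha>] dual_zero] by (simp add: zero_fun_apply)
    then show False using \<alpha> by (simp add: roots_iff)
  qed
  then have "nrm (tvec \<alpha>) > 0" by (rule nrm_pos)
  then show ?thesis using ip_tvec[OF \<alpha> tvec_h[OF \<alpha>]] by (simp add: pairing_def nrm_def)
qed

text \<open>\<open>ad e\<close> and \<open>ad (st e)\<close> are adjoint and their commutator acts as a real scalar
  on each weight space.\<close>

lemma nrm_B:
  assumes \<alpha>: "\<alpha> \<in> \<Delta>" "e \<in> wsp \<alpha>" "e \<noteq> 0" and x: "x \<in> wsp \<mu>"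
  shows "nrm (B e x) = nrm (B (st e) x) - nrm e * pairing \<mu> \<alpha> * nrm x"
proof (cases "x = 0")
  case False
  have "B (st e) e = - (of_real (nrm e) *s tvec \<alpha>)"
    using B_skew[of "st e" e] B_e_st_e_eq[OF \<alpha>] by simp
  then have "B (B (st e) e) x = - (of_real (nrm e * pairing \<mu> \<alpha>) *s x)"
    using x tvec_h[OF \<alpha>(1)] weight_tvec[OF \<alpha>(1) x False] by (simp add: B_minus B_scale wsp_iff)
  then have "B (st e) (B e x) = B e (B (st e) x) - of_real (nrm e * pairing \<mu> \<alpha>) *s x"
    using jacobi[of "st e" e x] by simp
  moreover have "ip (B e x) (B e x) = ip x (B (st e) (B e x))" by (rule ip_B)
  moreover have "ip x (B e (B (st e) x)) = ip (B (st e) x) (B (st e) x)" by (rule ip_B_right)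
  ultimately have "ip (B e x) (B e x) =
      ip (B (st e) x) (B (st e) x) - of_real (nrm e * pairing \<mu> \<alpha>) * ip x x"
    by (simp add: ip_diff ip_scale_right)
  then show ?thesis by (simp add: nrm_def)
qed simp

text \<open>Otherwise \<open>nrm_B\<close> would give \<open>B (st e) x\<close> a negative squared
  norm.\<close>

lemma B_nonzero_neg:
  assumes "\<alpha> \<in> \<Delta>" "e \<in> wsp \<alpha>" "e \<noteq> 0" "x \<in> wsp \<mu>" "x \<noteq> 0" "pairing \<mu> \<alpha> < 0"
  shows "B e x \<noteq> 0"
proof
  assume "B e x = 0"
  then have "nrm (B (st e) x) = nrm e * pairing \<mu> \<alpha> * nrm x" using nrm_B[OF assms(1-4)] by simp
  moreover have "nrm e * pairing \<mu> \<alpha> * nrm x < 0"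
    using nrm_pos[OF assms(3)] nrm_pos[OF assms(5)] assms(6) by (simp add: mult_pos_neg mult_neg_pos)
  ultimately show False using nrm_nonneg[of "B (st e) x"] by simp
qed

lemma B_st_nonzero_pos:
  assumes "\<alpha> \<in> \<Delta>" "e \<in> wsp \<alpha>" "e \<noteq> 0" "x \<in> wsp \<mu>" "x \<noteq> 0" "pairing \<mu> \<alpha> > 0"
  shows "B (st e) x \<noteq> 0"
proof
  assume "B (st e) x = 0"
  then have "nrm (B e x) = - (nrm e * pairing \<mu> \<alpha> * nrm x)" using nrm_B[OF assms(1-4)] by simp
  moreover have "nrm e * pairing \<mu> \<alpha> * nrm x > 0"
    using nrm_pos[OF assms(3)] nrm_pos[OF assms(5)] assms(6) by simp
  ultimately show False using nrm_nonneg[of "B e x"] by simp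
qed

text \<open>For y in the root space orthogonal to e, the bracket of \<open>st e\<close> with y lies
  in h and is orthogonal to h, so it is 0. As the pairing of \<alpha> with itself is positive,
  \<open>B_st_nonzero_pos\<close> gives y = 0.\<close>

lemma root_space_dim_1:
  assumes \<alpha>: "\<alpha> \<in> \<Delta>" and e: "e \<in> wsp \<alpha>" "e \<noteq> 0" and x: "x \<in> wsp \<alpha>"
  shows "\<exists>c. x = c *s e"
proof -
  define y where "y = x - (ip x e / ip e e) *s e"
  have y: "y \<in> wsp \<alpha>"
    unfolding y_def using x e subspace_wsp by (simp add: vec.subspace_diff vec.subspace_scale)
  have ye: "ip y e = 0" using e by (simp add: y_def ip_diff ip_scale ip_self_eq_0)
  have "B (st e) y \<in> wsp (- \<alpha> + \<alpha>)" by (rule wsp_B[OF wsp_st[OF e(1)] y])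
  then have h: "B (st e) y \<in> h" using wsp_zero by simp
  have "ip (B (st e) y) H = 0" if H: "H \<in> h" for H
  proof -
    have "ip (B (st e) y) H = ip y (B e H)" by (simp add: ip_B st_st)
    also have "B e H = - (\<alpha> H *s e)" using B_skew[of e H] e(1) H by (simp add: wsp_iff)
    finally show ?thesis using ye by (simp add: ip_minus ip_scale_right)
  qed
  then have "B (st e) y = 0" using h ip_self_eq_0 by blast
  then have "y = 0" using B_st_nonzero_pos[OF \<alpha> e y] pairing_self_pos[OF \<alpha>] by blast
  then show ?thesis by (auto simp: y_def)
qed

text \<open>For x of weight 2\<alpha>, the bracket of \<open>st e\<close> with x is a multiple of e,
  and it is orthogonal to e because [e, e] = 0. So it vanishes, against
  \<open>B_st_nonzero_pos\<close>.\<close>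

lemma twice_not_root:
  assumes \<alpha>: "\<alpha> \<in> \<Delta>"
  shows "\<alpha> + \<alpha> \<notin> \<Delta>"
proof
  assume "\<alpha> + \<alpha> \<in> \<Delta>"
  then obtain x where x: "x \<in> wsp (\<alpha> + \<alpha>)" "x \<noteq> 0" using root_vector by blast
  obtain e where e: "e \<in> wsp \<alpha>" "e \<noteq> 0" using root_vector \<alpha> by blast
  have "B (st e) x \<in> wsp (- \<alpha> + (\<alpha> + \<alpha>))" by (rule wsp_B[OF wsp_st[OF e(1)] x(1)])
  then have "B (st e) x \<in> wsp \<alpha>" by simp
  then obtain c where c: "B (st e) x = c *s e" using root_space_dim_1[OF \<alpha> e] by blast
  have "ip (B (st e) x) e = 0" by (simp add: ip_B st_st B_self)
  then have "c = 0" using e(2) by (simp add: c ip_scale ip_self_eq_0)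
  then have "B (st e) x = 0" using c by simp
  moreover have "pairing (\<alpha> + \<alpha>) \<alpha> > 0" unfolding pairing_add using pairing_self_pos[OF \<alpha>] by simp
  ultimately show False using B_st_nonzero_pos[OF \<alpha> e x] by blast
qed

text \<open>If [e, x] = 0, then the pairing of \<beta> with \<alpha> is not negative and that of
  \<alpha> + \<beta> is positive. So \<open>st e\<close> does not kill the root space of \<alpha> +
  \<beta>; but its image there is a multiple of x orthogonal to x.\<close>

lemma B_root_vectors_nonzero:
  assumes ab: "\<alpha> \<in> \<Delta>" "\<beta> \<in> \<Delta>" "\<alpha> + \<beta> \<in> \<Delta>"
    and e: "e \<in> wsp \<alpha>" "e \<noteq> 0" and x: "x \<in> wsp \<beta>" "x \<noteq> 0"
  shows "B e x \<noteq> 0"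
proof
  assume 0: "B e x = 0"
  then have "\<not> pairing \<beta> \<alpha> < 0" using B_nonzero_neg[OF ab(1) e x] by blast
  then have pos: "pairing (\<alpha> + \<beta>) \<alpha> > 0" using pairing_self_pos[OF ab(1)] by (simp add: pairing_add)
  obtain y where y: "y \<in> wsp (\<alpha> + \<beta>)" "y \<noteq> 0" using root_vector ab(3) by blast
  have "B (st e) y \<in> wsp (- \<alpha> + (\<alpha> + \<beta>))" by (rule wsp_B[OF wsp_st[OF e(1)] y(1)])
  then have "B (st e) y \<in> wsp \<beta>" by (simp add: add.assoc[symmetric])
  then obtain c where c: "B (st e) y = c *s x" using root_space_dim_1[OF ab(2) x] by blast
  have "ip (B (st e) y) x = 0" by (simp add: ip_B st_st 0)
  then have "c = 0" using x(2) by (simp add: c ip_scale ip_self_eq_0)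
  then have "B (st e) y = 0" using c by simp
  then show False using B_st_nonzero_pos[OF ab(1) e y pos] by blast
qed

section \<open>Coroots and sl2-strings\<close>

definition crt :: "'n functional \<Rightarrow> complex^'n" where
  "crt \<alpha> = of_real (2 / pairing \<alpha> \<alpha>) *s tvec \<alpha>"

lemma crt_h: "\<alpha> \<in> \<Delta> \<Longrightarrow> crt \<alpha> \<in> h"
  unfolding crt_def using tvec_h vec.subspace_scale[OF h_subspace] by blast

lemma dual_crt: "\<alpha> \<in> \<Delta> \<Longrightarrow> \<mu> \<in> dual_space h \<Longrightarrow> \<mu> (crt \<alpha>) = of_real (2 / pairing \<alpha> \<alpha>) * \<mu> (tvec \<alpha>)"
  unfolding crt_def using dual_apply_scale tvec_h by blast

lemma root_crt: "\<alpha> \<in> \<Delta> \<Longrightarrow> \<beta> \<in> \<Delta> \<Longrightarrow> \<beta> (crt \<alpha>) = of_real (2 * pairing \<beta> \<alpha> / pairing \<alpha> \<alpha>)"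
  using dual_crt[OF _ root_dual] root_tvec by simp

lemma crt_self: "\<alpha> \<in> \<Delta> \<Longrightarrow> \<alpha> (crt \<alpha>) = 2"
  using root_crt[of \<alpha> \<alpha>] pairing_self_pos[of \<alpha>] by simp

text \<open>All brackets of vectors of weights \<alpha> and -\<alpha> are multiples of
  \<open>tvec \<alpha>\<close>, since both root spaces are lines; normalising the value of \<alpha>
  to 2 leaves one multiple.\<close>

lemma coroot_eq_crt:
  assumes \<alpha>: "\<alpha> \<in> \<Delta>"
  shows "coroot B h \<alpha> = crt \<alpha>"
  unfolding coroot_def neg_eq_uminus
proof (rule the_equality)
  obtain e where e: "e \<in> wsp \<alpha>" "e \<noteq> 0" using root_vector \<alpha> by blast
  let ?S = "{B e f |e f. e \<in> wsp \<alpha> \<and> f \<in> wsp (- \<alpha>)}"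
  have "B e (st e) \<in> ?S" using e(1) wsp_st by blast
  then have "of_real (nrm e) *s tvec \<alpha> \<in> vec.span ?S" unfolding B_e_st_e_eq[OF \<alpha> e] by (rule vec.span_base)
  then have "(of_real (1 / nrm e)) *s (of_real (nrm e) *s tvec \<alpha>) \<in> vec.span ?S" by (rule vec.span_scale)
  then have "tvec \<alpha> \<in> vec.span ?S" using e(2) by (simp add: nrm_eq_0)
  then show "crt \<alpha> \<in> vec.span ?S \<and> \<alpha> (crt \<alpha>) = 2"
    unfolding crt_def using crt_self[OF \<alpha>] by (simp add: crt_def vec.span_scale)
  fix H assume H: "H \<in> vec.span ?S \<and> \<alpha> H = 2"
  have "?S \<subseteq> {c *s tvec \<alpha> |c. True}"
  proof
    fix z assume "z \<in> ?S"
    then obtain e' f where z: "z = B e' f" "e' \<in> wsp \<alpha>" "f \<in> wsp (- \<alpha>)" by blast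
    obtain c where c: "e' = c *s e" using root_space_dim_1[OF \<alpha> e z(2)] by blast
    obtain d where d: "f = d *s st e"
      using root_space_dim_1[OF minus_in_\<Delta>[OF \<alpha>] wsp_st[OF e(1)] _ z(3)] e(2) by (auto simp: st_eq_0)
    have "z = (c * d * of_real (nrm e)) *s tvec \<alpha>"
      using B_e_st_e_eq[OF \<alpha> e] by (simp add: z(1) c d B_scale B_scale_right)
    then show "z \<in> {c *s tvec \<alpha> |c. True}" by blast
  qed
  moreover have "vec.subspace {c *s tvec \<alpha> |c. True}"
    using vec.subspace_span[of "{tvec \<alpha>}"] by (simp add: vec.span_singleton full_SetCompr_eq)
  ultimately obtain c where c: "H = c *s tvec \<alpha>" using vec.span_minimal H by blast
  have "c * \<alpha> (tvec \<alpha>) = 2" using H dual_apply_scale[OF root_dual[OF \<alpha>] tvec_h[OF \<alpha>]] c by simp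
  then have "c = of_real (2 / pairing \<alpha> \<alpha>)"
    using root_tvec[OF \<alpha> \<alpha>] pairing_self_pos[OF \<alpha>] by (simp add: field_simps)
  then show "H = crt \<alpha>" by (simp add: c crt_def)
qed

text \<open>The weights \<mu> + cj\<alpha> are pairwise distinct, and only finitely many weights
  occur.\<close>

lemma multiples_finite:
  assumes \<alpha>: "\<alpha> \<in> \<Delta>" and \<mu>: "\<mu> \<in> dual_space h" and c: "c \<noteq> 0"
    and v: "\<And>j::nat. v j \<in> wsp (\<mu> + of_int (c * int j) * \<alpha>)"
  shows "\<exists>j. v j = 0"
proof (rule ccontr)
  assume nz: "\<not> ?thesis"
  let ?g = "\<lambda>j::nat. \<mu> + of_int (c * int j) * \<alpha>"
  have "?g j \<in> {\<mu> \<in> dual_space h. wsp \<mu> \<noteq> {0}}" for j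
  proof -
    have "?g j \<in> dual_space h" by (rule dual_add[OF \<mu> dual_scale[OF root_dual[OF \<alpha>]]])
    moreover have "wsp (?g j) \<noteq> {0}" using v[of j] nz by blast
    ultimately show ?thesis by blast
  qed
  then have "range ?g \<subseteq> {\<mu> \<in> dual_space h. wsp \<mu> \<noteq> {0}}" by (rule image_subsetI)
  then have "finite (range ?g)" by (rule finite_subset) (rule finite_weights)
  moreover have "inj ?g"
  proof (rule injI)
    fix i j assume "?g i = ?g j"
    then have "?g i (crt \<alpha>) = ?g j (crt \<alpha>)" by (rule fun_cong)
    then have "of_int (c * int i) * (2::complex) = of_int (c * int j) * 2"
      unfolding plus_fun_apply times_fun_apply of_int_fun_apply crt_self[OF \<alpha>] by simp
    then show "i = j" using c by simp
  qed
  ultimately have "finite (UNIV :: nat set)" by (rule finite_imageD)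
  then show False by simp
qed

lemma sl2_string:
  assumes \<alpha>: "\<alpha> \<in> \<Delta>" and \<mu>: "\<mu> \<in> dual_space h" and x: "x \<in> wsp \<mu>" "x \<noteq> 0"
  shows "\<exists>n::int. \<mu> (crt \<alpha>) = of_int n \<and> (\<forall>i. 0 \<le> i \<and> i \<le> n \<longrightarrow> wsp (\<mu> - of_int i * \<alpha>) \<noteq> {0})"
proof -
  obtain e where e: "e \<in> wsp \<alpha>" "e \<noteq> 0" using root_vector \<alpha> by blast
  \<comment> \<open>Scaled so that [e, f] is the coroot of \<alpha>.\<close>
  define f where "f = of_real (2 / (pairing \<alpha> \<alpha> * nrm e)) *s st e"
  have f: "f \<in> wsp (- \<alpha>)" unfolding f_def using wsp_st[OF e(1)] subspace_wsp vec.subspace_scale by blast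
  have ef: "B e f = crt \<alpha>"
    using e(2) B_e_st_e_eq[OF \<alpha> e] by (simp add: f_def B_scale_right crt_def nrm_eq_0)
  have up: "(B e ^^ j) x \<in> wsp (\<mu> + of_int (1 * int j) * \<alpha>)" for j
  proof (induction j)
    case (Suc j)
    have "B e ((B e ^^ j) x) \<in> wsp (\<alpha> + (\<mu> + of_int (1 * int j) * \<alpha>))" by (rule wsp_B[OF e(1) Suc])
    also have "\<alpha> + (\<mu> + of_int (1 * int j) * \<alpha>) = \<mu> + of_int (1 * int (Suc j)) * \<alpha>"
      by (simp add: fun_eq_iff fun_apply algebra_simps)
    finally show ?case by (simp only: funpow.simps comp_apply)
  qed (use x in simp)
  obtain j where j: "(B e ^^ j) x = 0" using multiples_finite[OF \<alpha> \<mu> _ up] by auto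
  define k where "k = (LEAST j. (B e ^^ j) x = 0) - 1"
  have "(B e ^^ (LEAST j. (B e ^^ j) x = 0)) x = 0" using j by (rule LeastI)
  moreover have L0: "(LEAST j. (B e ^^ j) x = 0) \<noteq> 0" using calculation x(2) by (metis funpow_0)
  ultimately have k1: "(B e ^^ Suc k) x = 0" by (simp add: k_def)
  have k0: "(B e ^^ k) x \<noteq> 0"
    using not_less_Least[of k "\<lambda>j. (B e ^^ j) x = 0"] L0 by (auto simp: k_def)
  define y where "y = (B e ^^ k) x"
  define \<gamma> where "\<gamma> = \<mu> + of_int (int k) * \<alpha>"
  have y: "y \<in> wsp \<gamma>" "y \<noteq> 0" "B e y = 0" using up[of k] k0 k1 by (simp_all add: y_def \<gamma>_def)
  have \<gamma>: "\<gamma> \<in> dual_space h" unfolding \<gamma>_def by (rule dual_add[OF \<mu> dual_scale[OF root_dual[OF \<alpha>]]])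
  have down: "(B f ^^ j) y \<in> wsp (\<gamma> + of_int (-1 * int j) * \<alpha>)" for j
  proof (induction j)
    case (Suc j)
    have "B f ((B f ^^ j) y) \<in> wsp (- \<alpha> + (\<gamma> + of_int (-1 * int j) * \<alpha>))" by (rule wsp_B[OF f Suc])
    also have "- \<alpha> + (\<gamma> + of_int (-1 * int j) * \<alpha>) = \<gamma> + of_int (-1 * int (Suc j)) * \<alpha>"
      by (simp add: fun_eq_iff fun_apply algebra_simps)
    finally show ?case by (simp only: funpow.simps comp_apply)
  qed (use y in simp)
  \<comment> \<open>With the coroot as h this is e f^(j+1) y = (j+1) (\<gamma>(h) - j) f^j y. At the
    first vanishing power of f it forces \<gamma>(h) = m.\<close>
  have rec: "B e ((B f ^^ Suc j) y) = (of_nat (Suc j) * (\<gamma> (crt \<alpha>) - of_nat j)) *s (B f ^^ j) y" for j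
  proof (induction j)
    case 0
    have "B e (B f y) = B (crt \<alpha>) y" using jacobi[of e f y] by (simp add: ef y)
    then show ?case using y(1) crt_h[OF \<alpha>] by (simp add: wsp_iff)
  next
    case (Suc j)
    let ?z = "(B f ^^ Suc j) y"
    have "B (crt \<alpha>) ?z = (\<gamma> + of_int (-1 * int (Suc j)) * \<alpha>) (crt \<alpha>) *s ?z"
      using down[of "Suc j"] crt_h[OF \<alpha>] unfolding wsp_iff by blast
    also have "(\<gamma> + of_int (-1 * int (Suc j)) * \<alpha>) (crt \<alpha>) = \<gamma> (crt \<alpha>) - 2 * of_nat (Suc j)"
      unfolding plus_fun_apply times_fun_apply of_int_fun_apply crt_self[OF \<alpha>] by simp
    finally have 1: "B (crt \<alpha>) ?z = (\<gamma> (crt \<alpha>) - 2 * of_nat (Suc j)) *s ?z" .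
    have 2: "B f (B e ?z) = (of_nat (Suc j) * (\<gamma> (crt \<alpha>) - of_nat j)) *s ?z"
      unfolding Suc B_scale_right by simp
    have "B e ((B f ^^ Suc (Suc j)) y) = B e (B f ?z)" by simp
    also have "\<dots> = B (crt \<alpha>) ?z + B f (B e ?z)" using jacobi[of e f ?z] by (simp only: ef)
    also have "\<dots> = ((\<gamma> (crt \<alpha>) - 2 * of_nat (Suc j)) + (of_nat (Suc j) * (\<gamma> (crt \<alpha>) - of_nat j))) *s ?z"
      unfolding 1 2 by (simp only: vec.scale_left_distrib)
    also have "(\<gamma> (crt \<alpha>) - 2 * of_nat (Suc j)) + (of_nat (Suc j) * (\<gamma> (crt \<alpha>) - of_nat j)) =
        of_nat (Suc (Suc j)) * (\<gamma> (crt \<alpha>) - of_nat (Suc j))"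
      by (simp add: algebra_simps)
    finally show ?case .
  qed
  obtain l where l: "(B f ^^ l) y = 0" using multiples_finite[OF \<alpha> \<gamma> _ down] by auto
  define m where "m = (LEAST j. (B f ^^ j) y = 0) - 1"
  have "(B f ^^ (LEAST j. (B f ^^ j) y = 0)) y = 0" using l by (rule LeastI)
  moreover have M0: "(LEAST j. (B f ^^ j) y = 0) \<noteq> 0" using calculation y(2) by (metis funpow_0)
  ultimately have m1: "(B f ^^ Suc m) y = 0" by (simp add: m_def)
  have nz: "(B f ^^ j) y \<noteq> 0" if "j \<le> m" for j
    using not_less_Least[of j "\<lambda>j. (B f ^^ j) y = 0"] M0 that by (auto simp: m_def)
  have "(of_nat (Suc m) * (\<gamma> (crt \<alpha>) - of_nat m)) *s (B f ^^ m) y = 0"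
    using rec[of m] unfolding m1 by simp
  then have "of_nat (Suc m) * (\<gamma> (crt \<alpha>) - of_nat m) = 0"
    using nz[of m] unfolding vec.scale_eq_0_iff by blast
  then have \<gamma>m: "\<gamma> (crt \<alpha>) = of_nat m" unfolding mult_eq_0_iff by (simp del: of_nat_Suc)
  \<comment> \<open>The weights of the string are \<gamma> - j\<alpha> with j \<le> m, and \<mu>
    sits at j = k. Going i steps below \<mu> means j = k + i, which is in range because n + k = m -
    k.\<close>
  define n where "n = int m - 2 * int k"
  have "\<gamma> (crt \<alpha>) = \<mu> (crt \<alpha>) + of_int (int k) * 2"
    unfolding \<gamma>_def plus_fun_apply times_fun_apply of_int_fun_apply crt_self[OF \<alpha>] ..
  then have "\<mu> (crt \<alpha>) = of_int n" using \<gamma>m by (simp add: n_def)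
  moreover have "wsp (\<mu> - of_int i * \<alpha>) \<noteq> {0}" if i: "0 \<le> i" "i \<le> n" for i
  proof -
    have le: "k + nat i \<le> m" using i by (simp add: n_def)
    have "\<gamma> + of_int (-1 * int (k + nat i)) * \<alpha> = \<mu> - of_int i * \<alpha>"
      using i by (simp add: \<gamma>_def fun_eq_iff fun_apply algebra_simps)
    then show ?thesis using down[of "k + nat i"] nz[OF le] by auto
  qed
  ultimately show ?thesis by blast
qed

end

context unitary_lie
begin

section \<open>The axioms of a root system\<close>

lemma tvec_minus: "\<alpha> \<in> \<Delta> \<Longrightarrow> tvec (- \<alpha>) = - tvec \<alpha>"
  by (rule tvec_eqI) (simp_all add: vec.subspace_neg[OF h_subspace] tvec_h ip_minus ip_tvec uminus_apply)

lemma crt_minus: "\<alpha> \<in> \<Delta> \<Longrightarrow> crt (- \<alpha>) = - crt \<alpha>"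
proof -
  assume \<alpha>: "\<alpha> \<in> \<Delta>"
  have "pairing (- \<alpha>) (- \<alpha>) = pairing \<alpha> \<alpha>"
    using pairing_commute[OF minus_in_\<Delta>[OF \<alpha>] \<alpha>] pairing_commute[OF \<alpha> minus_in_\<Delta>[OF \<alpha>]]
      pairing_minus[of \<alpha> \<alpha>] pairing_minus[of \<alpha> "- \<alpha>"] by simp
  then show ?thesis unfolding crt_def tvec_minus[OF \<alpha>] by simp
qed

lemma dual_apply_minus: "\<mu> \<in> dual_space h \<Longrightarrow> x \<in> h \<Longrightarrow> \<mu> (- x) = - \<mu> x"
  using dual_apply_scale[of \<mu> x "-1"] by simp

text \<open>The weight spaces of the string are nonzero by \<open>sl2_string\<close>, so only the
  weight 0 has to be excluded. If \<beta> = i\<alpha>, then i \<ge> 2 and the string would also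
  contain 2\<alpha>, against \<open>twice_not_root\<close>.\<close>

lemma root_string:
  assumes \<alpha>: "\<alpha> \<in> \<Delta>" and \<beta>: "\<beta> \<in> \<Delta>" and ne: "\<beta> \<noteq> \<alpha>" and i: "0 \<le> i" "of_int i \<le> Re (\<beta> (crt \<alpha>))"
  shows "\<beta> - of_int i * \<alpha> \<in> \<Delta>"
proof -
  obtain x where x: "x \<in> wsp \<beta>" "x \<noteq> 0" using root_vector \<beta> by blast
  from sl2_string[OF \<alpha> root_dual[OF \<beta>] x] obtain n where n1: "\<beta> (crt \<alpha>) = of_int n"
    and n2: "\<forall>i. 0 \<le> i \<and> i \<le> n \<longrightarrow> wsp (\<beta> - of_int i * \<alpha>) \<noteq> {0}" by (elim exE conjE)
  note n = n1 n2[rule_format, OF conjI]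
  have dual: "\<beta> - of_int i * \<alpha> \<in> dual_space h"
    unfolding diff_conv_add_uminus by (rule dual_add[OF root_dual[OF \<beta>] dual_minus[OF dual_scale[OF root_dual[OF \<alpha>]]]])
  have "\<beta> - of_int i * \<alpha> \<noteq> 0"
  proof
    assume "\<beta> - of_int i * \<alpha> = 0"
    then have \<beta>i: "\<beta> = of_int i * \<alpha>" by simp
    have "\<beta> \<noteq> 0" using \<beta> by (simp add: roots_iff)
    have "i \<noteq> 0"
    proof
      assume "i = 0"
      then have "\<beta> = 0" using \<beta>i by simp
      then show False using \<open>\<beta> \<noteq> 0\<close> by contradiction
    qed
    moreover have "i \<noteq> 1"
    proof
      assume "i = 1"
      then have "\<beta> = \<alpha>" using \<beta>i by simp
      then show False using ne by contradiction
    qed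
    ultimately have 2: "2 \<le> i" using i by linarith
    have "\<beta> (crt \<alpha>) = of_int (2 * i)" unfolding \<beta>i times_fun_apply of_int_fun_apply crt_self[OF \<alpha>] by simp
    then have "n = 2 * i" using n(1) by (simp only: of_int_eq_iff)
    then have "0 \<le> i - 2" "i - 2 \<le> n" using 2 by simp_all
    then have w': "wsp (\<beta> - of_int (i - 2) * \<alpha>) \<noteq> {0}" by (rule n(2))
    have eq: "\<beta> - of_int (i - 2) * \<alpha> = \<alpha> + \<alpha>"
      unfolding \<beta>i by (simp add: fun_eq_iff fun_apply algebra_simps)
    have w: "wsp (\<alpha> + \<alpha>) \<noteq> {0}" using w' unfolding eq .
    have "\<alpha> + \<alpha> \<noteq> 0"
    proof
      assume "\<alpha> + \<alpha> = 0"
      then have "(\<alpha> + \<alpha>) (crt \<alpha>) = 0" by (simp add: zero_fun_apply)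
      then show False unfolding plus_fun_apply crt_self[OF \<alpha>] by simp
    qed
    then have "\<alpha> + \<alpha> \<in> \<Delta>" using w dual_add[OF root_dual[OF \<alpha>] root_dual[OF \<alpha>]] by (simp only: roots_iff not_False_eq_True simp_thms)
    then show False using twice_not_root \<alpha> by blast
  qed
  moreover have "i \<le> n" using i(2) n(1) by simp
  then have "wsp (\<beta> - of_int i * \<alpha>) \<noteq> {0}" using n(2) i(1) by blast
  ultimately show ?thesis using dual by (simp only: roots_iff not_False_eq_True simp_thms)
qed

lemma root_reflection:
  assumes \<alpha>: "\<alpha> \<in> \<Delta>" and \<beta>: "\<beta> \<in> \<Delta>"
  obtains n where "\<alpha> (crt \<beta>) = of_int n" "\<alpha> - of_int n * \<beta> \<in> \<Delta>"
proof -
  obtain x where "x \<in> wsp \<alpha>" "x \<noteq> 0" using root_vector \<alpha> by blast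
  then obtain n where n: "\<alpha> (crt \<beta>) = of_int n" using sl2_string[OF \<beta> root_dual[OF \<alpha>]] by blast
  consider "\<alpha> = \<beta>" | "\<alpha> = - \<beta>" | "\<alpha> \<noteq> \<beta>" "\<alpha> \<noteq> - \<beta>" by blast
  then have "\<alpha> - of_int n * \<beta> \<in> \<Delta>"
  proof cases
    case 1
    then have "complex_of_int n = of_int 2" using n crt_self[OF \<beta>] by simp
    then have "n = 2" by (simp only: of_int_eq_iff)
    then have "\<alpha> - of_int n * \<beta> = - \<beta>" using 1 by simp
    then show ?thesis using minus_in_\<Delta>[OF \<beta>] by simp
  next
    case 2
    then have "complex_of_int n = of_int (-2)" using n crt_self[OF \<beta>] by (simp add: uminus_apply)
    then have "n = -2" by (simp only: of_int_eq_iff)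
    then have "\<alpha> - of_int n * \<beta> = \<beta>" using 2 by simp
    then show ?thesis using \<beta> by simp
  next
    case 3
    show ?thesis
    proof (cases "n \<ge> 0")
      case True
      then show ?thesis using root_string[OF \<beta> \<alpha> 3(1), of n] n by simp
    next
      case False
      then have "\<alpha> - of_int (- n) * (- \<beta>) \<in> \<Delta>"
        using root_string[OF minus_in_\<Delta>[OF \<beta>] \<alpha> 3(2), of "- n"] n
          dual_apply_minus[OF root_dual[OF \<alpha>] crt_h[OF \<beta>]] by (simp add: crt_minus[OF \<beta>])
      then show ?thesis by simp
    qed
  qed
  with n show thesis by (rule that)
qed

text \<open>The reflection preserves the pairing of \<alpha> with itself, so the coroot transforms
  like the representing vector.\<close>

lemma crt_reflection:
  assumes \<alpha>: "\<alpha> \<in> \<Delta>" and \<beta>: "\<beta> \<in> \<Delta>" and \<mu>: "\<mu> \<in> dual_space h"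
    and n: "\<alpha> (crt \<beta>) = of_int n" and \<gamma>: "\<alpha> - of_int n * \<beta> \<in> \<Delta>"
  shows "\<mu> (crt (\<alpha> - of_int n * \<beta>)) = \<mu> (crt \<alpha>) - \<mu> (crt \<beta>) * \<beta> (crt \<alpha>)"
proof -
  let ?\<gamma> = "\<alpha> - of_int n * \<beta>"
  have t: "tvec ?\<gamma> = tvec \<alpha> + of_int (- n) *s tvec \<beta>"
  proof (rule tvec_eqI)
    show "tvec \<alpha> + of_int (- n) *s tvec \<beta> \<in> h"
      using tvec_h[OF \<alpha>] tvec_h[OF \<beta>] h_subspace by (simp add: vec.subspace_add vec.subspace_scale vec.subspace_neg vec.subspace_diff)
    show "ip H (tvec \<alpha> + of_int (- n) *s tvec \<beta>) = ?\<gamma> H" if "H \<in> h" for H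
      unfolding ip_add_right ip_scale_right ip_tvec[OF \<alpha> that] ip_tvec[OF \<beta> that] by (simp add: fun_apply)
  qed
  let ?a = "pairing \<alpha> \<alpha>" and ?b = "pairing \<beta> \<beta>" and ?s = "pairing \<alpha> \<beta>"
  have pos: "?a > 0" "?b > 0" using pairing_self_pos \<alpha> \<beta> by auto
  have s: "pairing \<beta> \<alpha> = ?s" using pairing_commute \<alpha> \<beta> by blast
  have "complex_of_real (of_int n) = complex_of_real (2 * ?s / ?b)" using n root_crt[OF \<beta> \<alpha>] by simp
  then have nr: "real_of_int n = 2 * ?s / ?b" by (simp only: of_real_eq_iff)
  have g: "\<mu> (tvec ?\<gamma>) = \<mu> (tvec \<alpha>) - of_int n * \<mu> (tvec \<beta>)" if "\<mu> \<in> dual_space h" for \<mu>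
    unfolding t dual_apply_add[OF that tvec_h[OF \<alpha>] vec.subspace_scale[OF h_subspace tvec_h[OF \<beta>]]]
      dual_apply_scale[OF that tvec_h[OF \<beta>]] by simp
  have "pairing ?\<gamma> ?\<gamma> = pairing ?\<gamma> \<alpha> - of_int n * pairing ?\<gamma> \<beta>"
    using g[OF root_dual[OF \<gamma>]] by (simp add: pairing_def)
  also have "\<dots> = (?a - of_int n * ?s) - of_int n * (?s - of_int n * ?b)"
    using s by (simp add: pairing_def fun_apply)
  also have "\<dots> = ?a" using pos by (simp add: nr field_simps)
  finally have norm: "pairing ?\<gamma> ?\<gamma> = ?a" .
  have "\<mu> (crt ?\<gamma>) = of_real (2 / ?a) * (\<mu> (tvec \<alpha>) - of_real (2 * ?s / ?b) * \<mu> (tvec \<beta>))"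
    using dual_crt[OF \<gamma> \<mu>] g[OF \<mu>] norm nr[symmetric] by simp
  moreover have "\<mu> (crt \<alpha>) = of_real (2 / ?a) * \<mu> (tvec \<alpha>)" "\<mu> (crt \<beta>) = of_real (2 / ?b) * \<mu> (tvec \<beta>)"
    using dual_crt \<alpha> \<beta> \<mu> by blast+
  moreover have "\<beta> (crt \<alpha>) = of_real (2 * ?s / ?a)" using root_crt[OF \<alpha> \<beta>] s by simp
  ultimately show ?thesis by (simp add: algebra_simps)
qed

text \<open>The combination is represented by a vector T of h, and its values on the
  \<open>tvec \<beta>\<close> express the squared norm of T as a sum of nonpositive terms.\<close>

lemma int_comb_posdef:
  assumes F: "F \<subseteq> \<Delta>" and c: "\<And>\<alpha>. \<alpha> \<in> F \<Longrightarrow> 0 \<le> c \<alpha>"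
    and le: "\<And>\<beta>. \<beta> \<in> F \<Longrightarrow> Re (int_comb F c (crt \<beta>)) \<le> 0"
  shows "int_comb F c = 0"
proof -
  let ?v = "int_comb F c"
  have fin: "finite F" using F finite_\<Delta> finite_subset by blast
  define T where "T = (\<Sum>\<alpha>\<in>F. of_int (c \<alpha>) *s tvec \<alpha>)"
  have T: "T \<in> h" unfolding T_def
    by (intro vec.subspace_sum vec.subspace_scale h_subspace tvec_h) (use F in blast)
  have v: "?v H = ip H T" if "H \<in> h" for H
    unfolding T_def ip_sum_right int_comb_apply
    by (rule sum.cong[OF HOL.refl]) (use F that in \<open>auto simp: ip_scale_right ip_tvec\<close>)
  have "?v T = (\<Sum>\<beta>\<in>F. of_int (c \<beta>) * ?v (tvec \<beta>))"
  proof -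
    have "ip T T = (\<Sum>\<beta>\<in>F. of_int (c \<beta>) * ip (tvec \<beta>) T)"
      by (subst T_def) (simp add: ip_sum ip_scale)
    also have "\<dots> = (\<Sum>\<beta>\<in>F. of_int (c \<beta>) * ?v (tvec \<beta>))"
      by (rule sum.cong[OF HOL.refl]) (use F v tvec_h in auto)
    finally show ?thesis using v[OF T] by simp
  qed
  then have "nrm T = (\<Sum>\<beta>\<in>F. of_int (c \<beta>) * Re (?v (tvec \<beta>)))"
    using v[OF T] by (simp add: nrm_def)
  also have "\<dots> \<le> 0"
  proof (rule sum_nonpos)
    fix \<beta> assume \<beta>: "\<beta> \<in> F"
    then have \<beta>R: "\<beta> \<in> \<Delta>" using F by blast
    have "?v (crt \<beta>) = of_real (2 / pairing \<beta> \<beta>) * ?v (tvec \<beta>)"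
      using v[OF crt_h[OF \<beta>R]] v[OF tvec_h[OF \<beta>R]] by (simp add: crt_def ip_scale)
    then have "2 / pairing \<beta> \<beta> * Re (?v (tvec \<beta>)) \<le> 0" using le[OF \<beta>] by simp
    then have "Re (?v (tvec \<beta>)) \<le> 0"
      using pairing_self_pos[OF \<beta>R] by (simp add: divide_le_0_iff)
    then show "of_int (c \<beta>) * Re (?v (tvec \<beta>)) \<le> 0" using c[OF \<beta>] by (simp add: mult_nonneg_nonpos)
  qed
  finally have "T = 0" using nrm_pos[of T] by force
  show ?thesis
  proof
    fix H
    show "?v H = 0 H"
    proof (cases "H \<in> h")
      case True
      then show ?thesis using v \<open>T = 0\<close> by (simp add: zero_fun_apply)
    next
      case False
      then have "\<alpha> H = 0" if "\<alpha> \<in> F" for \<alpha> using root_dual F that unfolding dual_space_def by blast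
      then show ?thesis unfolding int_comb_apply zero_fun_apply by (intro sum.neutral ballI) simp
    qed
  qed
qed

sublocale R: root_system \<Delta> "coroot B h" h
proof unfold_locales
  show "finite \<Delta>" by (rule finite_\<Delta>)
  show "\<Delta> \<subseteq> dual_space h" using root_dual by blast
  show "0 \<notin> \<Delta>" by (simp add: roots_iff)
next
  fix \<alpha> assume \<alpha>: "\<alpha> \<in> \<Delta>"
  note cr = coroot_eq_crt[OF \<alpha>]
  show "- \<alpha> \<in> \<Delta>" by (rule minus_in_\<Delta>[OF \<alpha>])
  show "\<alpha> (coroot B h \<alpha>) = 2" unfolding cr by (rule crt_self[OF \<alpha>])
  show "\<mu> (coroot B h (- \<alpha>)) = - \<mu> (coroot B h \<alpha>)" if "\<mu> \<in> dual_space h" for \<mu>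
    unfolding cr coroot_eq_crt[OF minus_in_\<Delta>[OF \<alpha>]] crt_minus[OF \<alpha>]
    by (rule dual_apply_minus[OF that crt_h[OF \<alpha>]])
  show "\<alpha> + \<alpha> \<notin> \<Delta>" by (rule twice_not_root[OF \<alpha>])
  fix \<beta> assume \<beta>: "\<beta> \<in> \<Delta>"
  note cr' = coroot_eq_crt[OF \<beta>]
  show "\<mu> (coroot B h (\<lambda>x. \<alpha> x - \<alpha> (coroot B h \<beta>) * \<beta> x)) =
      \<mu> (coroot B h \<alpha>) - \<mu> (coroot B h \<beta>) * \<beta> (coroot B h \<alpha>)" if \<mu>: "\<mu> \<in> dual_space h" for \<mu>
  proof -
    obtain n where n: "\<alpha> (crt \<beta>) = of_int n" "\<alpha> - of_int n * \<beta> \<in> \<Delta>" using root_reflection[OF \<alpha> \<beta>] .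
    have "(\<lambda>x. \<alpha> x - \<alpha> (coroot B h \<beta>) * \<beta> x) = \<alpha> - of_int n * \<beta>"
      unfolding cr' n(1) by (simp add: fun_eq_iff fun_apply)
    then show ?thesis
      unfolding cr cr' using crt_reflection[OF \<alpha> \<beta> \<mu> n] coroot_eq_crt[OF n(2)] by simp
  qed
  show "\<beta> (coroot B h \<alpha>) \<in> \<int>"
    unfolding cr using root_reflection[OF \<beta> \<alpha>] by (metis Ints_of_int)
  show "0 < Re (\<alpha> (coroot B h \<beta>))" if "0 < Re (\<beta> (coroot B h \<alpha>))"
    using that pairing_self_pos[OF \<alpha>] pairing_self_pos[OF \<beta>] pairing_commute[OF \<alpha> \<beta>]
    unfolding cr cr' root_crt[OF \<alpha> \<beta>] root_crt[OF \<beta> \<alpha>] by (simp add: zero_less_divide_iff)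
  show "\<beta> - of_int i * \<alpha> \<in> \<Delta>" if "\<beta> \<noteq> \<alpha>" "0 \<le> i" "of_int i \<le> Re (\<beta> (coroot B h \<alpha>))" for i
    using root_string[OF \<alpha> \<beta> that(1,2)] that(3) unfolding cr by blast
next
  fix F c assume F: "F \<subseteq> \<Delta>" "\<And>\<alpha>. \<alpha> \<in> F \<Longrightarrow> 0 \<le> c \<alpha>" "\<And>\<beta>. \<beta> \<in> F \<Longrightarrow> Re (int_comb F c (coroot B h \<beta>)) \<le> 0"
  show "int_comb F c = 0"
  proof (rule int_comb_posdef)
    show "Re (int_comb F c (crt \<beta>)) \<le> 0" if "\<beta> \<in> F" for \<beta>
      using F(3)[OF that] coroot_eq_crt F(1) that by force
  qed (use F in blast)+
qed

subsection \<open>Reductivity of stable subalgebras\<close>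

text \<open>On L, \<open>ad x\<close> commutes with its adjoint, so ad(x)^2 y = 0 makes ad(st x)
  ad(x) y have norm 0, whence ad(x) y = 0. Applying this twice brings the cube down to
  \<open>ad x\<close>.\<close>

lemma st_stable_central:
  assumes L: "\<And>x y. x \<in> L \<Longrightarrow> y \<in> L \<Longrightarrow> B x y \<in> L" "\<And>x. x \<in> L \<Longrightarrow> st x \<in> L"
    and x: "x \<in> L" and normal: "\<And>y. y \<in> L \<Longrightarrow> B (B x (st x)) y = 0"
    and nil: "\<And>y. y \<in> L \<Longrightarrow> B x (B x (B x y)) = 0" and y: "y \<in> L"
  shows "B x y = 0"
proof -
  have comm: "B (st x) (B x y) = B x (B (st x) y)" if "y \<in> L" for y
    using normal[OF that] jacobi[of x "st x" y] by simp
  have zero: "B x y = 0" if y: "y \<in> L" "B x (B x y) = 0" for y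
  proof -
    have xy: "B x y \<in> L" using L(1)[OF x y(1)] .
    have "ip (B (st x) (B x y)) (B (st x) (B x y)) = ip (B x y) (B x (B (st x) (B x y)))"
      by (simp add: ip_B st_st)
    also have "B x (B (st x) (B x y)) = B (st x) (B x (B x y))" using comm[OF xy] by simp
    finally have "B (st x) (B x y) = 0" using y(2) ip_self_eq_0 by simp
    then have "ip (B x y) (B x y) = 0" by (simp add: ip_B)
    then show ?thesis using ip_self_eq_0 by blast
  qed
  have "B x (B x y) = 0" using zero[OF L(1)[OF x y] nil[OF y]] .
  then show ?thesis using zero[OF y] by blast
qed

text \<open>For \<open>x\<close> in a term of the derived series of a solvable ideal, \<open>[x, st x]\<close> acts nilpotently and
  self-adjointly, hence trivially, so that \<open>ad x\<close> is normal and nilpotent, hence trivial.\<close>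

lemma reductive_st_stable:
  assumes sub: "subalgebra B L" and st: "\<And>x. x \<in> L \<Longrightarrow> st x \<in> L"
  shows "reductive B L"
  unfolding reductive_def
proof (intro allI impI)
  fix I assume I: "lie_ideal B L I \<and> solvable B I"
  let ?D = "derived_series B I"
  have L: "vec.subspace L" "\<And>x y. x \<in> L \<Longrightarrow> y \<in> L \<Longrightarrow> B x y \<in> L" using sub by (auto simp: subalgebra_def)
  have ideal: "lie_ideal B L (?D i)" for i
  proof (induction i)
    case (Suc i)
    let ?S = "{B x y |x y. x \<in> ?D i \<and> y \<in> ?D i}"
    have "?S \<subseteq> ?D i" using Suc by (auto simp: lie_ideal_def)
    then have 1: "vec.span ?S \<subseteq> ?D i" by (rule vec.span_minimal) (use Suc in \<open>simp add: lie_ideal_def\<close>)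
    have "B z w \<in> vec.span ?S" if z: "z \<in> L" and w: "w \<in> vec.span ?S" for z w
      using w
    proof (induction rule: vec.span_induct_alt)
      case base
      show ?case by (simp add: vec.span_zero)
    next
      case (step c s t)
      then obtain x y where xy: "s = B x y" "x \<in> ?D i" "y \<in> ?D i" by blast
      have "B z x \<in> ?D i" "B z y \<in> ?D i" using Suc z xy by (auto simp: lie_ideal_def)
      then have "B (B z x) y \<in> ?S" "B x (B z y) \<in> ?S" using xy by blast+
      then have "B z s \<in> vec.span ?S"
        unfolding xy(1) jacobi[of z x y] by (intro vec.span_add vec.span_base)
      then show ?case using step.IH by (simp only: B_add_right B_scale_right vec.span_add vec.span_scale)
    qed
    then show ?case using 1 Suc by (auto simp: lie_ideal_def)
  qed (use I in simp)
  have step: "?D i \<subseteq> lie_centre B L" if cen: "?D (Suc i) \<subseteq> lie_centre B L" for i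
  proof
    fix x assume x: "x \<in> ?D i"
    have D: "?D i \<subseteq> L" "\<And>z w. z \<in> L \<Longrightarrow> w \<in> ?D i \<Longrightarrow> B z w \<in> ?D i"
      using ideal[of i] by (auto simp: lie_ideal_def)
    have D': "B w z \<in> ?D i" if "w \<in> ?D i" "z \<in> L" for w z
    proof -
      have "B z w \<in> ?D i" using D that by blast
      then have "- B z w \<in> ?D i" using ideal[of i] vec.subspace_neg by (auto simp: lie_ideal_def)
      then show ?thesis using B_skew[of w z] by simp
    qed
    have DD: "B u (B v w) = 0" if "v \<in> ?D i" "w \<in> ?D i" "u \<in> L" for u v w
    proof -
      have "B v w \<in> ?D (Suc i)" using that by (auto intro!: vec.span_base)
      then have "B (B v w) u = 0" using cen that by (auto simp: lie_centre_def)
      then show ?thesis using B_skew[of u "B v w"] by simp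
    qed
    have xL: "x \<in> L" "st x \<in> L" using x D st by blast+
    \<comment> \<open>As \<open>st ?z = ?z\<close>, normality is automatic for \<open>?z\<close>,
      which is therefore shown central first; this makes x normal. The cubes vanish because one
      bracket lands in \<open>?D i\<close>, the second in \<open>?D (Suc i)\<close>, which is
      central.\<close>
    let ?z = "B x (st x)"
    have z: "?z \<in> ?D i" using D' x xL by blast
    have zL: "?z \<in> L" using z D by blast
    have st_z: "st ?z = ?z" by (simp add: st_B st_st)
    have z0: "B ?z y = 0" if y: "y \<in> L" for y
    proof (rule st_stable_central[OF L(2) st zL])
      show "B (B ?z (st ?z)) y = 0" for y by (simp add: st_z B_self)
      show "B ?z (B ?z (B ?z y)) = 0" if "y \<in> L" for y using DD z D' zL that by blast
    qed (use y in auto)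
    have "B x y = 0" if y: "y \<in> L" for y
    proof (rule st_stable_central[OF L(2) st xL(1)])
      show "B x (B x (B x y)) = 0" if "y \<in> L" for y using DD x D' xL that by blast
    qed (use y z0 in auto)
    then show "x \<in> lie_centre B L" using xL by (simp add: lie_centre_def)
  qed
  obtain m where m: "?D m = {0}" using I by (auto simp: solvable_def)
  have "?D (m - j) \<subseteq> lie_centre B L" for j
  proof (induction j)
    case 0
    show ?case using m vec.subspace_0[OF L(1)] by (simp add: lie_centre_def)
  next
    case (Suc j)
    show ?case
    proof (cases "j < m")
      case True
      then have "m - j = Suc (m - Suc j)" by simp
      then show ?thesis using Suc step by metis
    next
      case False
      then show ?thesis using Suc by simp
    qed
  qed
  from this[of m] show "I \<subseteq> lie_centre B L" by simp
qed

end

context unitary_lie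
begin

subsection \<open>Graded subspaces\<close>

text \<open>Additivity is asked on roots only, since the degrees used here are read off from
  expansions of roots in simple roots.\<close>

definition grading :: "('n functional \<Rightarrow> int) \<Rightarrow> bool" where
  "grading f \<longleftrightarrow> (\<forall>\<alpha>\<in>\<Delta>. \<forall>\<beta>\<in>\<Delta>. \<alpha> + \<beta> \<in> \<Delta> \<longrightarrow> f (\<alpha> + \<beta>) = f \<alpha> + f \<beta>) \<and> (\<forall>\<alpha>\<in>\<Delta>. f (- \<alpha>) = - f \<alpha>)"

text \<open>For n_\<nu> this is l_0. For the degree of an exchanged system it plays the part of
  l'_0: a given l'_0 lies in it, and conversely it serves as l'_0.\<close>

definition deg0 :: "('n functional \<Rightarrow> int) \<Rightarrow> (complex^'n) set" where
  "deg0 f = vec.span (h \<union> (\<Union>\<alpha>\<in>{\<alpha> \<in> \<Delta>. f \<alpha> = 0}. wsp \<alpha>))"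

definition deg1 :: "('n functional \<Rightarrow> int) \<Rightarrow> (complex^'n) set" where
  "deg1 f = vec.span (\<Union>\<alpha>\<in>{\<alpha> \<in> \<Delta>. f \<alpha> = 1}. wsp \<alpha>)"

lemma grading_add: "grading f \<Longrightarrow> \<alpha> \<in> \<Delta> \<Longrightarrow> \<beta> \<in> \<Delta> \<Longrightarrow> \<alpha> + \<beta> \<in> \<Delta> \<Longrightarrow> f (\<alpha> + \<beta>) = f \<alpha> + f \<beta>"
  and grading_minus: "grading f \<Longrightarrow> \<alpha> \<in> \<Delta> \<Longrightarrow> f (- \<alpha>) = - f \<alpha>"
  by (simp_all add: grading_def)

lemma deg0_eq: "deg0 f = vec.span (\<Union>\<alpha>\<in>insert 0 {\<alpha> \<in> \<Delta>. f \<alpha> = 0}. wsp \<alpha>)"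
proof -
  have "h = wsp 0" using wsp_zero by blast
  then show ?thesis unfolding deg0_def by (simp only: UN_insert)
qed

lemma span_B:
  assumes "\<And>x y. x \<in> S \<Longrightarrow> y \<in> T \<Longrightarrow> B x y \<in> vec.span U" "x \<in> vec.span S" "y \<in> vec.span T"
  shows "B x y \<in> vec.span U"
  using assms(2)
proof (induction rule: vec.span_induct_alt)
  case base
  show ?case by (simp add: vec.span_zero)
next
  case (step c x z)
  have "B x y \<in> vec.span U"
    using assms(3)
  proof (induction rule: vec.span_induct_alt)
    case base
    show ?case by (simp add: vec.span_zero)
  next
    case (step c' y w)
    then show ?case using assms(1) \<open>x \<in> S\<close> by (simp add: B_add_right B_scale_right vec.span_add vec.span_scale)
  qed
  then show ?case using step.IH by (simp only: B_add B_scale vec.span_add vec.span_scale)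
qed

lemma B_wsp_cases:
  assumes "\<alpha> \<in> \<Delta>" "\<beta> \<in> \<Delta>" "x \<in> wsp \<alpha>" "y \<in> wsp \<beta>"
  obtains "B x y = 0" | "\<alpha> + \<beta> = 0" "B x y \<in> h" | "\<alpha> + \<beta> \<in> \<Delta>" "B x y \<in> wsp (\<alpha> + \<beta>)"
proof -
  have w: "B x y \<in> wsp (\<alpha> + \<beta>)" using wsp_B assms by blast
  consider "B x y = 0" | "\<alpha> + \<beta> = 0" | "B x y \<noteq> 0" "\<alpha> + \<beta> \<noteq> 0" by blast
  then show thesis
  proof cases
    case 1
    then show thesis by (rule that(1))
  next
    case 2
    then have "B x y \<in> h" using w wsp_zero by (simp only:)
    then show thesis using that(2) 2 by blast
  next
    case 3
    have "\<alpha> + \<beta> \<in> \<Delta>" using rootI[OF dual_add[OF root_dual root_dual] 3(2) w 3(1)] assms by blast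
    then show thesis using that(3) w by blast
  qed
qed

lemma wsp_deg0: "\<alpha> \<in> \<Delta> \<Longrightarrow> f \<alpha> = 0 \<Longrightarrow> wsp \<alpha> \<subseteq> deg0 f"
  unfolding deg0_def by (blast intro: vec.span_base)

lemma h_deg0: "h \<subseteq> deg0 f"
  unfolding deg0_def by (blast intro: vec.span_base)

lemma wsp_deg1: "\<alpha> \<in> \<Delta> \<Longrightarrow> f \<alpha> = 1 \<Longrightarrow> wsp \<alpha> \<subseteq> deg1 f"
  unfolding deg1_def by (blast intro: vec.span_base)

lemma B_h_wsp: "H \<in> h \<Longrightarrow> x \<in> wsp \<alpha> \<Longrightarrow> B H x \<in> wsp \<alpha>"
  using vec.subspace_scale[OF subspace_wsp, of x \<alpha> "\<alpha> H"] by (simp add: wsp_iff)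

lemma subalgebra_deg0:
  assumes f: "grading f"
  shows "subalgebra B (deg0 f)"
  unfolding subalgebra_def
proof (intro conjI ballI)
  show "vec.subspace (deg0 f)" unfolding deg0_def by (rule vec.subspace_span)
  let ?S = "h \<union> (\<Union>\<alpha>\<in>{\<alpha> \<in> \<Delta>. f \<alpha> = 0}. wsp \<alpha>)"
  have gen: "B x y \<in> deg0 f" if x: "x \<in> ?S" and y: "y \<in> ?S" for x y
  proof -
    have hS: "B H z \<in> deg0 f" if H: "H \<in> h" and z: "z \<in> ?S" for H z
    proof (cases "z \<in> h")
      case True
      then show ?thesis using h_abelian[OF H] by (simp add: deg0_def vec.span_zero)
    next
      case False
      then obtain \<alpha> where "\<alpha> \<in> \<Delta>" "f \<alpha> = 0" "z \<in> wsp \<alpha>" using z by blast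
      then show ?thesis using B_h_wsp[OF H] wsp_deg0 by blast
    qed
    consider "x \<in> h" | "y \<in> h" | "x \<notin> h" "y \<notin> h" by blast
    then show ?thesis
    proof cases
      case 1
      then show ?thesis using hS y by blast
    next
      case 2
      then have "B y x \<in> deg0 f" using hS x by blast
      then show ?thesis using B_skew[of x y] vec.span_neg by (simp add: deg0_def)
    next
      case 3
      then obtain \<alpha> \<beta> where ab: "\<alpha> \<in> \<Delta>" "f \<alpha> = 0" "x \<in> wsp \<alpha>" "\<beta> \<in> \<Delta>" "f \<beta> = 0" "y \<in> wsp \<beta>" using x y by blast
      show ?thesis
      proof (rule B_wsp_cases[OF ab(1,4,3,6)])
        assume "\<alpha> + \<beta> \<in> \<Delta>" "B x y \<in> wsp (\<alpha> + \<beta>)"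
        then show ?thesis using grading_add[OF f ab(1,4)] ab wsp_deg0[of "\<alpha> + \<beta>" f] by auto
      qed (use h_deg0 in \<open>auto simp: deg0_def vec.span_zero\<close>)
    qed
  qed
  fix x y assume "x \<in> deg0 f" "y \<in> deg0 f"
  then show "B x y \<in> deg0 f" using span_B[of ?S ?S ?S x y] gen unfolding deg0_def by blast
qed

lemma deg0_B_deg1:
  assumes f: "grading f" and x: "x \<in> deg0 f" and y: "y \<in> deg1 f"
  shows "B x y \<in> deg1 f"
proof -
  let ?S = "h \<union> (\<Union>\<alpha>\<in>{\<alpha> \<in> \<Delta>. f \<alpha> = 0}. wsp \<alpha>)" and ?T = "\<Union>\<alpha>\<in>{\<alpha> \<in> \<Delta>. f \<alpha> = 1}. wsp \<alpha>"
  have gen: "B x y \<in> deg1 f" if x: "x \<in> ?S" and y: "y \<in> ?T" for x y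
  proof -
    obtain \<beta> where \<beta>: "\<beta> \<in> \<Delta>" "f \<beta> = 1" "y \<in> wsp \<beta>" using y by blast
    show ?thesis
    proof (cases "x \<in> h")
      case True
      then show ?thesis using B_h_wsp \<beta> wsp_deg1 by blast
    next
      case False
      then obtain \<alpha> where \<alpha>: "\<alpha> \<in> \<Delta>" "f \<alpha> = 0" "x \<in> wsp \<alpha>" using x by blast
      show ?thesis
      proof (rule B_wsp_cases[OF \<alpha>(1) \<beta>(1) \<alpha>(3) \<beta>(3)])
        assume "\<alpha> + \<beta> = 0"
        then have "\<beta> = - \<alpha>" by (rule eq_neg_iff_add_eq_0[THEN iffD2, OF trans[OF add.commute]])
        then show ?thesis using grading_minus[OF f \<alpha>(1)] \<alpha> \<beta> by simp
      next
        assume "\<alpha> + \<beta> \<in> \<Delta>" "B x y \<in> wsp (\<alpha> + \<beta>)"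
        then show ?thesis using grading_add[OF f \<alpha>(1) \<beta>(1)] \<alpha> \<beta> wsp_deg1[of "\<alpha> + \<beta>" f] by auto
      qed (simp add: deg1_def vec.span_zero)
    qed
  qed
  show ?thesis using span_B[of ?S ?T ?T x y] gen x y unfolding deg0_def deg1_def by blast
qed

lemma st_deg0:
  assumes f: "grading f" and x: "x \<in> deg0 f"
  shows "st x \<in> deg0 f"
  using x unfolding deg0_def
proof (induction rule: vec.span_induct_alt)
  case base
  show ?case by (simp add: vec.span_zero)
next
  case (step c x y)
  have "st x \<in> deg0 f"
  proof (cases "x \<in> h")
    case True
    then show ?thesis using h_st h_deg0 by blast
  next
    case False
    then obtain \<alpha> where \<alpha>: "\<alpha> \<in> \<Delta>" "f \<alpha> = 0" "x \<in> wsp \<alpha>" using step.hyps by blast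
    then have "f (- \<alpha>) = 0" using grading_minus[OF f] by simp
    then show ?thesis using wsp_st[OF \<alpha>(3)] wsp_deg0[OF minus_in_\<Delta>[OF \<alpha>(1)]] by blast
  qed
  then show ?case using step.IH unfolding deg0_def st_add st_scale by (intro vec.span_add vec.span_scale)
qed

lemma reductive_deg0: "grading f \<Longrightarrow> reductive B (deg0 f)"
  by (rule reductive_st_stable[OF subalgebra_deg0 st_deg0])

text \<open>By orthogonality, a weight vector in a span of weight spaces has one of their
  weights.\<close>

lemma roots_deg0: "roots B h (deg0 f) = {\<alpha> \<in> \<Delta>. f \<alpha> = 0}"
proof (intro equalityI subsetI)
  fix \<alpha> assume \<alpha>: "\<alpha> \<in> {\<alpha> \<in> \<Delta>. f \<alpha> = 0}"
  then have "weight_space B h (deg0 f) \<alpha> = wsp \<alpha>" using wsp_deg0[of \<alpha> f] by (intro weight_space_wsp) simp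
  then show "\<alpha> \<in> roots B h (deg0 f)" using \<alpha> by (simp add: roots_iff)
next
  fix \<alpha> assume "\<alpha> \<in> roots B h (deg0 f)"
  then have \<alpha>: "\<alpha> \<in> dual_space h" "\<alpha> \<noteq> 0" "weight_space B h (deg0 f) \<alpha> \<noteq> {0}" by (simp_all add: roots_iff)
  have "0 \<in> weight_space B h (deg0 f) \<alpha>"
    by (rule weight_spaceI[OF _ vec.subspace_0[OF subspace_wsp]]) (simp add: deg0_def vec.span_zero)
  then obtain x where "x \<in> weight_space B h (deg0 f) \<alpha>" "x \<noteq> 0" using \<alpha>(3) by blast
  then have x: "x \<in> deg0 f" "x \<in> wsp \<alpha>" "x \<noteq> 0" using weight_spaceD by blast+
  have "\<alpha> \<in> insert 0 {\<alpha> \<in> \<Delta>. f \<alpha> = 0}"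
  proof (rule wsp_in_span[OF x(2,3) \<alpha>(1)])
    show "x \<in> vec.span (\<Union>\<alpha>\<in>insert 0 {\<alpha> \<in> \<Delta>. f \<alpha> = 0}. wsp \<alpha>)" using x(1) unfolding deg0_eq .
    show "insert 0 {\<alpha> \<in> \<Delta>. f \<alpha> = 0} \<subseteq> dual_space h" using dual_zero root_dual by blast
  qed
  then show "\<alpha> \<in> {\<alpha> \<in> \<Delta>. f \<alpha> = 0}" using \<alpha>(2) by blast
qed

lemma deg1_weight:
  assumes "x \<in> deg1 f" "x \<in> wsp \<mu>" "x \<noteq> 0" "\<mu> \<in> dual_space h"
  shows "\<mu> \<in> \<Delta>" "f \<mu> = 1"
proof -
  have "\<mu> \<in> {\<alpha> \<in> \<Delta>. f \<alpha> = 1}"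
  proof (rule wsp_in_span[OF assms(2,3,4)])
    show "x \<in> vec.span (\<Union>\<alpha>\<in>{\<alpha> \<in> \<Delta>. f \<alpha> = 1}. wsp \<alpha>)" using assms(1) unfolding deg1_def .
    show "{\<alpha> \<in> \<Delta>. f \<alpha> = 1} \<subseteq> dual_space h" using root_dual by blast
  qed
  then show "\<mu> \<in> \<Delta>" "f \<mu> = 1" by blast+
qed

lemma h_stable_subset_deg0:
  assumes M: "h_stable M" and r: "\<And>\<alpha>. \<alpha> \<in> roots B h M \<Longrightarrow> \<alpha> \<in> \<Delta> \<and> f \<alpha> = 0"
  shows "M \<subseteq> deg0 f"
proof -
  have "weight_space B h M \<mu> \<subseteq> deg0 f" if \<mu>: "\<mu> \<in> dual_space h" for \<mu>
  proof (cases "\<mu> = 0")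
    case True
    show ?thesis
    proof
      fix x assume "x \<in> weight_space B h M \<mu>"
      then have "x \<in> wsp 0" using weight_spaceD True by blast
      then show "x \<in> deg0 f" using wsp_zero h_deg0 by blast
    qed
  next
    case False
    show ?thesis
    proof (cases "weight_space B h M \<mu> = {0}")
      case True
      then show ?thesis by (simp add: deg0_def vec.span_zero)
    next
      case ne: False
      then have "\<mu> \<in> roots B h M" using \<mu> False unfolding roots_iff by blast
      then have "wsp \<mu> \<subseteq> deg0 f" using r wsp_deg0 by blast
      then show ?thesis using weight_spaceD by blast
    qed
  qed
  then have "vec.span (\<Union>\<mu>\<in>dual_space h. weight_space B h M \<mu>) \<subseteq> deg0 f"
    by (intro vec.span_minimal) (auto simp: deg0_def vec.subspace_span)
  then show ?thesis using weight_decomposition[OF M] by blast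
qed

text \<open>Root spaces are lines, so one nonzero root vector in M brings the whole root
  space.\<close>

lemma roots_subset: "\<alpha> \<in> roots B h M \<Longrightarrow> vec.subspace M \<Longrightarrow> \<alpha> \<in> \<Delta> \<and> wsp \<alpha> \<subseteq> M"
proof -
  assume \<alpha>: "\<alpha> \<in> roots B h M" and M: "vec.subspace M"
  have "0 \<in> weight_space B h M \<alpha>"
    by (rule weight_spaceI[OF vec.subspace_0[OF M] vec.subspace_0[OF subspace_wsp]])
  moreover have "weight_space B h M \<alpha> \<noteq> {0}" using \<alpha> by (simp add: roots_iff)
  ultimately obtain x where "x \<in> weight_space B h M \<alpha>" "x \<noteq> 0" by blast
  then have x: "x \<in> M" "x \<in> wsp \<alpha>" "x \<noteq> 0" using weight_spaceD by blast+
  have \<alpha>\<Delta>: "\<alpha> \<in> \<Delta>" using rootI[OF _ _ x(2,3)] \<alpha> by (simp add: roots_iff)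
  have "wsp \<alpha> \<subseteq> M"
  proof
    fix y assume "y \<in> wsp \<alpha>"
    then obtain c where "y = c *s x" using root_space_dim_1[OF \<alpha>\<Delta> x(2,3)] by blast
    then show "y \<in> M" using vec.subspace_scale[OF M x(1)] by simp
  qed
  then show ?thesis using \<alpha>\<Delta> by blast
qed

lemma roots_of_subalgebra_closed:
  assumes L: "subalgebra B L" and ab: "\<alpha> \<in> roots B h L" "\<beta> \<in> roots B h L" "\<alpha> + \<beta> \<in> \<Delta>"
  shows "\<alpha> + \<beta> \<in> roots B h L"
proof -
  have sub: "vec.subspace L" using L by (simp add: subalgebra_def)
  have a: "\<alpha> \<in> \<Delta>" "wsp \<alpha> \<subseteq> L" and b: "\<beta> \<in> \<Delta>" "wsp \<beta> \<subseteq> L"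
    using roots_subset[OF ab(1) sub] roots_subset[OF ab(2) sub] by simp_all
  obtain e where e: "e \<in> wsp \<alpha>" "e \<noteq> 0" using root_vector[OF a(1)] by blast
  obtain x where x: "x \<in> wsp \<beta>" "x \<noteq> 0" using root_vector[OF b(1)] by blast
  have "e \<in> L" "x \<in> L" using e x a b by blast+
  then have "B e x \<in> L" using L by (simp add: subalgebra_def)
  then have "B e x \<in> weight_space B h L (\<alpha> + \<beta>)" by (rule weight_spaceI[OF _ wsp_B[OF e(1) x(1)]])
  moreover have "B e x \<noteq> 0" using B_root_vectors_nonzero[OF a(1) b(1) ab(3) e x] .
  ultimately have "weight_space B h L (\<alpha> + \<beta>) \<noteq> {0}" by blast
  then show ?thesis using ab(3) by (simp add: roots_iff)
qed

text \<open>All roots of L have degree 0, so L preserves the part of degree 1. The intersection of V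
  with it is a submodule that contains v, hence is V.\<close>

lemma submodule_subset_deg1:
  assumes f: "grading f" and V: "irreducible_submodule B L M V"
    and L: "subalgebra B L" "h \<subseteq> L" and r: "\<And>\<alpha>. \<alpha> \<in> roots B h L \<Longrightarrow> f \<alpha> = 0"
    and v: "v \<in> V" "v \<in> wsp \<mu>" "v \<noteq> 0" "\<mu> \<in> \<Delta>" "f \<mu> = 1"
  shows "V \<subseteq> deg1 f"
proof -
  have sub: "vec.subspace L" using L by (simp add: subalgebra_def)
  have "h_stable L" using L unfolding h_stable_def subalgebra_def by blast
  then have L0: "L \<subseteq> deg0 f" using h_stable_subset_deg0[of L f] r roots_subset[OF _ sub] by blast
  have Vs: "vec.subspace V" "\<And>x w. x \<in> L \<Longrightarrow> w \<in> V \<Longrightarrow> B x w \<in> V"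
    using V by (auto simp: irreducible_submodule_def)
  let ?U = "V \<inter> deg1 f"
  have "vec.subspace ?U" using Vs(1) by (intro vec.subspace_inter) (simp_all add: deg1_def vec.subspace_span)
  moreover have "\<forall>x\<in>L. \<forall>w\<in>?U. B x w \<in> ?U" using Vs(2) deg0_B_deg1[OF f] L0 by blast
  ultimately have "?U = {0} \<or> ?U = V" using V unfolding irreducible_submodule_def by blast
  moreover have "v \<in> ?U" using v wsp_deg1 by blast
  ultimately show ?thesis using v(3) by blast
qed

text \<open>A root vector of weight -\<gamma> kills the lowest weight vector; by
  \<open>B_root_vectors_nonzero\<close> the sum \<nu>' - \<gamma> is then not a root.\<close>

lemma lowest_weight_deg1:
  assumes low: "lowest_weight B h L Q V \<nu>'" and V: "V \<subseteq> deg1 f" and L: "vec.subspace L"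
    and Q: "\<And>\<gamma>. \<gamma> \<in> Q \<Longrightarrow> - \<gamma> \<in> roots B h L"
  shows "\<nu>' \<in> \<Delta>" "f \<nu>' = 1" "\<And>\<gamma>. \<gamma> \<in> Q \<Longrightarrow> \<nu>' - \<gamma> \<notin> \<Delta>"
proof -
  obtain v where d: "\<nu>' \<in> dual_space h" and v: "v \<in> V" "v \<in> wsp \<nu>'" "v \<noteq> 0"
    and kill: "\<And>\<alpha> e. \<alpha> \<in> uminus ` Q \<Longrightarrow> e \<in> weight_space B h L \<alpha> \<Longrightarrow> B e v = 0"
    using low weight_spaceD[of _ V \<nu>'] unfolding lowest_weight_def highest_weight_def neg_eq_uminus by blast
  show \<nu>': "\<nu>' \<in> \<Delta>" and "f \<nu>' = 1" using deg1_weight[OF _ v(2,3) d] V v(1) by blast+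
  fix \<gamma> assume \<gamma>: "\<gamma> \<in> Q"
  have m: "- \<gamma> \<in> \<Delta>" "wsp (- \<gamma>) \<subseteq> L" using roots_subset[OF Q[OF \<gamma>] L] by simp_all
  obtain e where e: "e \<in> wsp (- \<gamma>)" "e \<noteq> 0" using root_vector m(1) by blast
  show "\<nu>' - \<gamma> \<notin> \<Delta>"
  proof
    assume "\<nu>' - \<gamma> \<in> \<Delta>"
    then have "- \<gamma> + \<nu>' \<in> \<Delta>" by (simp add: add.commute)
    then have "B e v \<noteq> 0" using B_root_vectors_nonzero[OF m(1) \<nu>' _ e v(2,3)] by blast
    moreover have "e \<in> weight_space B h L (- \<gamma>)" by (rule weight_spaceI[OF _ e(1)]) (use m(2) e(1) in blast)
    then have "B e v = 0" using kill \<gamma> by blast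
    ultimately show False by blast
  qed
qed

text \<open>Reduces irreducibility to combinatorics: a nonzero submodule contains a root space, and
  with it all those reached by adding roots of degree 0. The hypothesis \<open>connected\<close>
  says that these are all of degree 1.\<close>

lemma irreducible_deg1:
  assumes f: "grading f" and M: "deg1 f \<subseteq> M" and ne: "\<mu> \<in> \<Delta>" "f \<mu> = 1"
    and connected: "\<And>S. S \<noteq> {} \<Longrightarrow> S \<subseteq> {\<beta> \<in> \<Delta>. f \<beta> = 1} \<Longrightarrow>
      (\<And>\<beta> \<gamma>. \<beta> \<in> S \<Longrightarrow> \<gamma> \<in> \<Delta> \<Longrightarrow> f \<gamma> = 0 \<Longrightarrow> \<gamma> + \<beta> \<in> \<Delta> \<Longrightarrow> \<gamma> + \<beta> \<in> S) \<Longrightarrow> {\<beta> \<in> \<Delta>. f \<beta> = 1} \<subseteq> S"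
  shows "irreducible_submodule B (deg0 f) M (deg1 f)"
  unfolding irreducible_submodule_def
proof (intro conjI ballI allI impI)
  show "vec.subspace (deg1 f)" unfolding deg1_def by (rule vec.subspace_span)
  show "deg1 f \<subseteq> M" by (rule M)
  obtain e where "e \<in> wsp \<mu>" "e \<noteq> 0" using root_vector ne(1) by blast
  then show "deg1 f \<noteq> {0}" using wsp_deg1 ne by blast
  show "B x v \<in> deg1 f" if "x \<in> deg0 f" "v \<in> deg1 f" for x v using deg0_B_deg1[OF f that] .
  fix U assume U: "vec.subspace U \<and> U \<subseteq> deg1 f \<and> (\<forall>x\<in>deg0 f. \<forall>v\<in>U. B x v \<in> U)"
  have "deg1 f \<subseteq> U" if U_ne: "U \<noteq> {0}"
  proof -
    have "h_stable U" using U h_deg0 unfolding h_stable_def by blast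
    then obtain \<mu>' v where v: "\<mu>' \<in> dual_space h" "v \<in> U" "v \<in> wsp \<mu>'" "v \<noteq> 0"
      using weight_vector_exists[OF _ U_ne] weight_spaceD by blast
    define S where "S = {\<beta> \<in> \<Delta>. f \<beta> = 1 \<and> wsp \<beta> \<subseteq> U}"
    have line: "wsp \<beta> \<subseteq> U" if w: "\<beta> \<in> \<Delta>" "w \<in> U" "w \<in> wsp \<beta>" "w \<noteq> 0" for \<beta> w
    proof
      fix y assume "y \<in> wsp \<beta>"
      then obtain c where "y = c *s w" using root_space_dim_1[OF w(1,3,4)] by blast
      then show "y \<in> U" using U w(2) vec.subspace_scale by blast
    qed
    have "\<mu>' \<in> \<Delta>" "f \<mu>' = 1" using deg1_weight[OF _ v(3,4,1)] U v(2) by blast+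
    then have "\<mu>' \<in> S" using line[OF _ v(2,3,4)] by (simp add: S_def)
    then have ne: "S \<noteq> {}" by blast
    have step: "\<gamma> + \<beta> \<in> S" if bg: "\<beta> \<in> S" "\<gamma> \<in> \<Delta>" "f \<gamma> = 0" "\<gamma> + \<beta> \<in> \<Delta>" for \<beta> \<gamma>
    proof -
      have \<beta>: "\<beta> \<in> \<Delta>" "f \<beta> = 1" "wsp \<beta> \<subseteq> U" using bg(1) by (simp_all add: S_def)
      obtain e where e: "e \<in> wsp \<gamma>" "e \<noteq> 0" using root_vector[OF bg(2)] by blast
      obtain x where x: "x \<in> wsp \<beta>" "x \<noteq> 0" using root_vector[OF \<beta>(1)] by blast
      have nz: "B e x \<noteq> 0" by (rule B_root_vectors_nonzero[OF bg(2) \<beta>(1) bg(4) e x])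
      have "e \<in> deg0 f" using wsp_deg0[of _ f, OF bg(2,3)] e(1) by blast
      then have "B e x \<in> U" using U \<beta>(3) x(1) by blast
      then have "wsp (\<gamma> + \<beta>) \<subseteq> U" using line[OF bg(4) _ wsp_B[OF e(1) x(1)] nz] by blast
      moreover have "f (\<gamma> + \<beta>) = 1" using grading_add[OF f bg(2) \<beta>(1) bg(4)] bg(3) \<beta>(2) by simp
      ultimately show ?thesis using bg(4) by (simp add: S_def)
    qed
    have "{\<beta> \<in> \<Delta>. f \<beta> = 1} \<subseteq> S" by (rule connected[OF ne _ step]) (auto simp: S_def)
    then have "(\<Union>\<alpha>\<in>{\<alpha> \<in> \<Delta>. f \<alpha> = 1}. wsp \<alpha>) \<subseteq> U" unfolding S_def by blast
    then show ?thesis unfolding deg1_def using U by (intro vec.span_minimal) blast+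
  qed
  then show "U = {0} \<or> U = deg1 f" using U by blast
qed

lemma highest_weight_deg1:
  assumes f: "grading f" and \<mu>: "\<mu> \<in> \<Delta>" "f \<mu> = 1"
    and Q: "\<And>\<gamma>. \<gamma> \<in> Q \<Longrightarrow> \<gamma> \<in> \<Delta> \<and> f \<gamma> = 0 \<and> \<gamma> + \<mu> \<notin> \<Delta>"
  shows "highest_weight B h (deg0 f) Q (deg1 f) \<mu>"
  unfolding highest_weight_def
proof (intro conjI)
  show "\<mu> \<in> dual_space h" by (rule root_dual[OF \<mu>(1)])
  obtain v where v: "v \<in> wsp \<mu>" "v \<noteq> 0" using root_vector \<mu>(1) by blast
  have "v \<in> weight_space B h (deg1 f) \<mu>" by (rule weight_spaceI[OF _ v(1)]) (use v(1) wsp_deg1[of _ f, OF \<mu>] in blast)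
  moreover have "B e v = 0" if \<gamma>: "\<gamma> \<in> Q" and e: "e \<in> weight_space B h (deg0 f) \<gamma>" for \<gamma> e
  proof -
    have e': "e \<in> wsp \<gamma>" using weight_spaceD[OF e] by blast
    have g: "\<gamma> \<in> \<Delta>" "f \<gamma> = 0" "\<gamma> + \<mu> \<notin> \<Delta>" using Q[OF \<gamma>] by simp_all
    show ?thesis
    proof (rule B_wsp_cases[OF g(1) \<mu>(1) e' v(1)])
      assume "\<gamma> + \<mu> = 0"
      then have "\<mu> = - \<gamma>" by (rule eq_neg_iff_add_eq_0[THEN iffD2, OF trans[OF add.commute]])
      then show ?thesis using grading_minus[OF f g(1)] g(2) \<mu>(2) by simp
    qed (use g(3) in blast)+
  qed
  ultimately show "\<exists>v\<in>weight_space B h (deg1 f) \<mu>. v \<noteq> 0 \<and> (\<forall>\<alpha>\<in>Q. \<forall>e\<in>weight_space B h (deg0 f) \<alpha>. B e v = 0)"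
    using v(2) by blast
qed

end

section \<open>Compact and non-compact roots\<close>

locale cartan_lie = unitary_lie +
  fixes k p
  assumes subspace_k: "vec.subspace k" and subspace_p: "vec.subspace p"
    and k_plus_p: "\<exists>y\<in>k. \<exists>z\<in>p. x = y + z"
    and k_int_p: "x \<in> k \<Longrightarrow> x \<in> p \<Longrightarrow> x = 0"
    and B_k_k: "x \<in> k \<Longrightarrow> y \<in> k \<Longrightarrow> B x y \<in> k"
    and B_k_p: "x \<in> k \<Longrightarrow> y \<in> p \<Longrightarrow> B x y \<in> p"
    and B_p_p: "x \<in> p \<Longrightarrow> y \<in> p \<Longrightarrow> B x y \<in> k"
    and h_subset_k: "h \<subseteq> k"
begin

abbreviation \<Delta>k where "\<Delta>k \<equiv> roots B h k"

text \<open>Since h lies in k, it preserves k and p, so both components of a root vector have the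
  same weight; the root space is the line through a nonzero one.\<close>

lemma root_space_k_or_p: "\<alpha> \<in> \<Delta> \<Longrightarrow> wsp \<alpha> \<subseteq> k \<or> wsp \<alpha> \<subseteq> p"
proof -
  assume \<alpha>: "\<alpha> \<in> \<Delta>"
  obtain e where e: "e \<in> wsp \<alpha>" "e \<noteq> 0" using root_vector \<alpha> by blast
  obtain y z where yz: "y \<in> k" "z \<in> p" "e = y + z" using k_plus_p by blast
  have "B H y = \<alpha> H *s y \<and> B H z = \<alpha> H *s z" if H: "H \<in> h" for H
  proof -
    let ?u = "B H y - \<alpha> H *s y" and ?v = "B H z - \<alpha> H *s z"
    have Hk: "H \<in> k" using H h_subset_k by blast
    have "?u + ?v = B H e - \<alpha> H *s e"
      unfolding yz(3) by (simp add: B_add_right vec.scale_right_distrib)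
    also have "\<dots> = 0" using e(1) H by (simp add: wsp_iff)
    finally have uv: "?u = - ?v" by (simp only: eq_neg_iff_add_eq_0)
    have "?u \<in> k" by (rule vec.subspace_diff[OF subspace_k B_k_k[OF Hk yz(1)] vec.subspace_scale[OF subspace_k yz(1)]])
    moreover have "?v \<in> p" by (rule vec.subspace_diff[OF subspace_p B_k_p[OF Hk yz(2)] vec.subspace_scale[OF subspace_p yz(2)]])
    then have "?u \<in> p" unfolding uv by (rule vec.subspace_neg[OF subspace_p])
    ultimately have "?u = 0" by (rule k_int_p)
    then show ?thesis using uv by simp
  qed
  then have w: "y \<in> wsp \<alpha>" "z \<in> wsp \<alpha>" by (simp_all add: wsp_iff)
  have line: "wsp \<alpha> \<subseteq> M" if x: "vec.subspace M" "x \<in> M" "x \<in> wsp \<alpha>" "x \<noteq> 0" for M x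
  proof
    fix u assume "u \<in> wsp \<alpha>"
    then obtain c where "u = c *s x" using root_space_dim_1[OF \<alpha> x(3,4)] by blast
    then show "u \<in> M" using vec.subspace_scale[OF x(1,2)] by simp
  qed
  show ?thesis
  proof (cases "y = 0")
    case True
    then have "z \<noteq> 0" using e(2) yz(3) by simp
    then show ?thesis using line[OF subspace_p yz(2) w(2)] by blast
  next
    case False
    then show ?thesis using line[OF subspace_k yz(1) w(1)] by blast
  qed
qed

lemma compact_root_iff: "\<alpha> \<in> \<Delta>k \<longleftrightarrow> \<alpha> \<in> \<Delta> \<and> wsp \<alpha> \<subseteq> k"
proof
  assume "\<alpha> \<in> \<Delta>k"
  then show "\<alpha> \<in> \<Delta> \<and> wsp \<alpha> \<subseteq> k" using roots_subset subspace_k by blast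
next
  assume "\<alpha> \<in> \<Delta> \<and> wsp \<alpha> \<subseteq> k"
  then show "\<alpha> \<in> \<Delta>k" using weight_space_wsp[of \<alpha> k] by (simp add: roots_iff)
qed

lemma noncompact_root_iff: "\<alpha> \<in> \<Delta> \<Longrightarrow> wsp \<alpha> \<subseteq> p \<longleftrightarrow> \<alpha> \<notin> \<Delta>k"
  using root_space_k_or_p[of \<alpha>] root_vector[of \<alpha>] k_int_p compact_root_iff[of \<alpha>] by blast

sublocale G: compact_roots \<Delta> "coroot B h" h \<Delta>k
proof unfold_locales
  show "\<alpha> \<in> \<Delta>" if "\<alpha> \<in> \<Delta>k" for \<alpha> using that compact_root_iff by blast
next
  fix \<alpha> assume "\<alpha> \<in> \<Delta>k"
  then have \<alpha>: "\<alpha> \<in> \<Delta>" "wsp \<alpha> \<subseteq> k" using compact_root_iff by blast+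
  have m: "- \<alpha> \<in> \<Delta>" using minus_in_\<Delta>[OF \<alpha>(1)] .
  show "- \<alpha> \<in> \<Delta>k"
  proof (rule ccontr)
    \<comment> \<open>Then [e, st e] would lie in both k and p and vanish, although it is a nonzero
      multiple of \<open>tvec \<alpha>\<close>.\<close>
    assume "- \<alpha> \<notin> \<Delta>k"
    then have mp: "wsp (- \<alpha>) \<subseteq> p" using noncompact_root_iff[OF m] by blast
    obtain e where e: "e \<in> wsp \<alpha>" "e \<noteq> 0" using root_vector \<alpha>(1) by blast
    have "B e (st e) \<in> p" using B_k_p \<alpha>(2) mp e(1) wsp_st by blast
    moreover have "B e (st e) \<in> k" using B_e_st_e(1)[OF e(1)] h_subset_k by blast
    ultimately have "B e (st e) = 0" using k_int_p by blast
    then have "tvec \<alpha> = 0" using B_e_st_e_eq[OF \<alpha>(1) e] e(2) by (simp add: nrm_eq_0)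
    then have "\<alpha> (crt \<alpha>) = \<alpha> 0" by (simp add: crt_def)
    moreover have "\<alpha> (0 *s 0) = 0 * \<alpha> 0"
      by (rule dual_apply_scale[OF root_dual[OF \<alpha>(1)] vec.subspace_0[OF h_subspace]])
    ultimately show False using crt_self[OF \<alpha>(1)] by simp
  qed
next
  fix \<alpha> \<beta> assume ab: "\<alpha> \<in> \<Delta>" "\<beta> \<in> \<Delta>" "\<alpha> + \<beta> \<in> \<Delta>"
  obtain e where e: "e \<in> wsp \<alpha>" "e \<noteq> 0" using root_vector[OF ab(1)] by blast
  obtain x where x: "x \<in> wsp \<beta>" "x \<noteq> 0" using root_vector[OF ab(2)] by blast
  let ?z = "B e x"
  have z: "?z \<in> wsp (\<alpha> + \<beta>)" "?z \<noteq> 0" using wsp_B[OF e(1) x(1)] B_root_vectors_nonzero[OF ab e x] by blast+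
  have in_k: "\<gamma> \<in> \<Delta>k" if "\<gamma> \<in> \<Delta>" "u \<in> wsp \<gamma>" "u \<noteq> 0" "u \<in> k" for \<gamma> u
    using noncompact_root_iff[OF that(1)] k_int_p that by blast
  have in_p: "\<gamma> \<notin> \<Delta>k" if "\<gamma> \<in> \<Delta>" "u \<in> wsp \<gamma>" "u \<noteq> 0" "u \<in> p" for \<gamma> u
    using compact_root_iff[of \<gamma>] k_int_p that by blast
  have k_or_p: "u \<in> k \<or> u \<in> p" if "\<gamma> \<in> \<Delta>" "u \<in> wsp \<gamma>" for \<gamma> u using root_space_k_or_p that by blast
  have "?z \<in> k" if "e \<in> k" "x \<in> k" using B_k_k that .
  moreover have "?z \<in> p" if "e \<in> k" "x \<in> p" using B_k_p that .
  moreover have "?z \<in> p" if "e \<in> p" "x \<in> k"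
  proof -
    have "- B x e \<in> p" using B_k_p[OF that(2,1)] vec.subspace_neg[OF subspace_p] by blast
    then show ?thesis using B_skew[of e x] by simp
  qed
  moreover have "?z \<in> k" if "e \<in> p" "x \<in> p" using B_p_p that .
  ultimately show "\<alpha> + \<beta> \<in> \<Delta>k \<longleftrightarrow> (\<alpha> \<in> \<Delta>k \<longleftrightarrow> \<beta> \<in> \<Delta>k)"
    using in_k[OF ab(1) e] in_k[OF ab(2) x] in_k[OF ab(3) z] in_p[OF ab(1) e] in_p[OF ab(2) x] in_p[OF ab(3) z]
      k_or_p[OF ab(1) e(1)] k_or_p[OF ab(2) x(1)] by blast
qed

end

section \<open>Passing between the root combinatorics and the Lie algebra\<close>

lemma positive_system_minus:
  assumes P: "positive_system R P" and \<alpha>: "\<alpha> \<in> R"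
  shows "- \<alpha> \<in> R"
proof -
  have un: "P \<union> uminus ` P = R" using P by (simp add: positive_system_iff)
  show ?thesis
  proof (cases "\<alpha> \<in> P")
    case True
    then have "- \<alpha> \<in> uminus ` P" by (rule imageI)
    then show ?thesis using un by blast
  next
    case False
    then obtain \<beta> where "\<beta> \<in> P" "\<alpha> = - \<beta>" using un \<alpha> by blast
    then show ?thesis using un by auto
  qed
qed

text \<open>Parity and the bound 2 force \<gamma> to have degree 0. Undoing \<open>ws\<close> then
  turns \<gamma> + \<open>lam\<close> into a positive root \<nu> - \<gamma>' with \<gamma>'
  positive, so \<nu> would not be simple.\<close>

lemma (in bds_longest) lam_highest:
  assumes \<gamma>: "\<gamma> \<in> P \<inter> C"
  shows "\<gamma> + lam \<notin> R"
proof
  assume r: "\<gamma> + lam \<in> R"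
  have \<gamma>R: "\<gamma> \<in> R" using \<gamma> pos_root by blast
  have deg: "coef \<Phi> (\<gamma> + lam) \<nu> = coef \<Phi> \<gamma> \<nu> + 1"
    using coef_add[OF lattice_root[OF \<gamma>R] lattice_root[OF lam_root(1)] \<nu>(1)] lam_root(2) by simp
  have "even (coef \<Phi> \<gamma> \<nu>)" using compact_iff_even[OF \<gamma>R] \<gamma> by blast
  moreover have "0 \<le> coef \<Phi> \<gamma> \<nu>" using coef_nonneg \<gamma> \<nu>(1) by blast
  moreover have "coef \<Phi> \<gamma> \<nu> + 1 \<le> 2" using coef_\<nu>_le[OF r] deg by simp
  ultimately have 0: "coef \<Phi> \<gamma> \<nu> = 0" by presburger
  then have "- \<gamma> \<in> uminus ` P0" using \<gamma> by blast
  then have "- \<gamma> \<in> word ws ` P0" unfolding ws_image .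
  then obtain \<gamma>' where \<gamma>': "\<gamma>' \<in> P" "- \<gamma> = word ws \<gamma>'" by blast
  have "\<gamma> = - word ws \<gamma>'" unfolding \<gamma>'(2)[symmetric] by simp
  then have eq: "\<gamma> + lam = word ws (\<nu> - \<gamma>')" by (simp add: word_diff)
  have inv_eq: "word (rev ws) (\<gamma> + lam) = \<nu> - \<gamma>'" unfolding eq by (rule word_rev'[OF ws_R])
  have R: "\<nu> - \<gamma>' \<in> R" using word_root[of "rev ws", OF _ r] ws_R unfolding inv_eq by simp
  have "coef \<Phi> (\<nu> - \<gamma>') \<nu> = 1"
    using word_degree[of "rev ws" "\<gamma> + lam"] ws_roots r deg 0 unfolding inv_eq by simp
  then have "\<nu> - \<gamma>' \<in> P" using pos_if_coef_pos[OF R \<nu>(1)] by simp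
  moreover have "\<nu> = (\<nu> - \<gamma>') + \<gamma>'" by simp
  ultimately show False using \<nu>(1) \<gamma>'(1) unfolding simple_roots_iff by blast
qed

context unitary_lie
begin

lemma reflection_product_dual:
  "set \<alpha>s \<subseteq> \<Delta> \<Longrightarrow> \<mu> \<in> dual_space h \<Longrightarrow> reflection_product B h \<alpha>s \<mu> = R.word \<alpha>s \<mu>"
proof (induction \<alpha>s)
  case Nil
  show ?case by (simp add: reflection_product_def)
next
  case (Cons \<alpha> \<alpha>s)
  have "reflection_product B h (\<alpha> # \<alpha>s) \<mu> = reflection B h \<alpha> (R.word \<alpha>s \<mu>)"
    using Cons by (simp add: reflection_product_def)
  also have "\<dots> = R.word (\<alpha> # \<alpha>s) \<mu>"
    using R.word_dual[of \<alpha>s \<mu>] Cons.prems by (simp add: reflection_def R.refl_def)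
  finally show ?case .
qed

lemma reflection_product_not_dual: "\<mu> \<notin> dual_space h \<Longrightarrow> reflection_product B h \<alpha>s \<mu> = \<mu>"
  by (induction \<alpha>s) (simp_all add: reflection_product_def reflection_def)

lemma reflection_product_eq_iff:
  assumes "set \<alpha>s \<subseteq> \<Delta>" "set \<beta>s \<subseteq> \<Delta>"
  shows "reflection_product B h \<alpha>s = reflection_product B h \<beta>s \<longleftrightarrow>
    (\<forall>\<mu>\<in>dual_space h. R.word \<alpha>s \<mu> = R.word \<beta>s \<mu>)"
proof
  assume eq: "reflection_product B h \<alpha>s = reflection_product B h \<beta>s"
  show "\<forall>\<mu>\<in>dual_space h. R.word \<alpha>s \<mu> = R.word \<beta>s \<mu>"
  proof
    fix \<mu> assume \<mu>: "\<mu> \<in> dual_space h"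
    show "R.word \<alpha>s \<mu> = R.word \<beta>s \<mu>"
      unfolding reflection_product_dual[OF assms(1) \<mu>, symmetric] reflection_product_dual[OF assms(2) \<mu>, symmetric] eq ..
  qed
next
  assume eq: "\<forall>\<mu>\<in>dual_space h. R.word \<alpha>s \<mu> = R.word \<beta>s \<mu>"
  show "reflection_product B h \<alpha>s = reflection_product B h \<beta>s"
  proof
    fix \<mu>
    show "reflection_product B h \<alpha>s \<mu> = reflection_product B h \<beta>s \<mu>"
    proof (cases "\<mu> \<in> dual_space h")
      case True
      then show ?thesis using reflection_product_dual[OF assms(1) True] reflection_product_dual[OF assms(2) True] eq
        by (simp only:)
    next
      case False
      show ?thesis unfolding reflection_product_not_dual[OF False] ..
    qed
  qed
qed

text \<open>On reduced words \<open>weyl_length\<close> is the length of the word, so w is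
  represented by a reduced word of maximal length and \<open>longest_word_image\<close>
  applies.\<close>

lemma longest_element_word:
  assumes "positive_roots R' (coroot B h) h P'" and R': "R' \<subseteq> \<Delta>" and w: "longest_element B h R' P' w"
  obtains ws where "set ws \<subseteq> R'" "R.word ws ` P' = uminus ` P'" "\<And>\<mu>. \<mu> \<in> dual_space h \<Longrightarrow> w \<mu> = R.word ws \<mu>"
proof -
  interpret Z: positive_roots R' "coroot B h" h P' by (rule assms(1))
  have sub: "set \<psi>s \<subseteq> \<Delta>" if "set \<psi>s \<subseteq> simple_roots P'" for \<psi>s
    using that Z.simple_root R' by blast
  have len: "weyl_length B h P' (reflection_product B h \<psi>s) = length \<psi>s" if red: "Z.reduced_word \<psi>s" for \<psi>s
    unfolding weyl_length_def
  proof (rule Least_equality)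
    have s: "set \<psi>s \<subseteq> simple_roots P'" using red by (simp add: Z.reduced_word_def)
    then show "\<exists>\<alpha>s. length \<alpha>s = length \<psi>s \<and> set \<alpha>s \<subseteq> simple_roots P' \<and>
      reflection_product B h \<psi>s = reflection_product B h \<alpha>s" by blast
    fix m assume "\<exists>\<alpha>s. length \<alpha>s = m \<and> set \<alpha>s \<subseteq> simple_roots P' \<and>
      reflection_product B h \<psi>s = reflection_product B h \<alpha>s"
    then obtain \<alpha>s where \<alpha>s: "length \<alpha>s = m" "set \<alpha>s \<subseteq> simple_roots P'"
      "reflection_product B h \<alpha>s = reflection_product B h \<psi>s" by auto
    then have "\<forall>\<mu>\<in>dual_space h. R.word \<alpha>s \<mu> = R.word \<psi>s \<mu>"
      using reflection_product_eq_iff[OF sub[OF \<alpha>s(2)] sub[OF s]] by blast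
    then show "length \<psi>s \<le> m" using red \<alpha>s unfolding Z.reduced_word_def by blast
  qed
  have mem: "reflection_product B h \<psi>s \<in> weyl_group B h R'" if "Z.reduced_word \<psi>s" for \<psi>s
    using that Z.simple_root unfolding weyl_group_def Z.reduced_word_def by blast
  obtain \<alpha>s where \<alpha>s: "set \<alpha>s \<subseteq> R'" "w = reflection_product B h \<alpha>s"
    using w unfolding longest_element_def weyl_group_def by blast
  obtain ws where ws: "Z.reduced_word ws" "\<forall>\<mu>\<in>dual_space h. R.word \<alpha>s \<mu> = R.word ws \<mu>"
    using Z.exists_reduced_word[OF \<alpha>s(1)] .
  have s: "set ws \<subseteq> simple_roots P'" using ws(1) by (simp add: Z.reduced_word_def)
  have \<alpha>s\<Delta>: "set \<alpha>s \<subseteq> \<Delta>" using \<alpha>s(1) R' by blast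
  have w_eq: "w = reflection_product B h ws"
    unfolding \<alpha>s(2) using reflection_product_eq_iff[OF \<alpha>s\<Delta> sub[OF s]] ws(2) by blast
  have "length \<phi>s \<le> length ws" if "Z.reduced_word \<phi>s" for \<phi>s
    using w mem[OF that] len[OF that] len[OF ws(1)] unfolding longest_element_def w_eq by metis
  then have "R.word ws ` P' = uminus ` P'" using Z.longest_word_image[OF ws(1)] by blast
  moreover have "set ws \<subseteq> R'" using s Z.simple_root by blast
  moreover have "w \<mu> = R.word ws \<mu>" if "\<mu> \<in> dual_space h" for \<mu>
    unfolding w_eq using reflection_product_dual[OF sub[OF s] that] .
  ultimately show thesis using that by blast
qed

lemma l_zero_eq: "l_zero B h \<Phi> \<nu> = deg0 (\<lambda>\<alpha>. coef \<Phi> \<alpha> \<nu>)"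
  by (simp add: l_zero_def deg0_def)

end

context cartan_lie
begin

text \<open>The centre is an abelian, hence solvable, ideal.\<close>

lemma semisimple_centre:
  assumes "semisimple B k"
  shows "lie_centre B k = {0}"
proof -
  let ?Z = "lie_centre B k"
  have Z: "x \<in> ?Z \<longleftrightarrow> x \<in> k \<and> (\<forall>y\<in>k. B x y = 0)" for x by (simp add: lie_centre_def)
  have sub: "vec.subspace ?Z"
    by (rule vec.subspaceI) (simp_all add: Z B_add B_scale vec.subspace_0[OF subspace_k]
      vec.subspace_add[OF subspace_k] vec.subspace_scale[OF subspace_k])
  have comm: "B x y = 0" if "x \<in> k" "y \<in> ?Z" for x y using that B_skew[of x y] by (simp add: Z)
  have "lie_ideal B k ?Z"
    unfolding lie_ideal_def using sub comm vec.subspace_0[OF sub] by (simp add: subset_iff Z)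
  moreover have "{B x y |x y. x \<in> ?Z \<and> y \<in> ?Z} \<subseteq> {0}" using comm Z by blast
  then have "vec.span {B x y |x y. x \<in> ?Z \<and> y \<in> ?Z} \<subseteq> {0}"
    by (rule vec.span_minimal) (rule vec.subspace_single_0)
  then have "derived_series B ?Z (Suc 0) = {0}" using vec.span_zero by auto
  then have "solvable B ?Z" unfolding solvable_def by blast
  ultimately show ?thesis using assms unfolding semisimple_def by blast
qed

lemma noncompact_simple_eq:
  assumes "positive_system \<Delta> P"
  shows "{\<alpha> \<in> simple_roots P. wsp \<alpha> \<subseteq> p} = {\<alpha> \<in> simple_roots P. \<alpha> \<notin> \<Delta>k}"
proof -
  interpret P: positive_roots \<Delta> "coroot B h" h P using assms by unfold_locales
  show ?thesis using noncompact_root_iff P.simple_root by blast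
qed

lemma borel_de_siebenthal_iff:
  assumes "semisimple B k"
  shows "borel_de_siebenthal B h k p P \<longleftrightarrow> (\<exists>\<nu> \<delta>. bds_roots \<Delta> (coroot B h) h \<Delta>k P \<nu> \<delta>)"
proof
  assume bds: "borel_de_siebenthal B h k p P"
  then have pos: "positive_system \<Delta> P" by (simp add: borel_de_siebenthal_def)
  interpret P: positive_roots \<Delta> "coroot B h" h P using pos by unfold_locales
  obtain \<nu> \<delta> where d: "{\<alpha> \<in> simple_roots P. wsp \<alpha> \<subseteq> p} = {\<nu>}" "highest_root \<Delta> P \<delta>" "coef (simple_roots P) \<delta> \<nu> = 2"
    using bds assms unfolding borel_de_siebenthal_def by blast
  have "bds_roots \<Delta> (coroot B h) h \<Delta>k P \<nu> \<delta>"
    by unfold_locales (use d noncompact_simple_eq[OF pos] in simp_all)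
  then show "\<exists>\<nu> \<delta>. bds_roots \<Delta> (coroot B h) h \<Delta>k P \<nu> \<delta>" by blast
next
  assume "\<exists>\<nu> \<delta>. bds_roots \<Delta> (coroot B h) h \<Delta>k P \<nu> \<delta>"
  then obtain \<nu> \<delta> where "bds_roots \<Delta> (coroot B h) h \<Delta>k P \<nu> \<delta>" by blast
  then interpret X: bds_roots \<Delta> "coroot B h" h \<Delta>k P \<nu> \<delta> .
  show "borel_de_siebenthal B h k p P"
    unfolding borel_de_siebenthal_def noncompact_simple_eq[OF X.positive]
    using X.positive X.noncompact_simple X.highest X.coef_highest semisimple_centre[OF assms] by blast
qed

text \<open>The first half extracts from given L, Q, V the degree of \<nu>' and its minimality, and
  then uses the constructed positive system. The second half exhibits the parts of degree 0 and 1
  for P' as the required L and V.\<close>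

lemma exchange_theorem:
  assumes ss: "semisimple B k" and Pk: "positive_system \<Delta>k Pk" and bds: "borel_de_siebenthal B h k p P"
    and Pk_P: "Pk \<subseteq> P" and \<nu>: "\<nu> \<in> simple_roots P" "wsp \<nu> \<subseteq> p" and \<delta>: "highest_root \<Delta> P \<delta>"
    and \<Delta>0: "\<Delta>0 = roots B h (l_zero B h (simple_roots P) \<nu>)"
    and w0: "longest_element B h \<Delta>0 (\<Delta>0 \<inter> Pk) w0"
    and \<Phi>k: "\<Phi>k = (simple_roots P - {\<nu>}) \<union> {w0 \<delta>}"
  shows "(\<forall>\<phi> \<nu>'. exchange_data B h k p (simple_roots P) (simple_roots P - {\<nu>}) \<Phi>k \<delta> w0 (w0 \<nu>) \<phi> \<nu>' \<longrightarrow>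
           (\<exists>P'. borel_de_siebenthal B h k p P' \<and> Pk \<subseteq> P' \<and> simple_roots P' = (\<Phi>k - {\<phi>}) \<union> {\<nu>'}))
       \<and> (\<forall>P'. borel_de_siebenthal B h k p P' \<and> Pk \<subseteq> P' \<longrightarrow>
           P' = P \<or>
           (\<exists>\<phi> \<nu>'. exchange_data B h k p (simple_roots P) (simple_roots P - {\<nu>}) \<Phi>k \<delta> w0 (w0 \<nu>) \<phi> \<nu>' \<and>
              simple_roots P' = (\<Phi>k - {\<phi>}) \<union> {\<nu>'}))"
proof -
  obtain \<nu>1 \<delta>1 where bds1: "bds_roots \<Delta> (coroot B h) h \<Delta>k P \<nu>1 \<delta>1"
    using bds borel_de_siebenthal_iff[OF ss] by blast
  have "bds_roots \<Delta> (coroot B h) h \<Delta>k P \<nu> \<delta>"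
  proof -
    interpret X1: bds_roots \<Delta> "coroot B h" h \<Delta>k P \<nu>1 \<delta>1 by (rule bds1)
    have "\<nu> \<in> {\<alpha> \<in> simple_roots P. wsp \<alpha> \<subseteq> p}" using \<nu> by blast
    then have \<nu>_eq: "\<nu> = \<nu>1" unfolding noncompact_simple_eq[OF X1.positive] X1.noncompact_simple by blast
    \<comment> \<open>The definition of a Borel-de Siebenthal system supplies its own highest root;
      maximality on both sides gives \<delta> the same coefficient.\<close>
    have "coef (simple_roots P) \<delta> \<nu> = 2"
    proof (rule antisym)
      show "coef (simple_roots P) \<delta> \<nu> \<le> 2" using X1.coef_\<nu>_le \<delta> \<nu>_eq by (simp add: highest_root_def)
      have "coef (simple_roots P) \<delta>1 \<nu> \<le> coef (simple_roots P) \<delta> \<nu>"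
        using \<delta> X1.highest_root \<nu>(1) by (simp add: highest_root_def)
      then show "2 \<le> coef (simple_roots P) \<delta> \<nu>" using X1.coef_highest \<nu>_eq by simp
    qed
    then show ?thesis
      using \<delta> X1.noncompact_simple \<nu>_eq by unfold_locales simp_all
  qed
  then interpret X: bds_roots \<Delta> "coroot B h" h \<Delta>k P \<nu> \<delta> .
  have Pk_eq: "Pk = P \<inter> \<Delta>k" using X.compact_positive_system_unique[OF Pk Pk_P] .
  have \<Delta>0_eq: "\<Delta>0 = X.R0" unfolding \<Delta>0 l_zero_eq roots_deg0 ..
  have P0_eq: "\<Delta>0 \<inter> Pk = X.P0"
  proof -
    have "\<alpha> \<in> \<Delta> \<and> \<alpha> \<in> \<Delta>k" if "\<alpha> \<in> X.P0" for \<alpha>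
      using that X.pos_root[of \<alpha>] X.compact_iff_even[of \<alpha>] by simp
    then show ?thesis unfolding \<Delta>0_eq Pk_eq by blast
  qed
  obtain ws where ws: "set ws \<subseteq> X.R0" "R.word ws ` X.P0 = uminus ` X.P0"
    "\<And>\<mu>. \<mu> \<in> dual_space h \<Longrightarrow> w0 \<mu> = R.word ws \<mu>"
  proof (rule longest_element_word)
    show "positive_roots X.R0 (coroot B h) h X.P0" by (rule X.Z.positive_roots_axioms)
    show "X.R0 \<subseteq> \<Delta>" by blast
    show "longest_element B h X.R0 X.P0 w0" using w0 unfolding P0_eq unfolding \<Delta>0_eq .
    fix ws assume "set ws \<subseteq> X.R0" "R.word ws ` X.P0 = uminus ` X.P0" "\<And>\<mu>. \<mu> \<in> dual_space h \<Longrightarrow> w0 \<mu> = R.word ws \<mu>"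
    then show thesis by (rule that)
  qed
  interpret Y: bds_longest \<Delta> "coroot B h" h \<Delta>k P \<nu> \<delta> ws
    using ws(1,2) by unfold_locales
  have w0_root: "w0 \<alpha> = R.word ws \<alpha>" if "\<alpha> \<in> \<Delta>" for \<alpha> by (rule ws(3)[OF root_dual[OF that]])
  have lam: "w0 \<nu> = Y.lam" by (rule w0_root[OF X.simple_root[OF X.\<nu>(1)]])
  have \<Phi>k_eq: "\<Phi>k = X.\<Phi>0 \<union> {Y.eps}" unfolding \<Phi>k w0_root[OF X.highest_root] ..
  let ?ex = "exchange_data B h k p (simple_roots P) (simple_roots P - {\<nu>}) \<Phi>k \<delta> w0 (w0 \<nu>)"
  have part1: "\<exists>P'. borel_de_siebenthal B h k p P' \<and> Pk \<subseteq> P' \<and> simple_roots P' = (\<Phi>k - {\<phi>}) \<union> {\<nu>'}"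
    if ex: "?ex \<phi> \<nu>'" for \<phi> \<nu>'
  proof -
    obtain \<phi>' L Q V where \<phi>': "\<phi>' \<in> X.\<Phi>0" "coef (simple_roots P) \<delta> \<phi>' = 1" "\<phi> \<in> X.\<Phi>0" "w0 \<phi>' = - \<phi>"
      and L: "reductive_with_simple_roots B h k (\<Phi>k - {\<phi>}) L Q"
      and V: "irreducible_submodule B L p V" "highest_weight B h L Q V (w0 \<nu>)" "lowest_weight B h L Q V \<nu>'"
      using ex unfolding exchange_data_def neg_eq_uminus by blast
    have "R.word ws \<phi>' = - \<phi>" using \<phi>'(1,4) w0_root X.simple_root by (metis DiffD1)
    then interpret E: bds_exchange \<Delta> "coroot B h" h \<Delta>k P \<nu> \<delta> ws \<phi> \<phi>'
      using \<phi>' by unfold_locales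
    let ?f = "E.degree"
    have f: "grading ?f" by (simp add: grading_def E.degree_add E.degree_minus)
    have Lsub: "subalgebra B L" "h \<subseteq> L" "positive_system (roots B h L) Q" "simple_roots Q = \<Phi>k - {\<phi>}"
      using L by (simp_all add: reductive_with_simple_roots_def)
    have Ls: "vec.subspace L" using Lsub(1) by (simp add: subalgebra_def)
    note Q_minus = positive_system_minus[OF Lsub(3)]
    \<comment> \<open>Symmetry comes from the positive system Q, closedness from the nonvanishing of
      brackets of root vectors.\<close>
    interpret RL: root_system "roots B h L" "coroot B h" h
    proof (rule R.root_system_closed_subset)
      show "roots B h L \<subseteq> \<Delta>" by (rule subsetI) (rule roots_subset[OF _ Ls, THEN conjunct1])
      show "- \<alpha> \<in> roots B h L" if "\<alpha> \<in> roots B h L" for \<alpha> by (rule Q_minus[OF that])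
      show "\<alpha> + \<beta> \<in> roots B h L" if "\<alpha> \<in> roots B h L" "\<beta> \<in> roots B h L" "\<alpha> + \<beta> \<in> \<Delta>" for \<alpha> \<beta>
        by (rule roots_of_subalgebra_closed[OF Lsub(1) that])
    qed
    interpret QL: positive_roots "roots B h L" "coroot B h" h Q
      using Lsub(3) by unfold_locales
    have QL_\<Delta>: "\<alpha> \<in> \<Delta>" if "\<alpha> \<in> Q" for \<alpha> by (rule roots_subset[OF QL.pos_root[OF that] Ls, THEN conjunct1])
    have fQ: "?f \<alpha> = 0" if "\<alpha> \<in> Q" for \<alpha>
      using that
    proof (induction rule: QL.pos_induct)
      case (simple \<psi>)
      then have \<psi>: "\<psi> \<in> \<Phi>k - {\<phi>}" unfolding Lsub(4) .
      then have "?f \<psi> = (if \<psi> = \<phi> then 2 else 0)" unfolding \<Phi>k_eq by (intro E.degree_simple_compact) (rule DiffD1)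
      then show ?case using \<psi> by simp
    next
      case (add \<beta> \<gamma>)
      have "?f (\<beta> + \<gamma>) = ?f \<beta> + ?f \<gamma>" by (rule E.degree_add[OF QL_\<Delta>[OF add(1)] QL_\<Delta>[OF add(2)]])
      then show ?case unfolding add(4,5) by simp
    qed
    have fL: "?f \<alpha> = 0" if \<alpha>: "\<alpha> \<in> roots B h L" for \<alpha>
    proof (cases "\<alpha> \<in> Q")
      case False
      then have "- \<alpha> \<in> Q" using QL.root_cases[OF \<alpha>] by blast
      then have "?f (- \<alpha>) = 0" by (rule fQ)
      then show ?thesis unfolding E.degree_minus[OF roots_subset[OF \<alpha> Ls, THEN conjunct1]] by simp
    qed (rule fQ)
    obtain v where v: "v \<in> weight_space B h V Y.lam" "v \<noteq> 0"
      using V(2) unfolding lam highest_weight_def by blast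
    have V1: "V \<subseteq> deg1 ?f"
      by (rule submodule_subset_deg1[OF f V(1) Lsub(1,2) fL weight_spaceD[OF v(1), THEN conjunct1]
          weight_spaceD[OF v(1), THEN conjunct2] v(2) Y.lam_root(1) E.degree_lam])
    have Qm: "- \<gamma> \<in> roots B h L" if "\<gamma> \<in> Q" for \<gamma> by (rule Q_minus[OF QL.pos_root[OF that]])
    have low: "\<nu>' \<in> \<Delta>" "?f \<nu>' = 1"
      by (rule lowest_weight_deg1(1)[OF V(3) V1 Ls Qm] lowest_weight_deg1(2)[OF V(3) V1 Ls Qm], assumption)+
    have low_Q: "\<nu>' - \<gamma> \<notin> \<Delta>" if "\<gamma> \<in> Q" for \<gamma>
      by (rule lowest_weight_deg1(3)[OF V(3) V1 Ls Qm that])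
    \<comment> \<open>Degrees of compact positive roots are nonnegative, so one of degree 0 is built
      from simple compact roots other than \<phi>; these are simple in Q.\<close>
    have in_Q: "?f \<gamma> = 0 \<longrightarrow> \<gamma> \<in> Q" if "\<gamma> \<in> P \<inter> \<Delta>k" for \<gamma>
      using that
    proof (induction rule: X.K.pos_induct)
      case (simple \<psi>)
      show ?case
      proof
        assume 0: "?f \<psi> = 0"
        have "\<psi> \<in> \<Phi>k" using simple unfolding Y.simple_roots_compact \<Phi>k_eq .
        moreover have "\<psi> \<noteq> \<phi>"
        proof
          assume "\<psi> = \<phi>"
          then have "?f \<psi> = 2" using E.degree_simple_compact[of \<phi>] E.\<phi> by simp
          then show False using 0 by simp
        qed
        ultimately have "\<psi> \<in> simple_roots Q" unfolding Lsub(4) by blast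
        then show "\<psi> \<in> Q" by (rule QL.simple_pos)
      qed
    next
      case (add \<beta> \<gamma>)
      show ?case
      proof
        assume 0: "?f (\<beta> + \<gamma>) = 0"
        have bg: "\<beta> \<in> \<Delta>" "\<gamma> \<in> \<Delta>" "\<beta> + \<gamma> \<in> \<Delta>" using add X.pos_root by blast+
        have "?f \<beta> + ?f \<gamma> = 0" using 0 E.degree_add[OF bg(1,2)] by simp
        then have "?f \<beta> = 0" "?f \<gamma> = 0" using E.degree_nonneg[OF add(1)] E.degree_nonneg[OF add(2)] by linarith+
        then have Q: "\<beta> \<in> Q" "\<gamma> \<in> Q" using add by blast+
        then have "\<beta> + \<gamma> \<in> roots B h L"
          by (intro roots_of_subalgebra_closed[OF Lsub(1) _ _ bg(3)] QL.pos_root)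
        then show "\<beta> + \<gamma> \<in> Q" using QL.pos_add Q by blast
      qed
    qed
    have lowest: "\<nu>' - \<gamma> \<notin> \<Delta>" if "\<gamma> \<in> P \<inter> \<Delta>k" "?f \<gamma> = 0" for \<gamma>
    proof -
      have "\<gamma> \<in> Q" using in_Q[OF that(1)] that(2) by (rule mp)
      then show ?thesis by (rule low_Q)
    qed
    have simple: "simple_roots E.new_positive = (\<Phi>k - {\<phi>}) \<union> {\<nu>'}"
      unfolding \<Phi>k_eq by (rule E.simple_roots_new[OF low]) (rule lowest)
    have "\<exists>\<delta>'. bds_roots \<Delta> (coroot B h) h \<Delta>k E.new_positive \<nu>' \<delta>'"
      by (rule E.bds_roots_new[OF low]) (rule lowest)
    then obtain \<delta>' where d: "bds_roots \<Delta> (coroot B h) h \<Delta>k E.new_positive \<nu>' \<delta>'" by (rule exE)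
    show ?thesis
    proof (rule exI[of _ E.new_positive], rule conjI[OF _ conjI])
      show "borel_de_siebenthal B h k p E.new_positive"
        unfolding borel_de_siebenthal_iff[OF ss] by (rule exI, rule exI, rule d)
      show "Pk \<subseteq> E.new_positive" unfolding Pk_eq by (rule E.compact_pos_new)
      show "simple_roots E.new_positive = (\<Phi>k - {\<phi>}) \<union> {\<nu>'}" by (rule simple)
    qed
  qed
  have part2: "P' = P \<or> (\<exists>\<phi> \<nu>'. ?ex \<phi> \<nu>' \<and> simple_roots P' = (\<Phi>k - {\<phi>}) \<union> {\<nu>'})"
    if P': "borel_de_siebenthal B h k p P'" "Pk \<subseteq> P'" for P'
  proof -
    obtain \<nu>' \<delta>' where N: "bds_roots \<Delta> (coroot B h) h \<Delta>k P' \<nu>' \<delta>'"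
      using P'(1) borel_de_siebenthal_iff[OF ss] by blast
    interpret N: bds_roots \<Delta> "coroot B h" h \<Delta>k P' \<nu>' \<delta>' by (rule N)
    have PC: "P' \<inter> \<Delta>k = P \<inter> \<Delta>k" using N.compact_positive_system_unique[OF Pk P'(2)] Pk_eq by simp
    define f where "f = (\<lambda>\<alpha>. coef (simple_roots P') \<alpha> \<nu>')"
    have f: "grading f"
      by (simp add: grading_def f_def N.coef_add N.coef_minus N.lattice_root N.\<nu>(1))
    have f_even: "even (f \<alpha>) \<longleftrightarrow> wsp \<alpha> \<subseteq> k" if "\<alpha> \<in> \<Delta>" for \<alpha>
      unfolding f_def N.compact_iff_even[OF that, symmetric] compact_root_iff using that by simp
    have f_odd: "odd (f \<alpha>) \<longleftrightarrow> wsp \<alpha> \<subseteq> p" if "\<alpha> \<in> \<Delta>" for \<alpha>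
      unfolding f_def noncompact_root_iff[OF that] N.compact_iff_even[OF that] ..
    have f_\<nu>': "f \<nu>' = 1" "\<nu>' \<in> \<Delta>"
      using N.coef_simple[OF N.\<nu>(1) N.\<nu>(1)] N.simple_root[OF N.\<nu>(1)] by (simp_all add: f_def)
    have "\<exists>\<phi>. ?ex \<phi> \<nu>' \<and> simple_roots P' = (\<Phi>k - {\<phi>}) \<union> {\<nu>'}" if ne: "P' \<noteq> P"
    proof -
      obtain \<phi>' \<phi> where \<phi>: "\<phi>' \<in> X.\<Phi>0" "\<phi> \<in> X.\<Phi>0" "coef (simple_roots P) \<delta> \<phi>' = 1" "R.word ws \<phi>' = - \<phi>"
        and simple: "simple_roots P' - {\<nu>'} = \<Phi>k - {\<phi>}" and f_lam: "f Y.lam = 1"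
        using Y.bds_cases[OF N P'(2)[unfolded Pk_eq]] ne unfolding \<Phi>k_eq f_def by (elim disjE bexE conjE) simp_all
      let ?Q = "{\<alpha> \<in> P'. f \<alpha> = 0}"
      have Q: "?Q = N.P0" by (simp add: f_def)
      have "wsp \<alpha> \<subseteq> k" if "\<alpha> \<in> \<Delta>" "f \<alpha> = 0" for \<alpha> using f_even[OF that(1)] that(2) by simp
      then have gen: "h \<union> (\<Union>\<alpha>\<in>{\<alpha> \<in> \<Delta>. f \<alpha> = 0}. wsp \<alpha>) \<subseteq> k" using h_subset_k by blast
      have "deg0 f \<subseteq> k"
        unfolding deg0_def
        by (rule vec.span_minimal[OF gen subspace_k])
      moreover have "positive_system (roots B h (deg0 f)) ?Q"
        unfolding roots_deg0 unfolding f_def by (rule N.Z.positive)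
      moreover have "simple_roots ?Q = \<Phi>k - {\<phi>}" unfolding Q N.simple_roots_P0 by (rule simple)
      ultimately have red: "reductive_with_simple_roots B h k (\<Phi>k - {\<phi>}) (deg0 f) ?Q"
        unfolding reductive_with_simple_roots_def
        using subalgebra_deg0[OF f] h_deg0 reductive_deg0[OF f] by blast
      have "wsp \<alpha> \<subseteq> p" if "\<alpha> \<in> \<Delta>" "f \<alpha> = 1" for \<alpha> using f_odd[OF that(1)] that(2) by simp
      then have gen1: "(\<Union>\<alpha>\<in>{\<alpha> \<in> \<Delta>. f \<alpha> = 1}. wsp \<alpha>) \<subseteq> p" by blast
      have deg1_p: "deg1 f \<subseteq> p"
        unfolding deg1_def by (rule vec.span_minimal[OF gen1 subspace_p])
      have irr: "irreducible_submodule B (deg0 f) p (deg1 f)"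
      proof (rule irreducible_deg1[OF f deg1_p f_\<nu>'(2,1)])
        fix S assume S: "S \<noteq> {}" "S \<subseteq> {\<beta> \<in> \<Delta>. f \<beta> = 1}"
          "\<And>\<beta> \<gamma>. \<beta> \<in> S \<Longrightarrow> \<gamma> \<in> \<Delta> \<Longrightarrow> f \<gamma> = 0 \<Longrightarrow> \<gamma> + \<beta> \<in> \<Delta> \<Longrightarrow> \<gamma> + \<beta> \<in> S"
        have pos: "\<beta> \<in> P'" if "\<beta> \<in> \<Delta>" "f \<beta> = 1" for \<beta>
          using N.pos_if_coef_pos[OF that(1) N.\<nu>(1)] that(2) by (simp add: f_def)
        \<comment> \<open>Roots of degree 0 come with their opposites, so the closure property of S
          can be reversed.\<close>
        have step: "\<beta> + \<gamma> \<in> S \<longleftrightarrow> \<beta> \<in> S" if bg: "\<beta> \<in> \<Delta>" "\<gamma> \<in> \<Delta>" "\<beta> + \<gamma> \<in> \<Delta>" "f \<gamma> = 0" for \<beta> \<gamma>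
        proof
          assume "\<beta> \<in> S"
          then have "\<gamma> + \<beta> \<in> S" using S(3)[OF _ bg(2,4)] bg(3) by (simp add: add.commute)
          then show "\<beta> + \<gamma> \<in> S" by (simp add: add.commute)
        next
          assume "\<beta> + \<gamma> \<in> S"
          moreover have "- \<gamma> \<in> \<Delta>" "f (- \<gamma>) = 0" using minus_in_\<Delta>[OF bg(2)] grading_minus[OF f bg(2)] bg(4) by simp_all
          moreover have eq: "- \<gamma> + (\<beta> + \<gamma>) = \<beta>" by simp
          ultimately show "\<beta> \<in> S" using S(3)[of "\<beta> + \<gamma>" "- \<gamma>"] bg(1) unfolding eq by blast
        qed
        \<comment> \<open>When a root of degree 1 is built from simple roots, exactly one summand
          has degree 1, namely \<nu>'; by \<open>step\<close> the others do not affect membership in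
          S. So S contains all roots of degree 1 or none.\<close>
        have all: "f \<beta> = 1 \<longrightarrow> (\<beta> \<in> S \<longleftrightarrow> \<nu>' \<in> S)" if "\<beta> \<in> P'" for \<beta>
          using that
        proof (induction rule: N.pos_induct)
          case (simple \<psi>)
          then show ?case using N.coef_simple[OF simple N.\<nu>(1)] by (auto simp: f_def)
        next
          case (add \<beta> \<gamma>)
          show ?case
          proof
            assume 1: "f (\<beta> + \<gamma>) = 1"
            have bg: "\<beta> \<in> \<Delta>" "\<gamma> \<in> \<Delta>" "\<beta> + \<gamma> \<in> \<Delta>" using add N.pos_root by blast+
            have cb: "\<gamma> + \<beta> = \<beta> + \<gamma>" by (rule add.commute)
            have "f \<beta> + f \<gamma> = 1" using 1 grading_add[OF f bg] by simp
            moreover have "0 \<le> f \<beta>" "0 \<le> f \<gamma>"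
              unfolding f_def using N.coef_nonneg[OF add(1) N.\<nu>(1)] N.coef_nonneg[OF add(2) N.\<nu>(1)] by simp_all
            ultimately consider "f \<beta> = 1" "f \<gamma> = 0" | "f \<beta> = 0" "f \<gamma> = 1" by linarith
            then show "\<beta> + \<gamma> \<in> S \<longleftrightarrow> \<nu>' \<in> S"
            proof cases
              case 1
              then show ?thesis using add step[OF bg] by blast
            next
              case 2
              then show ?thesis using add step[OF bg(2,1), unfolded cb, OF bg(3)] by blast
            qed
          qed
        qed
        obtain \<beta>0 where \<beta>0: "\<beta>0 \<in> S" using S(1) by blast
        then have "\<nu>' \<in> S" using all[OF pos] S(2) by blast
        then show "{\<beta> \<in> \<Delta>. f \<beta> = 1} \<subseteq> S" using all[OF pos] by blast
      qed
      have Q_compact: "\<gamma> \<in> P \<inter> \<Delta>k" if "\<gamma> \<in> ?Q" for \<gamma>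
      proof -
        have \<gamma>: "\<gamma> \<in> P'" "f \<gamma> = 0" using that by simp_all
        then have "\<gamma> \<in> \<Delta>k" using N.compact_iff_even[OF N.pos_root[OF \<gamma>(1)]] by (simp add: f_def)
        then have "\<gamma> \<in> P' \<inter> \<Delta>k" using \<gamma>(1) by blast
        then show ?thesis unfolding PC .
      qed
      have hw: "highest_weight B h (deg0 f) ?Q (deg1 f) (w0 \<nu>)"
        unfolding lam
      proof (rule highest_weight_deg1[OF f Y.lam_root(1) f_lam])
        fix \<gamma> assume \<gamma>: "\<gamma> \<in> ?Q"
        then have "\<gamma> \<in> P'" "f \<gamma> = 0" by simp_all
        then show "\<gamma> \<in> \<Delta> \<and> f \<gamma> = 0 \<and> \<gamma> + Y.lam \<notin> \<Delta>"
          by (intro conjI N.pos_root Y.lam_highest Q_compact \<gamma>)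
      qed
      have lw: "lowest_weight B h (deg0 f) ?Q (deg1 f) \<nu>'"
        unfolding lowest_weight_def neg_eq_uminus
      proof (rule highest_weight_deg1[OF f f_\<nu>'(2,1)])
        fix \<gamma> assume "\<gamma> \<in> uminus ` ?Q"
        then obtain q where q: "q \<in> P'" "f q = 0" "\<gamma> = - q" by blast
        have q\<Delta>: "q \<in> \<Delta>" using N.pos_root[OF q(1)] .
        have "\<gamma> + \<nu>' \<notin> \<Delta>"
        proof
          assume r: "\<gamma> + \<nu>' \<in> \<Delta>"
          have g: "\<gamma> \<in> \<Delta>" "f \<gamma> = 0" using minus_in_\<Delta>[OF q\<Delta>] grading_minus[OF f q\<Delta>] q by simp_all
          have "f (\<gamma> + \<nu>') = 1" using grading_add[OF f g(1) f_\<nu>'(2) r] g(2) f_\<nu>'(1) by simp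
          then have "\<gamma> + \<nu>' \<in> P'" using N.pos_if_coef_pos[OF r N.\<nu>(1)] by (simp add: f_def)
          moreover have "\<nu>' = (\<gamma> + \<nu>') + q" by (simp add: q(3))
          ultimately show False using N.\<nu>(1) q(1) unfolding simple_roots_iff by blast
        qed
        then show "\<gamma> \<in> \<Delta> \<and> f \<gamma> = 0 \<and> \<gamma> + \<nu>' \<notin> \<Delta>"
          using minus_in_\<Delta>[OF q\<Delta>] grading_minus[OF f q\<Delta>] q by simp
      qed
      have "w0 \<phi>' = neg \<phi>" using \<phi>(1,4) w0_root X.simple_root unfolding neg_eq_uminus by (metis DiffD1)
      then have "?ex \<phi> \<nu>'"
        unfolding exchange_data_def
        by (intro bexI[of _ \<phi>'] conjI exI[of _ "deg0 f"] exI[of _ ?Q] exI[of _ "deg1 f"] \<phi> red irr hw lw)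
      moreover have "simple_roots P' = (\<Phi>k - {\<phi>}) \<union> {\<nu>'}" using simple N.\<nu>(1) by blast
      ultimately show ?thesis by blast
    qed
    then show ?thesis by blast
  qed
  show ?thesis
  proof (intro conjI allI impI)
    fix \<phi> \<nu>' assume "?ex \<phi> \<nu>'"
    then show "\<exists>P'. borel_de_siebenthal B h k p P' \<and> Pk \<subseteq> P' \<and> simple_roots P' = (\<Phi>k - {\<phi>}) \<union> {\<nu>'}"
      by (rule part1)
  next
    fix P' assume "borel_de_siebenthal B h k p P' \<and> Pk \<subseteq> P'"
    then show "P' = P \<or> (\<exists>\<phi> \<nu>'. ?ex \<phi> \<nu>' \<and> simple_roots P' = (\<Phi>k - {\<phi>}) \<union> {\<nu>'})"
      by (elim conjE) (rule part2)
  qed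
qed

end

section \<open>Complexification of a Cartan decomposition\<close>

lemma complexify_iff: "z \<in> complexify S \<longleftrightarrow> Re_vec z \<in> S \<and> Im_vec z \<in> S"
  by (simp add: complexify_def)

definition complex_vec :: "real^'n \<Rightarrow> real^'n \<Rightarrow> complex^'n" where
  "complex_vec x y = (\<chi> i. Complex (x $ i) (y $ i))"

lemma Re_complex_vec [simp]: "Re_vec (complex_vec x y) = x"
  and Im_complex_vec [simp]: "Im_vec (complex_vec x y) = y"
  by (simp_all add: complex_vec_def Re_vec_def Im_vec_def)

lemma complex_vec_eq_iff: "z = w \<longleftrightarrow> Re_vec z = Re_vec w \<and> Im_vec z = Im_vec w"
  by (auto simp: vec_eq_iff Re_vec_def Im_vec_def complex_eq_iff)

lemma Re_vec_add [simp]: "Re_vec (z + w) = Re_vec z + Re_vec w"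
  and Im_vec_add [simp]: "Im_vec (z + w) = Im_vec z + Im_vec w"
  and Re_vec_zero [simp]: "Re_vec 0 = 0"
  and Im_vec_zero [simp]: "Im_vec 0 = 0"
  and Re_vec_scale [simp]: "Re_vec (c *s z) = Re c *\<^sub>R Re_vec z - Im c *\<^sub>R Im_vec z"
  and Im_vec_scale [simp]: "Im_vec (c *s z) = Re c *\<^sub>R Im_vec z + Im c *\<^sub>R Re_vec z"
  and Re_vec_cbr [simp]: "Re_vec (cbr br z w) = br (Re_vec z) (Re_vec w) - br (Im_vec z) (Im_vec w)"
  and Im_vec_cbr [simp]: "Im_vec (cbr br z w) = br (Re_vec z) (Im_vec w) + br (Im_vec z) (Re_vec w)"
  by (simp_all add: vec_eq_iff Re_vec_def Im_vec_def cbr_def)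

lemma subspace_complexify: "subspace S \<Longrightarrow> vec.subspace (complexify S)"
  by (rule vec.subspaceI)
    (simp_all add: complexify_iff subspace_0 subspace_add subspace_diff subspace_scale)

section \<open>The real Lie algebra and its Cartan involution\<close>

locale real_cartan =
  fixes br :: "real^'n \<Rightarrow> real^'n \<Rightarrow> real^'n" and \<theta> :: "real^'n \<Rightarrow> real^'n"
    and t0 :: "(real^'n) set" and r :: nat
  assumes lie: "lie_bracket br" and involution: "cartan_involution br \<theta>"
    and rank: "has_rank br UNIV r" and rank_k: "has_rank br {x. \<theta> x = x} r"
    and maximal: "maximal_abelian_in br {x. \<theta> x = x} t0"
begin

lemma br_bilinear: "bilinear br"
  using lie by (simp add: lie_bracket_def)

lemma linear_br: "linear (br x)" and linear_br_left: "linear (\<lambda>x. br x y)"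
  using br_bilinear by (simp_all add: bilinear_def)

lemmas br_simps = bilinear_ladd[OF br_bilinear] bilinear_radd[OF br_bilinear]
  bilinear_lmul[OF br_bilinear] bilinear_rmul[OF br_bilinear] bilinear_lneg[OF br_bilinear]
  bilinear_rneg[OF br_bilinear] bilinear_lsub[OF br_bilinear] bilinear_rsub[OF br_bilinear]
  bilinear_lzero[OF br_bilinear] bilinear_rzero[OF br_bilinear]

lemma br_self: "br x x = 0"
  using lie by (simp add: lie_bracket_def)

lemma br_skew: "br x y = - br y x"
proof -
  have "br x y + br y x = br (x + y) (x + y)"
    unfolding bilinear_ladd[OF br_bilinear] bilinear_radd[OF br_bilinear] by (simp add: br_self)
  then show ?thesis by (simp add: br_self eq_neg_iff_add_eq_0)
qed

lemma br_jacobi: "br x (br y z) = br (br x y) z + br y (br x z)"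
proof -
  have "br x (br y z) + br y (br z x) + br z (br x y) = 0"
    using lie by (simp add: lie_bracket_def)
  moreover have "br y (br z x) = - br y (br x z)" using br_skew[of z x] by (simp add: br_simps)
  moreover have "br z (br x y) = - br (br x y) z" by (rule br_skew)
  ultimately show ?thesis by (simp add: algebra_simps)
qed

lemma linear_\<theta>: "linear \<theta>" and \<theta>_\<theta>: "\<theta> (\<theta> x) = x" and \<theta>_br: "\<theta> (br x y) = br (\<theta> x) (\<theta> y)"
  using involution by (simp_all add: cartan_involution_def)

lemmas \<theta>_simps = linear_add[OF linear_\<theta>] linear_diff[OF linear_\<theta>] linear_neg[OF linear_\<theta>]
  linear_scale[OF linear_\<theta>] linear_0[OF linear_\<theta>]

lemma matrix_apply: "linear f \<Longrightarrow> matrix f *v x = f x" for f :: "real^'n \<Rightarrow> real^'n"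
  by (rule matrix_works) (simp add: linear_matrix_vector_mul_eq)

definition ad :: "real^'n \<Rightarrow> real^'n^'n" where
  "ad x = matrix (br x)"

lemma killing_ad: "killing_form br x y = trace (ad x ** ad y)"
proof -
  have "matrix (br x \<circ> br y) = ad x ** ad y"
    unfolding ad_def by (rule matrix_compose[OF linear_br linear_br])
  then show ?thesis by (simp add: killing_form_def comp_def)
qed

lemma ad_add: "ad (x + y) = ad x + ad y"
  and ad_scale: "ad (c *\<^sub>R x) = c *\<^sub>R ad x"
  by (simp_all add: ad_def matrix_def vec_eq_iff br_simps)

lemma ad_br: "ad (br x y) = ad x ** ad y - ad y ** ad x"
proof -
  have "ad (br x y) *v z = (ad x ** ad y - ad y ** ad x) *v z" for z
    by (simp add: ad_def matrix_apply[OF linear_br] matrix_vector_mul_assoc[symmetric]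
      matrix_vector_mult_diff_rdistrib br_jacobi[of x y z])
  then show ?thesis by (simp add: matrix_eq)
qed

lemma trace_rotate: "trace (A ** (C ** D)) = trace (C ** (D ** A))" for A C D :: "real^'n^'n"
  using trace_mul_sym[of A "C ** D"] by (simp add: matrix_mul_assoc)

lemma killing_invariant: "killing_form br (br x y) z = killing_form br x (br y z)"
proof -
  have l: "(A - C) ** D = A ** D - C ** D" and r: "D ** (A - C) = D ** A - D ** C" for A C D :: "real^'n^'n"
    by (simp_all add: vec_eq_iff matrix_matrix_mult_def algebra_simps sum_subtractf)
  have "trace (ad y ** (ad x ** ad z)) = trace (ad x ** (ad z ** ad y))" by (rule trace_rotate)
  then show ?thesis by (simp add: killing_ad ad_br l r trace_sub matrix_mul_assoc[symmetric])
qed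

text \<open>The matrix of \<theta> is its own inverse and conjugates \<open>ad x\<close> into
  \<open>ad (\<theta> x)\<close>; the trace is invariant under conjugation.\<close>

lemma killing_\<theta>: "killing_form br (\<theta> x) (\<theta> y) = killing_form br x y"
proof -
  let ?T = "matrix \<theta>"
  have TT: "?T ** (?T ** A) = A" for A :: "real^'n^'n"
  proof -
    have "?T ** ?T = matrix (\<theta> \<circ> \<theta>)" by (rule matrix_compose[OF linear_\<theta> linear_\<theta>, symmetric])
    also have "\<theta> \<circ> \<theta> = id" by (simp add: fun_eq_iff \<theta>_\<theta>)
    finally have "?T ** ?T = mat 1" unfolding matrix_id_mat_1 .
    then show ?thesis by (simp add: matrix_mul_assoc)
  qed
  have ad: "ad (\<theta> x) = ?T ** (ad x ** ?T)" for x
  proof -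
    have "ad (\<theta> x) *v z = (?T ** (ad x ** ?T)) *v z" for z
      by (simp add: ad_def matrix_apply[OF linear_br] matrix_apply[OF linear_\<theta>]
        matrix_vector_mul_assoc[symmetric] \<theta>_br \<theta>_\<theta>)
    then show ?thesis by (simp add: matrix_eq)
  qed
  have "ad (\<theta> x) ** ad (\<theta> y) = ?T ** ((ad x ** ad y) ** ?T)"
    unfolding ad by (simp add: matrix_mul_assoc[symmetric] TT)
  then have "killing_form br (\<theta> x) (\<theta> y) = trace (?T ** ((ad x ** ad y) ** ?T))" by (simp only: killing_ad)
  also have "\<dots> = trace ((ad x ** ad y) ** (?T ** ?T))" by (rule trace_rotate)
  also have "\<dots> = trace (?T ** (?T ** (ad x ** ad y)))" by (metis trace_rotate)
  finally show ?thesis by (simp only: TT killing_ad)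
qed

definition rip :: "real^'n \<Rightarrow> real^'n \<Rightarrow> real" where
  "rip x y = - killing_form br x (\<theta> y)"

lemma rip_pos: "x \<noteq> 0 \<Longrightarrow> rip x x > 0"
  using involution by (simp add: cartan_involution_def rip_def)

lemma rip_commute: "rip x y = rip y x"
  using killing_\<theta>[of x "\<theta> y"] trace_mul_sym[of "ad (\<theta> x)" "ad y"]
  by (simp add: rip_def \<theta>_\<theta> killing_ad)

lemma rip_add: "rip (x + y) z = rip x z + rip y z"
  and rip_scale: "rip (c *\<^sub>R x) z = c * rip x z"
proof -
  have "(ad x + ad y) ** D = ad x ** D + ad y ** D" for D :: "real^'n^'n"
    by (simp add: vec_eq_iff matrix_matrix_mult_def algebra_simps sum.distrib)
  then show "rip (x + y) z = rip x z + rip y z"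
    by (simp add: rip_def killing_ad ad_add trace_add)
  have "(c *\<^sub>R ad x) ** D = c *\<^sub>R (ad x ** D)" for D :: "real^'n^'n"
    by (simp add: vec_eq_iff matrix_matrix_mult_def sum_distrib_left mult.assoc)
  then show "rip (c *\<^sub>R x) z = c * rip x z"
    by (simp add: rip_def killing_ad ad_scale trace_def sum_distrib_left)
qed

lemma rip_add_right: "rip z (x + y) = rip z x + rip z y"
  and rip_scale_right: "rip z (c *\<^sub>R x) = c * rip z x"
  using rip_add rip_scale rip_commute by metis+

lemma rip_minus: "rip (- x) y = - rip x y" and rip_minus_right: "rip x (- y) = - rip x y"
  using rip_scale[of "-1" x y] rip_scale_right[of x "-1" y] by simp_all

lemma rip_diff: "rip (x - y) z = rip x z - rip y z"
  using rip_add[of x "- y" z] by (simp add: rip_minus)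

lemma rip_diff_right: "rip z (x - y) = rip z x - rip z y"
  using rip_add_right[of z x "- y"] by (simp add: rip_minus_right)

lemma rip_zero [simp]: "rip 0 x = 0" "rip x 0 = 0"
  using rip_scale[of 0 0 x] rip_scale_right[of x 0 0] by simp_all

lemma rip_br: "rip (br x y) z = - rip y (br (\<theta> x) z)"
proof -
  have neg: "killing_form br (- x) y = - killing_form br x y" for x y
    using ad_scale[of "-1" x] by (simp add: killing_ad trace_def matrix_matrix_mult_def sum_negf)
  have "rip (br x y) z = - killing_form br (- br y x) (\<theta> z)" unfolding rip_def br_skew[of x y] ..
  also have "\<dots> = killing_form br y (br x (\<theta> z))" by (simp add: neg killing_invariant)
  also have "br x (\<theta> z) = \<theta> (br (\<theta> x) z)" by (simp add: \<theta>_br \<theta>_\<theta>)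
  finally show ?thesis by (simp add: rip_def)
qed

section \<open>Equal rank: \<open>t0\<close> is its own centraliser\<close>

abbreviation k0 where "k0 \<equiv> {x. \<theta> x = x}"
abbreviation p0 where "p0 \<equiv> {x. \<theta> x = - x}"

lemma subspace_k0: "subspace k0" and subspace_p0: "subspace p0"
  by (simp_all add: subspace_def \<theta>_simps)

lemma t0: "subspace t0" "t0 \<subseteq> k0" "x \<in> t0 \<Longrightarrow> y \<in> t0 \<Longrightarrow> br x y = 0"
  using maximal by (auto simp: maximal_abelian_in_def)

lemma abelian_span_insert:
  assumes S: "subspace S" "S \<subseteq> W" "\<And>x y. x \<in> S \<Longrightarrow> y \<in> S \<Longrightarrow> br x y = 0"
    and W: "subspace W" and u: "u \<in> W" "\<And>x. x \<in> S \<Longrightarrow> br x u = 0"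
  shows "span (insert u S) \<subseteq> W" "x \<in> span (insert u S) \<Longrightarrow> y \<in> span (insert u S) \<Longrightarrow> br x y = 0"
proof -
  show "span (insert u S) \<subseteq> W" using S u W by (intro span_minimal) auto
  assume "x \<in> span (insert u S)" "y \<in> span (insert u S)"
  then obtain a b where "x - a *\<^sub>R u \<in> span S" "y - b *\<^sub>R u \<in> span S" by (auto simp: span_breakdown_eq)
  moreover have "span S = S" using S(1) by (simp add: span_eq_iff)
  ultimately have xy: "x - a *\<^sub>R u \<in> S" "y - b *\<^sub>R u \<in> S" by simp_all
  define s t where "s = x - a *\<^sub>R u" and "t = y - b *\<^sub>R u"
  have st: "x = s + a *\<^sub>R u" "y = t + b *\<^sub>R u" "s \<in> S" "t \<in> S" using xy by (simp_all add: s_def t_def)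
  have "br u t = 0" using u(2)[OF st(4)] br_skew[of u t] by simp
  then show "br x y = 0"
    using S(3)[OF st(3,4)] u(2)[OF st(3)] unfolding st(1,2) by (simp add: br_simps br_self)
qed

lemma t0_maximal:
  assumes "x \<in> k0" "\<And>t. t \<in> t0 \<Longrightarrow> br t x = 0"
  shows "x \<in> t0"
proof -
  have s: "span (insert x t0) \<subseteq> k0" "\<And>u v. u \<in> span (insert x t0) \<Longrightarrow> v \<in> span (insert x t0) \<Longrightarrow> br u v = 0"
    using abelian_span_insert[OF t0 subspace_k0 assms] by blast+
  have "t0 \<subseteq> span (insert x t0)" using span_superset by blast
  then have "span (insert x t0) = t0"
    using maximal s subspace_span unfolding maximal_abelian_in_def by blast
  then show ?thesis using span_superset[of "insert x t0"] by blast
qed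

text \<open>The lower central series of an abelian subspace stops after one step, so only
  self-normalisation is left to check.\<close>

lemma cartan_subalgebra_abelian:
  assumes H: "subspace H" "H \<subseteq> L" "\<And>x y. x \<in> H \<Longrightarrow> y \<in> H \<Longrightarrow> br x y = 0"
    and norm: "\<And>x. x \<in> L \<Longrightarrow> (\<And>y. y \<in> H \<Longrightarrow> br x y \<in> H) \<Longrightarrow> x \<in> H"
  shows "cartan_subalgebra br L H"
proof -
  have "{br x y |x y. x \<in> H \<and> y \<in> lower_central br H 0} \<subseteq> {0}" using H(3) by auto
  then have "lower_central br H (Suc 0) \<subseteq> {0}"
    unfolding lower_central.simps(2) by (rule span_minimal) (rule subspace_single_0)
  moreover have "0 \<in> lower_central br H (Suc 0)" by (simp add: span_zero)
  ultimately have "lower_central br H (Suc 0) = {0}" by blast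
  show ?thesis
    unfolding cartan_subalgebra_def
  proof (intro conjI ballI impI)
    show "\<exists>i. lower_central br H i = {0}" using \<open>lower_central br H (Suc 0) = {0}\<close> by (rule exI)
    show "br x y \<in> H" if "x \<in> H" "y \<in> H" for x y using H(3)[OF that] subspace_0[OF H(1)] by simp
    show "x \<in> H" if "x \<in> L" "\<forall>y\<in>H. br x y \<in> H" for x using norm that by blast
  qed (use H in auto)
qed

text \<open>For y in k0 or p0, \<open>ad y\<close> is skew or symmetric up to its sign under
  \<theta>, so the squared norm of [x, y] is, up to sign, the product of x with [y, [x, y]].\<close>

lemma normaliser_centralises:
  assumes "\<theta> y = y \<or> \<theta> y = - y" "br y (br x y) = 0"
  shows "br x y = 0"
proof (rule ccontr)
  assume "br x y \<noteq> 0"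
  then have "rip (br x y) (br x y) > 0" by (rule rip_pos)
  moreover have "rip (br x y) (br x y) = rip x (br (\<theta> y) (br x y))"
    using rip_br[of y x "br x y"] br_skew[of x y] by (simp add: rip_minus)
  moreover have "br (\<theta> y) (br x y) = 0" using assms by (auto simp: br_simps)
  ultimately show False by simp
qed

lemma cartan_t0: "cartan_subalgebra br k0 t0"
proof (rule cartan_subalgebra_abelian[OF t0])
  fix x assume x: "x \<in> k0" "\<And>y. y \<in> t0 \<Longrightarrow> br x y \<in> t0"
  have "br y x = 0" if y: "y \<in> t0" for y
  proof -
    have "br x y = 0" using normaliser_centralises[of y x] t0(2) t0(3)[OF y x(2)[OF y]] y by blast
    then show ?thesis using br_skew[of y x] by simp
  qed
  then show "x \<in> t0" by (rule t0_maximal[OF x(1)])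
qed

definition kpart where "kpart x = (1/2) *\<^sub>R (x + \<theta> x)"
definition ppart where "ppart x = (1/2) *\<^sub>R (x - \<theta> x)"

lemma parts: "kpart x \<in> k0" "ppart x \<in> p0" "x = kpart x + ppart x"
proof -
  show "kpart x \<in> k0" by (simp add: kpart_def \<theta>_simps \<theta>_\<theta> add.commute)
  show "ppart x \<in> p0" by (simp add: ppart_def \<theta>_simps \<theta>_\<theta> scaleR_right_diff_distrib)
  have "kpart x + ppart x = (1/2) *\<^sub>R (2 *\<^sub>R x)"
    unfolding kpart_def ppart_def scaleR_add_right[symmetric] by (simp add: scaleR_2)
  then show "x = kpart x + ppart x" by simp
qed

lemma parts_centralise: "\<theta> t = t \<Longrightarrow> br t x = 0 \<Longrightarrow> br t (kpart x) = 0 \<and> br t (ppart x) = 0"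
  using \<theta>_br[of t x] by (simp add: kpart_def ppart_def br_simps \<theta>_simps)

text \<open>If \<open>a\<close> is a maximal abelian subspace of the centraliser of \<open>t0\<close> in \<open>p0\<close>, then \<open>t0 + a\<close> is a Cartan
  subalgebra, so equality of ranks forces \<open>a = 0\<close>.\<close>

lemma p0_centraliser_trivial:
  assumes "x \<in> p0" "\<And>t. t \<in> t0 \<Longrightarrow> br t x = 0"
  shows "x = 0"
proof -
  define W where "W = {x \<in> p0. \<forall>t\<in>t0. br t x = 0}"
  have W: "subspace W" using subspace_p0 by (simp add: W_def subspace_def br_simps)
  define A where "A = (\<lambda>a. subspace a \<and> a \<subseteq> W \<and> (\<forall>x\<in>a. \<forall>y\<in>a. br x y = 0))"
  have "A {0}" using subspace_0[OF W] by (simp add: A_def br_simps)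
  moreover have "\<forall>a. A a \<longrightarrow> dim a < Suc DIM(real^'n)" using dim_subset_UNIV le_imp_less_Suc by blast
  ultimately have "\<exists>a. A a \<and> (\<forall>b. A b \<longrightarrow> dim b \<le> dim a)" by (rule Lattices_Big.ex_has_greatest_nat)
  then obtain a where a_A: "A a" and greatest: "\<And>b. A b \<Longrightarrow> dim b \<le> dim a" by blast
  have a: "subspace a" "a \<subseteq> W" "\<And>x y. x \<in> a \<Longrightarrow> y \<in> a \<Longrightarrow> br x y = 0" using a_A by (simp_all add: A_def)
  have a_max: "u \<in> a" if u: "u \<in> W" "\<And>s. s \<in> a \<Longrightarrow> br s u = 0" for u
  proof -
    have "A (span (insert u a))"
      unfolding A_def using abelian_span_insert[OF a W u] by (intro conjI subspace_span ballI)
    then have "dim (span (insert u a)) \<le> dim a" by (rule greatest)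
    moreover have "a \<subseteq> span (insert u a)" using span_superset by blast
    ultimately have "a = span (insert u a)" using a(1) by (intro subspace_dim_equal) (simp_all add: subspace_span)
    then show ?thesis using span_superset[of "insert u a"] by blast
  qed
  define H where "H = {t + s |t s. t \<in> t0 \<and> s \<in> a}"
  have memH: "t + s \<in> H" if "t \<in> t0" "s \<in> a" for t s using that unfolding H_def by blast
  have mem: "t \<in> H" if "t \<in> t0" for t
    using memH[OF that subspace_0[OF a(1)]] by simp
  have mem': "s \<in> H" if "s \<in> a" for s
    using memH[OF subspace_0[OF t0(1)] that] by simp
  have ta: "br t s = 0" "br s t = 0" if "t \<in> t0" "s \<in> a" for t s
  proof -
    show "br t s = 0" using that a(2) by (auto simp: W_def)
    then show "br s t = 0" using br_skew[of s t] by simp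
  qed
  have H_abelian: "br x y = 0" if x: "x \<in> H" and y: "y \<in> H" for x y
  proof -
    obtain t s t' s' where "x = t + s" "t \<in> t0" "s \<in> a" "y = t' + s'" "t' \<in> t0" "s' \<in> a"
      using x y unfolding H_def by blast
    then show ?thesis by (simp add: br_simps ta t0(3) a(3))
  qed
  have H: "subspace H" unfolding H_def using t0(1) a(1) by (rule subspace_sums)
  have "cartan_subalgebra br UNIV H"
  proof (rule cartan_subalgebra_abelian[OF H _ H_abelian])
    fix x assume x: "\<And>y. y \<in> H \<Longrightarrow> br x y \<in> H"
    \<comment> \<open>Elements of \<open>t0\<close> and of a are eigenvectors of \<theta>, so a
      normalising x centralises both; its two parts are then caught by the maximality of
      \<open>t0\<close> and of a.\<close>
    have cen: "br y x = 0" if y: "y \<in> H" "\<theta> y = y \<or> \<theta> y = - y" for y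
      using normaliser_centralises[OF y(2) H_abelian[OF y(1) x[OF y(1)]]] br_skew[of y x] by simp
    have t: "br t (kpart x) = 0" "br t (ppart x) = 0" if "t \<in> t0" for t
      using parts_centralise[OF _ cen[OF mem[OF that]]] t0(2) that by auto
    have k: "kpart x \<in> t0" by (rule t0_maximal[OF parts(1) t(1)])
    have p: "ppart x \<in> a"
    proof (rule a_max)
      show "ppart x \<in> W" using parts(2) t(2) by (simp add: W_def)
      fix s assume s: "s \<in> a"
      have "\<theta> s = - s" using s a(2) by (auto simp: W_def)
      then have "br s x = 0" using cen[OF mem'[OF s]] by blast
      then have "br s (kpart x) + br s (ppart x) = 0"
        using parts(3)[of x] bilinear_radd[OF br_bilinear, of s "kpart x" "ppart x"] by simp
      then show "br s (ppart x) = 0" using ta(2)[OF k s] by simp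
    qed
    show "x \<in> H" using memH[OF k p] parts(3)[of x] by simp
  qed simp
  then have "dim H = r" using rank by (simp add: has_rank_def)
  moreover have "dim t0 = r" using rank_k cartan_t0 by (simp add: has_rank_def)
  moreover have "t0 \<subseteq> H" using mem by blast
  ultimately have "t0 = H" using H t0(1) by (intro subspace_dim_equal) simp_all
  have "a \<subseteq> {0}"
  proof
    fix s assume s: "s \<in> a"
    then have "\<theta> s = s" using mem' \<open>t0 = H\<close> t0(2) by blast
    moreover have "\<theta> s = - s" using s a(2) by (auto simp: W_def)
    ultimately have "s = - s" by simp
    then have "2 *\<^sub>R s = 0" by (simp add: scaleR_2 eq_neg_iff_add_eq_0)
    then show "s \<in> {0}" by simp
  qed
  moreover have "x \<in> W" using assms by (simp add: W_def)
  then have "x \<in> a"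
  proof (rule a_max)
    show "br s x = 0" if "s \<in> a" for s using that \<open>a \<subseteq> {0}\<close> by (auto simp: br_simps)
  qed
  ultimately show ?thesis by blast
qed

lemma t0_centraliser:
  assumes "\<And>t. t \<in> t0 \<Longrightarrow> br t x = 0"
  shows "x \<in> t0"
proof -
  have t: "br t (kpart x) = 0" "br t (ppart x) = 0" if "t \<in> t0" for t
    using parts_centralise[OF _ assms[OF that]] t0(2) that by auto
  have "ppart x = 0" by (rule p0_centraliser_trivial[OF parts(2) t(2)])
  moreover have "kpart x \<in> t0" by (rule t0_maximal[OF parts(1) t(1)])
  ultimately show ?thesis using parts(3)[of x] by simp
qed

section \<open>The Hermitian structure on the complexification\<close>

definition cip :: "complex^'n \<Rightarrow> complex^'n \<Rightarrow> complex" where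
  "cip z w = Complex (rip (Re_vec z) (Re_vec w) + rip (Im_vec z) (Im_vec w))
     (rip (Im_vec z) (Re_vec w) - rip (Re_vec z) (Im_vec w))"

text \<open>Minus \<theta> after complex conjugation. The sign comes from \<open>rip_br\<close>,
  where the adjoint of \<open>ad x\<close> is \<open>ad (- \<theta> x)\<close>; the conjugation
  comes from the adjoint being conjugate linear.\<close>

definition cst :: "complex^'n \<Rightarrow> complex^'n" where
  "cst z = complex_vec (- \<theta> (Re_vec z)) (\<theta> (Im_vec z))"

lemmas rip_simps = rip_add rip_scale rip_add_right rip_scale_right rip_minus rip_minus_right rip_diff rip_diff_right

lemma cartan_lie_complexify: "cartan_lie (cbr br) cip cst (complexify t0) (complexify k0) (complexify p0)"
proof unfold_locales
  fix x y z :: "complex^'n" and c :: complex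
  show "cbr br (x + y) z = cbr br x z + cbr br y z" "cbr br x (y + z) = cbr br x y + cbr br x z"
    by (simp_all add: complex_vec_eq_iff br_simps)
  show "cbr br (c *s x) z = c *s cbr br x z" "cbr br x (c *s z) = c *s cbr br x z"
    by (simp_all add: complex_vec_eq_iff br_simps scaleR_add_right scaleR_diff_right)
  show "cbr br x x = 0"
    using br_skew[of "Re_vec x" "Im_vec x"] by (simp add: complex_vec_eq_iff br_self)
  \<comment> \<open>Splits into eight real Jacobi identities, according to the real or imaginary
    part of each argument.\<close>
  show "cbr br x (cbr br y z) = cbr br (cbr br x y) z + cbr br y (cbr br x z)"
    using br_jacobi[of "Re_vec x" "Re_vec y" "Re_vec z"] br_jacobi[of "Re_vec x" "Re_vec y" "Im_vec z"]
      br_jacobi[of "Re_vec x" "Im_vec y" "Re_vec z"] br_jacobi[of "Re_vec x" "Im_vec y" "Im_vec z"]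
      br_jacobi[of "Im_vec x" "Re_vec y" "Re_vec z"] br_jacobi[of "Im_vec x" "Re_vec y" "Im_vec z"]
      br_jacobi[of "Im_vec x" "Im_vec y" "Re_vec z"] br_jacobi[of "Im_vec x" "Im_vec y" "Im_vec z"]
    by (simp add: complex_vec_eq_iff br_simps)
  show "cip (x + y) z = cip x z + cip y z" "cip (c *s x) z = c * cip x z"
    by (simp_all add: cip_def complex_eq_iff rip_simps algebra_simps)
  show "cnj (cip x y) = cip y x"
    by (simp add: cip_def complex_eq_iff rip_commute[of "Re_vec y"] rip_commute[of "Im_vec y"])
  show "Re (cip x x) > 0" if "x \<noteq> 0"
  proof -
    have nn: "rip u u \<ge> 0" for u using rip_pos[of u] by (cases "u = 0") auto
    have "Re_vec x \<noteq> 0 \<or> Im_vec x \<noteq> 0" using that complex_vec_eq_iff[of x 0] by simp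
    then show ?thesis
      using rip_pos[of "Re_vec x"] rip_pos[of "Im_vec x"] nn[of "Re_vec x"] nn[of "Im_vec x"] by (auto simp: cip_def)
  qed
  show "cst (cst x) = x" by (simp add: cst_def complex_vec_eq_iff \<theta>_simps \<theta>_\<theta>)
  show "cst (x + y) = cst x + cst y" by (simp add: cst_def complex_vec_eq_iff \<theta>_simps)
  show "cst (c *s x) = cnj c *s cst x" by (simp add: cst_def complex_vec_eq_iff \<theta>_simps)
  show "cst (cbr br x y) = cbr br (cst y) (cst x)"
    using br_skew[of "\<theta> (Re_vec y)"] br_skew[of "\<theta> (Im_vec y)"]
    by (simp add: cst_def complex_vec_eq_iff \<theta>_simps \<theta>_br br_simps)
  show "cip (cbr br x y) z = cip y (cbr br (cst x) z)"
    by (simp add: cip_def cst_def complex_eq_iff rip_simps rip_br br_simps)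
  show "vec.subspace (complexify t0)" "vec.subspace (complexify k0)" "vec.subspace (complexify p0)"
    using t0(1) subspace_k0 subspace_p0 by (simp_all only: subspace_complexify)
  show "cst x \<in> complexify t0" if "x \<in> complexify t0"
  proof -
    have m: "Re_vec x \<in> t0" "Im_vec x \<in> t0" using that by (simp_all add: complexify_iff)
    then have "\<theta> (Re_vec x) = Re_vec x" "\<theta> (Im_vec x) = Im_vec x" using t0(2) by blast+
    then show ?thesis using m subspace_neg[OF t0(1)] by (simp add: complexify_iff cst_def)
  qed
  show "cbr br x y = 0" if "x \<in> complexify t0" "y \<in> complexify t0"
    using that by (simp add: complexify_iff complex_vec_eq_iff t0(3))
  \<comment> \<open>Testing with real elements of the complexified torus separates the real from the
    imaginary part of x.\<close>
  show "x \<in> complexify t0" if cen: "\<And>H. H \<in> complexify t0 \<Longrightarrow> cbr br H x = 0"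
  proof -
    have "br t (Re_vec x) = 0 \<and> br t (Im_vec x) = 0" if "t \<in> t0" for t
      using cen[of "complex_vec t 0"] that subspace_0[OF t0(1)]
      by (simp add: complexify_iff complex_vec_eq_iff br_simps)
    then show ?thesis using t0_centraliser by (simp add: complexify_iff)
  qed
  show "\<exists>y\<in>complexify k0. \<exists>z\<in>complexify p0. x = y + z"
  proof (intro bexI)
    show "x = complex_vec (kpart (Re_vec x)) (kpart (Im_vec x)) + complex_vec (ppart (Re_vec x)) (ppart (Im_vec x))"
      using parts(3) by (simp add: complex_vec_eq_iff)
  qed (use parts(1,2) in \<open>simp_all add: complexify_iff\<close>)
  show "x = 0" if "x \<in> complexify k0" "x \<in> complexify p0"
  proof -
    have z: "u = 0" if "\<theta> u = u" "\<theta> u = - u" for u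
    proof -
      have "u = - u" using that by simp
      then have "2 *\<^sub>R u = 0" by (simp add: scaleR_2 eq_neg_iff_add_eq_0)
      then show ?thesis by simp
    qed
    show ?thesis using that z by (simp add: complexify_iff complex_vec_eq_iff)
  qed
  show "cbr br x y \<in> complexify k0" if "x \<in> complexify k0" "y \<in> complexify k0"
    using that by (simp add: complexify_iff \<theta>_simps \<theta>_br)
  show "cbr br x y \<in> complexify p0" if "x \<in> complexify k0" "y \<in> complexify p0"
    using that by (simp add: complexify_iff \<theta>_simps \<theta>_br br_simps)
  show "cbr br x y \<in> complexify k0" if "x \<in> complexify p0" "y \<in> complexify p0"
    using that by (simp add: complexify_iff \<theta>_simps \<theta>_br br_simps)
  show "complexify t0 \<subseteq> complexify k0" using t0(2) by (auto simp: complexify_iff)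
qed

end

section \<open>The theorem for the Lie group\<close>

theorem theorem1p1:
  fixes G :: "('g, 'z) monoid_scheme"
    and T :: "'g topology"
    and A :: "('g set \<times> ('g \<Rightarrow> real^'n)) set"
    and br :: "real^'n \<Rightarrow> real^'n \<Rightarrow> real^'n"
    and \<Lambda> :: "real^'n \<Rightarrow> ('g \<Rightarrow> real) \<Rightarrow> ('g \<Rightarrow> real)"
    and K :: "'g set"
    and k0 p0 t0 :: "(real^'n) set"
    and B :: "complex^'n \<Rightarrow> complex^'n \<Rightarrow> complex^'n"
    and k p h :: "(complex^'n) set"
    and \<Delta> \<Delta>k \<Delta>0 Pk P P0 \<Phi> \<Phi>0 \<Phi>k :: "'n functional set"
    and \<nu> \<delta> lam eps :: "'n functional"
    and w0 :: "'n functional \<Rightarrow> 'n functional"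
  assumes "lie_group G T A" and "connected_space T" and "finite_centre G"
    and "is_lie_algebra_of G A br \<Lambda>" and "simple_lie_bracket br"
    and "maximal_compact_subgroup G T K"
    and "k0 = lie_subalgebra_of_subgroup G T A \<Lambda> K"
    and "cartan_decomposition br k0 p0"
    and "\<exists>r. has_rank br UNIV r \<and> has_rank br k0 r"
    and "maximal_abelian_in br k0 t0"
    and "B = cbr br" and "k = complexify k0" and "p = complexify p0" and "h = complexify t0"
    and "\<Delta> = roots B h UNIV" and "\<Delta>k = roots B h k"
    and "semisimple B k"
    and "positive_system \<Delta>k Pk"
    and "borel_de_siebenthal B h k p P" and "Pk \<subseteq> P"
    and "\<Phi> = simple_roots P"
    and "\<nu> \<in> \<Phi>" and "root_space B h \<nu> \<subseteq> p"
    and "highest_root \<Delta> P \<delta>"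
    and "\<Phi>0 = \<Phi> - {\<nu>}"
    and "\<Delta>0 = roots B h (l_zero B h \<Phi> \<nu>)" and "P0 = \<Delta>0 \<inter> Pk"
    and "longest_element B h \<Delta>0 P0 w0"
    and "lam = w0 \<nu>" and "eps = w0 \<delta>"
    and "\<Phi>k = \<Phi>0 \<union> {eps}"
  shows "(\<forall>\<phi> \<nu>'. exchange_data B h k p \<Phi> \<Phi>0 \<Phi>k \<delta> w0 lam \<phi> \<nu>' \<longrightarrow>
           (\<exists>P'. borel_de_siebenthal B h k p P' \<and> Pk \<subseteq> P' \<and>
              simple_roots P' = (\<Phi>k - {\<phi>}) \<union> {\<nu>'}))
       \<and> (\<forall>P'. borel_de_siebenthal B h k p P' \<and> Pk \<subseteq> P' \<longrightarrow>
           P' = P \<or>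
           (\<exists>\<phi> \<nu>'. exchange_data B h k p \<Phi> \<Phi>0 \<Phi>k \<delta> w0 lam \<phi> \<nu>' \<and>
              simple_roots P' = (\<Phi>k - {\<phi>}) \<union> {\<nu>'}))"
proof -
  obtain \<theta> where \<theta>: "cartan_involution br \<theta>" "k0 = {x. \<theta> x = x}" "p0 = {x. \<theta> x = - x}"
    using assms(8) unfolding cartan_decomposition_def by blast
  obtain r where r: "has_rank br UNIV r" "has_rank br k0 r" using assms(9) by blast
  interpret RC: real_cartan br \<theta> t0 r
    using assms(5,10) \<theta>(1) r unfolding \<theta>(2) simple_lie_bracket_def by unfold_locales blast+
  have "cartan_lie B RC.cip RC.cst h k p"
    using RC.cartan_lie_complexify assms(11-14) \<theta>(2,3) by simp
  then interpret CL: cartan_lie B RC.cip RC.cst h k p .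
  note data = assms(15,16,21,25,27,29,30)
  have Pk: "positive_system (roots B h k) Pk" using assms(18) unfolding data .
  have \<nu>: "\<nu> \<in> simple_roots P" using assms(22) unfolding data .
  have \<delta>: "highest_root (roots B h UNIV) P \<delta>" using assms(24) unfolding data .
  have \<Delta>0: "\<Delta>0 = roots B h (l_zero B h (simple_roots P) \<nu>)" using assms(26) unfolding data .
  have w0: "longest_element B h \<Delta>0 (\<Delta>0 \<inter> Pk) w0" using assms(28) unfolding data .
  have \<Phi>k: "\<Phi>k = simple_roots P - {\<nu>} \<union> {w0 \<delta>}" using assms(31) unfolding data .
  show ?thesis
    unfolding data
    by (rule CL.exchange_theorem[OF assms(17) Pk assms(19,20) \<nu> assms(23) \<delta> \<Delta>0 w0 \<Phi>k])
qed

end
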